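(* Let $r \geq 2$ and $c \geq 2$ be integers. There exist polynomials $\tilde{g}_{r,k} \in \mathbb{Z}[x_1,\ldots,x_r]$ for $1 \leq k \leq c$ such that, for any endomorphism $\varphi \in \mathrm{End}(N_{r,c})$, if $p_\varphi = \sum_{i=0}^{r} a_i x^i$ is the characteristic polynomial, with $a_r = 1$, of the endomorphism $\varphi_1 \in \mathrm{End}(N_{r,c}/\gamma_2(N_{r,c}))$ induced by $\varphi$, then $$R(\varphi) = \left|\prod_{k=1}^{c} \tilde{g}_{r,k}(a_0,\ldots,a_{r-1})\right|_\infty.$$
   Context: For a group $G$, put $\gamma_1(G) := G$ and $\gamma_{i+1}(G) := [\gamma_i(G), G]$. Let $F(r)$ be the free group of rank $r$; the free $c$-step nilpotent group of rank $r$ is $N_{r,c} := F(r)/\gamma_{c+1}(F(r))$. The quotient $N_{r,c}/\gamma_2(N_{r,c})$ is free abelian of rank $r$, so an endomorphism of it is given by an integer $r\times r$ matrix and has a monic characteristic polynomial of degree $r$ with integer coefficients. For a group $G$ and $\varphi \in \mathrm{End}(G)$, elements $x,y\in G$ are $\varphi$-conjugate if $x = z y \varphi(z)^{-1}$ for some $z \in G$; this is an equivalence relation, and the Reidemeister number $R(\varphi) \in \{1,2,\ldots\}\cup\{\infty\}$ is the number of equivalence classes ($\infty$ if there are infinitely many). For $n \in \mathbb{Z}$, $|n|_\infty := \infty$ if $n = 0$ and $|n|_\infty := |n|$ otherwise. *)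

theory Defs
  imports
    "HOL-Library.Extended_Nat"
    "HOL-Library.Poly_Mapping"
    "HOL-Algebra.Generated_Groups"
    "Jordan_Normal_Form.Char_Poly"
begin

text \<open>Free groups. A letter \<open>(True, i)\<close> stands for the generator \<open>x\<^sub>i\<close> and \<open>(False, i)\<close> for its
  inverse; elements are the reduced words, and the product of two words is obtained by letting
  the letters of the first act on the second.\<close>

type_synonym letter = "bool \<times> nat"

fun reduced :: "letter list \<Rightarrow> bool" where
  "reduced [] \<longleftrightarrow> True"
| "reduced [a] \<longleftrightarrow> True"
| "reduced (a # b # w) \<longleftrightarrow> \<not> (snd a = snd b \<and> fst a \<noteq> fst b) \<and> reduced (b # w)"

fun reduced_cons :: "letter \<Rightarrow> letter list \<Rightarrow> letter list" where
  "reduced_cons a [] = [a]"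
| "reduced_cons a (b # w) = (if snd a = snd b \<and> fst a \<noteq> fst b then w else a # b # w)"

definition free_group :: "nat \<Rightarrow> letter list monoid" where
  "free_group r = \<lparr>carrier = {w. reduced w \<and> snd ` set w \<subseteq> {..<r}},
                   monoid.mult = (\<lambda>u v. foldr reduced_cons u v),
                   one = []\<rparr>"

lemma reduced_tl: "reduced (a # w) \<Longrightarrow> reduced w"
  by (cases w) auto

lemma reduced_reduced_cons: "reduced w \<Longrightarrow> reduced (reduced_cons a w)"
  by (cases w) (auto dest: reduced_tl)

lemma set_reduced_cons: "set (reduced_cons a w) \<subseteq> insert a (set w)"
  by (cases w) auto

lemma reduced_cons_inverse:
  assumes "reduced w" "snd a = snd b" "fst a \<noteq> fst b"
  shows "reduced_cons a (reduced_cons b w) = w"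
proof (cases w)
  case Nil
  then show ?thesis using assms by auto
next
  case (Cons d v)
  show ?thesis
  proof (cases "snd b = snd d \<and> fst b \<noteq> fst d")
    case True
    then have "a = d" using assms by (auto intro: prod_eqI)
    then show ?thesis using assms True Cons by (cases v) auto
  next
    case False
    then show ?thesis using assms Cons by auto
  qed
qed

lemma foldr_reduced_cons_reduced: "reduced w \<Longrightarrow> reduced (foldr reduced_cons u w)"
  by (induction u) (auto intro: reduced_reduced_cons)

lemma set_foldr_reduced_cons: "set (foldr reduced_cons u w) \<subseteq> set u \<union> set w"
proof (induction u)
  case (Cons a u)
  then show ?case using set_reduced_cons[of a "foldr reduced_cons u w"] by auto
qed auto

lemma foldr_reduced_cons_assoc:
  assumes "reduced v" "reduced w"
  shows "foldr reduced_cons (foldr reduced_cons u v) w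
       = foldr reduced_cons u (foldr reduced_cons v w)"
proof (induction u)
  case (Cons a u)
  have "foldr reduced_cons (reduced_cons a x) w = reduced_cons a (foldr reduced_cons x w)" for x
  proof (cases x)
    case (Cons b y)
    then show ?thesis
      using reduced_cons_inverse[OF foldr_reduced_cons_reduced[OF assms(2)], of a b y] by auto
  qed auto
  with Cons show ?case by simp
qed auto

lemma foldr_reduced_cons_Nil: "reduced u \<Longrightarrow> foldr reduced_cons u [] = u"
proof (induction u)
  case (Cons a u)
  then show ?case by (cases u) (auto dest: reduced_tl)
qed auto

lemma foldr_reduced_cons_inverse_word:
  "reduced w \<Longrightarrow> foldr reduced_cons (rev (map (\<lambda>a. (\<not> fst a, snd a)) u)) (foldr reduced_cons u w) = w"
proof (induction u)
  case (Cons a u)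
  then show ?case
    using reduced_cons_inverse[OF foldr_reduced_cons_reduced[OF Cons.prems], of "(\<not> fst a, snd a)" a u]
    by simp
qed auto

lemma group_free_group: "group (free_group r)"
proof (rule groupI)
  fix u assume u: "u \<in> carrier (free_group r)"
  define v where "v = foldr reduced_cons (rev (map (\<lambda>a. (\<not> fst a, snd a)) u)) []"
  have "v \<in> carrier (free_group r)"
    using u set_foldr_reduced_cons[of "rev (map (\<lambda>a. (\<not> fst a, snd a)) u)" "[]"]
    by (force simp: free_group_def v_def intro: foldr_reduced_cons_reduced)
  moreover have "foldr reduced_cons v u = []"
    using u foldr_reduced_cons_assoc[of "[]" u "rev (map (\<lambda>a. (\<not> fst a, snd a)) u)"]
      foldr_reduced_cons_inverse_word[of "[]" u] foldr_reduced_cons_Nil[of u]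
    by (simp add: v_def free_group_def)
  ultimately show "\<exists>v\<in>carrier (free_group r). v \<otimes>\<^bsub>free_group r\<^esub> u = \<one>\<^bsub>free_group r\<^esub>"
    by (auto simp: free_group_def)
next
  fix u v assume "u \<in> carrier (free_group r)" "v \<in> carrier (free_group r)"
  then show "u \<otimes>\<^bsub>free_group r\<^esub> v \<in> carrier (free_group r)"
    using set_foldr_reduced_cons[of u v]
    by (fastforce simp: free_group_def intro: foldr_reduced_cons_reduced)
qed (auto simp: free_group_def foldr_reduced_cons_assoc foldr_reduced_cons_Nil)

lemma free_group_extend:
  assumes "group G" "f \<in> {..<r} \<rightarrow> carrier G"
  shows "\<exists>h \<in> hom (free_group r) G. \<forall>i<r. h [(True, i)] = f i"
proof -
  interpret G: group G by fact
  define l where "l a = (if fst a then f (snd a) else inv\<^bsub>G\<^esub> f (snd a))" for a :: letter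
  define h where "h w = foldr (\<lambda>a x. l a \<otimes>\<^bsub>G\<^esub> x) w \<one>\<^bsub>G\<^esub>" for w
  have l: "l a \<in> carrier G" if "snd a < r" for a
    using that assms(2) by (auto simp: l_def)
  have h: "h w \<in> carrier G" if "snd ` set w \<subseteq> {..<r}" for w
    using that by (induction w) (auto simp: h_def l)
  have cons: "h (reduced_cons a w) = l a \<otimes>\<^bsub>G\<^esub> h w"
    if "snd a < r" "snd ` set w \<subseteq> {..<r}" for a w
  proof (cases w)
    case Nil
    then show ?thesis by (simp add: h_def)
  next
    case (Cons b v)
    have fb: "f (snd b) \<in> carrier G" and hv: "h v \<in> carrier G"
      using Cons that assms(2) h by auto
    have hc: "h (b # v) = l b \<otimes>\<^bsub>G\<^esub> h v" by (simp add: h_def)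
    show ?thesis
    proof (cases "snd a = snd b \<and> fst a \<noteq> fst b")
      case True
      have "l a \<otimes>\<^bsub>G\<^esub> l b = \<one>\<^bsub>G\<^esub>" using True fb by (auto simp: l_def)
      then have "l a \<otimes>\<^bsub>G\<^esub> h w = h v"
        using Cons hc that l hv by (simp flip: G.m_assoc)
      then show ?thesis using True Cons by simp
    next
      case False
      then show ?thesis using Cons by (auto simp: h_def)
    qed
  qed
  have mult: "h (foldr reduced_cons u v) = h u \<otimes>\<^bsub>G\<^esub> h v"
    if "snd ` set u \<subseteq> {..<r}" "snd ` set v \<subseteq> {..<r}" for u v
    using that(1)
  proof (induction u)
    case Nil
    then show ?case using h[OF that(2)] by (simp add: h_def)
  next
    case (Cons a u)
    have "snd ` set (foldr reduced_cons u v) \<subseteq> {..<r}"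
      using set_foldr_reduced_cons[of u v] Cons.prems that(2) by fastforce
    then have "h (foldr reduced_cons (a # u) v) = l a \<otimes>\<^bsub>G\<^esub> (h u \<otimes>\<^bsub>G\<^esub> h v)"
      using cons Cons by simp
    also have "\<dots> = h (a # u) \<otimes>\<^bsub>G\<^esub> h v"
      using Cons.prems h[of u] h[OF that(2)] l[of a] by (simp add: h_def G.m_assoc)
    finally show ?case .
  qed
  have "h \<in> hom (free_group r) G"
    using h mult by (auto simp: hom_def free_group_def)
  moreover have "h [(True, i)] = f i" if "i < r" for i
    using that l[of "(True, i)"] by (simp add: h_def l_def)
  ultimately show ?thesis by blast
qed

definition commutator_subgroup :: "('a, 'b) monoid_scheme \<Rightarrow> 'a set \<Rightarrow> 'a set \<Rightarrow> 'a set" where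
  "commutator_subgroup G H K =
     generate G {x \<otimes>\<^bsub>G\<^esub> y \<otimes>\<^bsub>G\<^esub> inv\<^bsub>G\<^esub> x \<otimes>\<^bsub>G\<^esub> inv\<^bsub>G\<^esub> y | x y. x \<in> H \<and> y \<in> K}"

text \<open>The series is indexed from 1, as usual; the value at 0 is a dummy.\<close>

fun lower_central :: "('a, 'b) monoid_scheme \<Rightarrow> nat \<Rightarrow> 'a set" where
  "lower_central G 0 = carrier G"
| "lower_central G (Suc 0) = carrier G"
| "lower_central G (Suc (Suc i)) = commutator_subgroup G (lower_central G (Suc i)) (carrier G)"

definition free_nilpotent :: "nat \<Rightarrow> nat \<Rightarrow> letter list set monoid" where
  "free_nilpotent r c = free_group r Mod lower_central (free_group r) (c + 1)"

text \<open>For an endomorphism \<open>\<phi>\<close> of \<open>G\<close> mapping the normal subgroup \<open>H\<close> into itself,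
  \<open>\<phi>(gH) H = \<phi>(g) H\<close>, so this is the endomorphism of \<open>G / H\<close> induced by \<open>\<phi>\<close>.\<close>

definition induced_map :: "('a, 'b) monoid_scheme \<Rightarrow> 'a set \<Rightarrow> ('a \<Rightarrow> 'a) \<Rightarrow> 'a set \<Rightarrow> 'a set" where
  "induced_map G H \<phi> C = (\<phi> ` C) <#>\<^bsub>G\<^esub> H"

definition Z_basis :: "('a, 'b) monoid_scheme \<Rightarrow> nat \<Rightarrow> (nat \<Rightarrow> 'a) \<Rightarrow> bool" where
  "Z_basis A n b \<longleftrightarrow> b \<in> {..<n} \<rightarrow> carrier A \<and>
     (\<forall>x\<in>carrier A. \<exists>!k :: nat \<Rightarrow> int. k \<in> extensional {..<n} \<and>
        x = finprod A (\<lambda>i. b i [^]\<^bsub>A\<^esub> k i) {..<n})"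

text \<open>The characteristic polynomial of an endomorphism of a free abelian group \<open>A\<close> (written
  multiplicatively) of rank \<open>n\<close>; it does not depend on the basis.\<close>

definition endo_char_poly :: "('a, 'b) monoid_scheme \<Rightarrow> nat \<Rightarrow> ('a \<Rightarrow> 'a) \<Rightarrow> int poly" where
  "endo_char_poly A n \<psi> = (THE p. \<exists>b M. Z_basis A n b \<and> M \<in> carrier_mat n n \<and>
     (\<forall>j<n. \<psi> (b j) = finprod A (\<lambda>i. b i [^]\<^bsub>A\<^esub> (M $$ (i, j))) {..<n}) \<and>
     p = char_poly M)"

definition twisted_conj :: "('a, 'b) monoid_scheme \<Rightarrow> ('a \<Rightarrow> 'a) \<Rightarrow> ('a \<times> 'a) set" where
  "twisted_conj G \<phi> = {(x, y). x \<in> carrier G \<and> y \<in> carrier G \<and>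
     (\<exists>z\<in>carrier G. x = z \<otimes>\<^bsub>G\<^esub> y \<otimes>\<^bsub>G\<^esub> inv\<^bsub>G\<^esub> (\<phi> z))}"

definition reidemeister_number :: "('a, 'b) monoid_scheme \<Rightarrow> ('a \<Rightarrow> 'a) \<Rightarrow> enat" where
  "reidemeister_number G \<phi> =
     (let Q = carrier G // twisted_conj G \<phi>
      in if finite Q then enat (card Q) else \<infinity>)"

definition abs_infty :: "int \<Rightarrow> enat" where
  "abs_infty n = (if n = 0 then \<infinity> else enat (nat \<bar>n\<bar>))"

text \<open>Multivariate polynomials map exponent vectors to coefficients.\<close>

type_synonym int_mpoly = "(nat \<Rightarrow>\<^sub>0 nat) \<Rightarrow>\<^sub>0 int"

definition mpolys_in :: "nat set \<Rightarrow> int_mpoly set" where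
  "mpolys_in V = {p. \<forall>m\<in>Poly_Mapping.keys p. Poly_Mapping.keys m \<subseteq> V}"

definition mpoly_eval :: "(nat \<Rightarrow> int) \<Rightarrow> int_mpoly \<Rightarrow> int" where
  "mpoly_eval x p = (\<Sum>m\<in>Poly_Mapping.keys p.
     Poly_Mapping.lookup p m * (\<Prod>i\<in>Poly_Mapping.keys m. x i ^ Poly_Mapping.lookup m i))"

end

theory Submission
  imports Defs "HOL-Library.List_Lexorder" "Jordan_Normal_Form.Column_Operations"
begin

text \<open>
  Let \<open>F\<close> be the free group of rank \<open>r\<close>. An endomorphism \<open>\<phi>\<close> of \<open>N\<^sub>r\<^sub>,\<^sub>c\<close> lifts to an endomorphism \<open>\<Phi>\<close> of
  \<open>F\<close>, and \<open>\<Phi>\<close> acts on each \<open>\<gamma>\<^sub>k(F) / \<gamma>\<^sub>k\<^sub>+\<^sub>1(F)\<close>. By the theorem of Magnus and Witt this quotient is free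
  abelian: commutators of Lyndon words generate it, and the leading term of the Magnus expansion of
  such a commutator is the Lyndon word plus larger words. On leading terms \<open>\<Phi>\<close> acts as the \<open>k\<close>-th
  tensor power of its abelianization \<open>A\<close>, so in suitable coordinates the action is a matrix \<open>M\<^sub>k(A)\<close>
  that is multiplicative in \<open>A\<close> and polynomial in the entries of \<open>A\<close>.

  Twisted conjugacy classes are counted along the lower central series: while the determinants
  \<open>det(1 - M\<^sub>k(A))\<close> are nonzero, an element that twistedly fixes a class modulo \<open>\<gamma>\<^sub>k\<close> lies in \<open>\<gamma>\<^sub>k\<close>, so each
  class splits into \<open>\<bar>det(1 - M\<^sub>k(A))\<bar>\<close> classes modulo \<open>\<gamma>\<^sub>k\<^sub>+\<^sub>1\<close>; the first zero determinant gives
  infinitely many classes.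

  Finally \<open>det(1 - M\<^sub>k(A))\<close> only depends on the characteristic polynomial: if \<open>e\<^sub>0\<close> is a cyclic vector,
  then \<open>A K = K C\<close> with the Krylov matrix \<open>K\<close> and the companion matrix \<open>C\<close> of the characteristic
  polynomial, and multiplicativity of \<open>M\<^sub>k\<close> gives \<open>det(1 - M\<^sub>k(A)) = det(1 - M\<^sub>k(C))\<close>. The general case
  follows by a polynomial deformation, and the right-hand side is a polynomial in the coefficients.
\<close>

section \<open>Cosets of an integer lattice\<close>

text \<open>The graded Lie ring and the quotients gamma_k / gamma_(k+1) are never formed. Statements
  about them become statements about subgroups lying between gamma_(k+1) and gamma_k, or about
  Lyndon coefficients of leading terms. These coefficients suffice because the passage from Lyndon
  commutators to Lyndon coefficients is triangular with ones on the diagonal, hence invertible over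
  the integers.

  Reading only Lyndon coefficients is also the obstacle to multiplicativity of M_k: tensor powers
  are multiplicative, but their restriction to the lattice of leading terms is so only if that
  lattice is invariant under every integer matrix. Invariance comes from freeness: every integer
  matrix is the abelianization of some endomorphism of F, and endomorphisms preserve gamma_k.

  The Krylov matrix K is invertible over the rationals at best. Its adjugate replaces the inverse:
  M_k(K) M_k(adj K) is det(K)^k times the identity, so det M_k(K) is nonzero whenever det K is.

  The count |det(1 - M_k)| is the index of the lattice spanned by the columns of 1 - M_k; it is
  computed by integer column operations.\<close>

definition lattice_transversal :: "nat \<Rightarrow> int mat \<Rightarrow> int vec set \<Rightarrow> bool" where
  "lattice_transversal n M E \<longleftrightarrow> E \<subseteq> carrier_vec n \<and>
     (\<forall>x\<in>carrier_vec n. \<exists>e\<in>E. \<exists>y\<in>carrier_vec n. x = e + M *\<^sub>v y) \<and>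
     (\<forall>e\<in>E. \<forall>e'\<in>E. \<forall>y\<in>carrier_vec n. e = e' + M *\<^sub>v y \<longrightarrow> e = e')"

text \<open>\<open>U\<close> is unimodular, with \<open>V\<close> as witness of its inverse, so the
  columns of \<open>M\<close> and \<open>N\<close> span the same lattice.\<close>

definition column_equiv :: "nat \<Rightarrow> int mat \<Rightarrow> int mat \<Rightarrow> bool" where
  "column_equiv n M N \<longleftrightarrow> (\<exists>U\<in>carrier_mat n n. \<exists>V\<in>carrier_mat n n. U * V = 1\<^sub>m n \<and> V * U = 1\<^sub>m n \<and> N = M * U)"

lemma column_equiv_refl: "M \<in> carrier_mat n n \<Longrightarrow> column_equiv n M M"
  unfolding column_equiv_def by (intro bexI[of _ "1\<^sub>m n"]) auto

lemma column_equiv_trans: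
  assumes M: "M \<in> carrier_mat n n" and "column_equiv n M N" "column_equiv n N P"
  shows "column_equiv n M P"
proof -
  from assms obtain U V U' V' where U: "U \<in> carrier_mat n n" "V \<in> carrier_mat n n"
    "U * V = 1\<^sub>m n" "V * U = 1\<^sub>m n" "N = M * U"
    and U': "U' \<in> carrier_mat n n" "V' \<in> carrier_mat n n"
    "U' * V' = 1\<^sub>m n" "V' * U' = 1\<^sub>m n" "P = N * U'"
    unfolding column_equiv_def by blast
  have "U' * (V' * V) = V" "V * (U * U') = U'"
    using assoc_mult_mat[OF U'(1,2) U(2)] assoc_mult_mat[OF U(2,1) U'(1)] U U' by simp_all
  then have 1: "(U * U') * (V' * V) = 1\<^sub>m n" and 2: "(V' * V) * (U * U') = 1\<^sub>m n"
    using assoc_mult_mat[OF U(1) U'(1), of "V' * V" n] assoc_mult_mat[OF U'(2) U(2), of "U * U'" n] U U'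
    by simp_all
  have "P = M * (U * U')" using U U' M by simp
  then show ?thesis
    unfolding column_equiv_def using 1 2 U U' by (intro bexI[of _ "U * U'"] bexI[of _ "V' * V"]) auto
qed

lemma column_equiv_carrier: "M \<in> carrier_mat n n \<Longrightarrow> column_equiv n M N \<Longrightarrow> N \<in> carrier_mat n n"
  by (auto simp: column_equiv_def)

lemma column_equiv_addcol:
  assumes "M \<in> carrier_mat n n" "k < n" "l < n" "k \<noteq> l"
  shows "column_equiv n M (addcol a k l M)"
  unfolding column_equiv_def
  using assms addcol_mat[OF assms(1,3), of a k] addrow_mat_inv[of l n k a] addrow_mat_inv[of l n k "- a"]
  by (intro bexI[of _ "addrow_mat n a l k"] bexI[of _ "addrow_mat n (- a) l k"]) auto

lemma column_equiv_swapcols: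
  assumes "M \<in> carrier_mat n n" "k < n" "l < n"
  shows "column_equiv n M (swapcols k l M)"
  unfolding column_equiv_def
  using assms swapcols_mat[OF assms] swaprows_mat_inv[of k n l]
  by (intro bexI[of _ "swaprows_mat n k l"]) auto

lemma column_equiv_det:
  assumes "M \<in> carrier_mat n n" "column_equiv n M N"
  shows "\<bar>det N\<bar> = \<bar>det M\<bar>"
proof -
  obtain U V where U: "U \<in> carrier_mat n n" "V \<in> carrier_mat n n" "U * V = 1\<^sub>m n" "N = M * U"
    using assms unfolding column_equiv_def by blast
  have "det U * det V = 1" using det_mult[OF U(1,2)] U(3) by simp
  then have "\<bar>det U\<bar> = 1" using zmult_eq_1_iff by fastforce
  then show ?thesis using det_mult[OF assms(1) U(1)] U(4) by (simp add: abs_mult)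
qed

lemma lattice_transversal_column_equiv:
  assumes M: "M \<in> carrier_mat n n" and eq: "column_equiv n M N" and E: "lattice_transversal n N E"
  shows "lattice_transversal n M E"
proof -
  obtain U V where U: "U \<in> carrier_mat n n" "V \<in> carrier_mat n n" "U * V = 1\<^sub>m n" "N = M * U"
    using eq unfolding column_equiv_def by blast
  have N: "N *\<^sub>v y = M *\<^sub>v (U *\<^sub>v y)" if "y \<in> carrier_vec n" for y
    using U M that by simp
  have M': "M *\<^sub>v y = N *\<^sub>v (V *\<^sub>v y)" if y: "y \<in> carrier_vec n" for y
  proof -
    have "U *\<^sub>v (V *\<^sub>v y) = y" using assoc_mult_mat_vec[OF U(1,2) y] U(3) y by simp
    then show ?thesis using N[of "V *\<^sub>v y"] U y by simp
  qed
  show ?thesis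
    unfolding lattice_transversal_def
  proof (intro conjI ballI impI)
    show "E \<subseteq> carrier_vec n" using E by (simp add: lattice_transversal_def)
    fix x :: "int vec" assume "x \<in> carrier_vec n"
    then obtain e y where "e \<in> E" "y \<in> carrier_vec n" "x = e + N *\<^sub>v y"
      using E unfolding lattice_transversal_def by blast
    then show "\<exists>e\<in>E. \<exists>y\<in>carrier_vec n. x = e + M *\<^sub>v y"
      using N U by (intro bexI[of _ e] bexI[of _ "U *\<^sub>v y"]) auto
  next
    fix e e' y assume *: "e \<in> E" "e' \<in> E" "y \<in> carrier_vec n" "e = e' + M *\<^sub>v y"
    then have "e = e' + N *\<^sub>v (V *\<^sub>v y)" using M' by simp
    then show "e = e'" using E * U unfolding lattice_transversal_def by (metis mult_mat_vec_carrier)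
  qed
qed

text \<open>The Euclidean algorithm phrased as minimality: in a column-equivalent matrix whose first
  row has the least sum of absolute values, two nonzero entries could still be reduced against each
  other. So at most one is left, and a swap brings it to the front.\<close>

lemma column_equiv_first_row:
  assumes "M \<in> carrier_mat (Suc n) (Suc n)"
  shows "\<exists>N. column_equiv (Suc n) M N \<and> (\<forall>j. 0 < j \<and> j < Suc n \<longrightarrow> N $$ (0, j) = 0)"
proof -
  define weight where "weight N = (\<Sum>j<Suc n. nat \<bar>N $$ (0, j)\<bar>)" for N :: "int mat"
  obtain N where N: "column_equiv (Suc n) M N" and min: "\<And>N'. column_equiv (Suc n) M N' \<Longrightarrow> weight N \<le> weight N'"
    using ex_has_least_nat[of "column_equiv (Suc n) M" M weight] column_equiv_refl[OF assms] by blast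
  have Nc: "N \<in> carrier_mat (Suc n) (Suc n)" using column_equiv_carrier assms N by blast
  have no_two: False if kl: "k < Suc n" "l < Suc n" "k \<noteq> l" "N $$ (0, l) \<noteq> 0" "\<bar>N $$ (0, l)\<bar> \<le> \<bar>N $$ (0, k)\<bar>" for k l
  proof -
    \<comment> \<open>Column \<open>k\<close> receives \<open>a\<close> times column
      \<open>l\<close>; with this sign the entry of column \<open>k\<close> loses exactly the
      absolute value of the entry of column \<open>l\<close>.\<close>
    define a :: int where "a = (if (N $$ (0, l) > 0) = (N $$ (0, k) > 0) then -1 else 1)"
    let ?N = "addcol a k l N"
    have "column_equiv (Suc n) M ?N"
      using column_equiv_trans[OF assms N] column_equiv_addcol[OF Nc kl(1-3)] by blast
    then have "weight N \<le> weight ?N" by (rule min)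
    moreover have "weight ?N < weight N"
      unfolding weight_def
    proof (rule sum_strict_mono_ex1)
      show "\<forall>j\<in>{..<Suc n}. nat \<bar>?N $$ (0, j)\<bar> \<le> nat \<bar>N $$ (0, j)\<bar>"
        using Nc kl by (auto simp: mat_addcol_def a_def)
      show "\<exists>j\<in>{..<Suc n}. nat \<bar>?N $$ (0, j)\<bar> < nat \<bar>N $$ (0, j)\<bar>"
        using Nc kl by (intro bexI[of _ k]) (auto simp: mat_addcol_def a_def)
    qed simp
    ultimately show False by simp
  qed
  have uniq: "k = l" if "k < Suc n" "l < Suc n" "N $$ (0, k) \<noteq> 0" "N $$ (0, l) \<noteq> 0" for k l
    using no_two[of k l] no_two[of l k] that by (metis linear)
  show ?thesis
  proof (cases "\<exists>k<Suc n. N $$ (0, k) \<noteq> 0")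
    case True
    then obtain k where k: "k < Suc n" "N $$ (0, k) \<noteq> 0" by blast
    have "swapcols 0 k N $$ (0, j) = 0" if "0 < j" "j < Suc n" for j
      using that Nc uniq[of j k] uniq[of 0 k] k by (auto simp: mat_swapcols_def)
    moreover have "column_equiv (Suc n) M (swapcols 0 k N)"
      using column_equiv_trans[OF assms N] column_equiv_swapcols[OF Nc _ k(1), of 0] by blast
    ultimately show ?thesis by blast
  qed (use N in blast)
qed

text \<open>Column operations turn the first row into (d, 0, ..., 0). A coset is then given by a
  residue of the first coordinate modulo \<open>d\<close> and a coset of the smaller block
  \<open>P\<close>, matching \<open>det N = d * det P\<close>.\<close>

lemma finite_lattice_transversal:
  assumes "M \<in> carrier_mat n n" "det M \<noteq> 0"
  shows "\<exists>E. lattice_transversal n M E \<and> finite E \<and> card E = nat \<bar>det M\<bar>"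
  using assms
proof (induction n arbitrary: M)
  case 0
  have "v = 0\<^sub>v 0" if "v \<in> carrier_vec 0" for v :: "int vec" using that by auto
  then have "lattice_transversal 0 M {0\<^sub>v 0}"
    unfolding lattice_transversal_def
    by (intro conjI ballI impI bexI[of _ "0\<^sub>v 0"] eq_vecI) (use 0 in auto)
  moreover have "det M = 1" using 0 by simp
  ultimately show ?case by (intro exI[of _ "{0\<^sub>v 0}"]) auto
next
  case (Suc n)
  obtain N where eq: "column_equiv (Suc n) M N" and N0: "\<And>j. 0 < j \<Longrightarrow> j < Suc n \<Longrightarrow> N $$ (0, j) = 0"
    using column_equiv_first_row[OF Suc.prems(1)] by blast
  have Nc: "N \<in> carrier_mat (Suc n) (Suc n)" using column_equiv_carrier Suc.prems eq by blast
  define d where "d = N $$ (0, 0)"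
  define D where "D = mat 1 1 (\<lambda>_. d)"
  define B where "B = mat n 1 (\<lambda>(i, _). N $$ (Suc i, 0))"
  define P where "P = mat n n (\<lambda>(i, j). N $$ (Suc i, Suc j))"
  have car: "D \<in> carrier_mat 1 1" "B \<in> carrier_mat n 1" "P \<in> carrier_mat n n"
    by (simp_all add: D_def B_def P_def)
  have blk: "N = four_block_mat D (0\<^sub>m 1 n) B P"
    using Nc N0 by (intro eq_matI) (auto simp: D_def B_def P_def d_def)
  have "det N = det D * det P" unfolding blk by (rule det_four_block_mat_upper_right_zero) (use car in auto)
  also have "det D = d" using det_single[OF car(1)] by (simp add: D_def)
  finally have detN: "det N = d * det P" .
  have detM: "\<bar>det N\<bar> = \<bar>det M\<bar>" using column_equiv_det[OF Suc.prems(1) eq] .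
  then have d: "d \<noteq> 0" and "det P \<noteq> 0" using detN Suc.prems by auto
  then obtain E where E: "lattice_transversal n P E" "finite E" "card E = nat \<bar>det P\<bar>"
    using Suc.IH car by blast
  have Ec: "e \<in> carrier_vec n" if "e \<in> E" for e using E that by (auto simp: lattice_transversal_def)
  define single where "single a = vec 1 (\<lambda>_. a)" for a :: int
  have single: "single a \<in> carrier_vec 1" "single a $ 0 = a" for a by (simp_all add: single_def)
  define F where "F = (\<lambda>(a, e). single a @\<^sub>v e) ` ({0..<\<bar>d\<bar>} \<times> E)"
  have app_inj: "single a @\<^sub>v e = single b @\<^sub>v e' \<longleftrightarrow> a = b \<and> e = e'" for a b e e'
    using append_vec_eq[OF single(1) single(1)] single(2) by metis
  have Nmult: "N *\<^sub>v (single q @\<^sub>v y) = single (d * q) @\<^sub>v (B *\<^sub>v single q + P *\<^sub>v y)"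
    if "y \<in> carrier_vec n" for q y
  proof -
    have "D *\<^sub>v single q + 0\<^sub>m 1 n *\<^sub>v y = single (d * q)"
      using that by (intro eq_vecI) (auto simp: D_def single_def scalar_prod_def)
    then show ?thesis unfolding blk using four_block_mat_mult_vec[OF car(1) _ car(2,3) single(1) that] by simp
  qed
  have add_app: "(single a @\<^sub>v x) + (single b @\<^sub>v y) = single (a + b) @\<^sub>v (x + y)"
    if "x \<in> carrier_vec n" "y \<in> carrier_vec n" for a b x y
    using that by (intro eq_vecI) (auto simp: single_def)
  have split: "\<exists>a y. y \<in> carrier_vec n \<and> x = single a @\<^sub>v y" if "x \<in> carrier_vec (Suc n)" for x :: "int vec"
    using that by (intro exI[of _ "x $ 0"] exI[of _ "vec n (\<lambda>i. x $ Suc i)"] conjI eq_vecI) (auto simp: single_def)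
  have F: "lattice_transversal (Suc n) N F"
    unfolding lattice_transversal_def
  proof (intro conjI ballI impI)
    have "single a @\<^sub>v e \<in> carrier_vec (1 + n)" if "e \<in> E" for a e
      using single(1) Ec[OF that] by (rule append_carrier_vec)
    then show "F \<subseteq> carrier_vec (Suc n)" by (auto simp: F_def)
    fix x :: "int vec" assume "x \<in> carrier_vec (Suc n)"
    then obtain a y where x: "y \<in> carrier_vec n" "x = single a @\<^sub>v y" using split by blast
    \<comment> \<open>As \<open>d\<close> may be negative, the quotient is taken by
      \<open>\<bar>d\<bar>\<close> and corrected by the sign of \<open>d\<close>; the remainder is
      then in the range used for \<open>F\<close>.\<close>
    define q where "q = sgn d * (a div \<bar>d\<bar>)"
    have "d * q = \<bar>d\<bar> * (a div \<bar>d\<bar>)" by (simp add: q_def mult.assoc[symmetric] abs_sgn mult.commute)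
    then have a: "a = a mod \<bar>d\<bar> + d * q" by simp
    \<comment> \<open>Subtracting \<open>q\<close> times the first column of \<open>N\<close> also
      changes the lower coordinates, by \<open>B *\<^sub>v single q\<close>; this is removed before
      the representative of the smaller block is chosen.\<close>
    obtain e z where ez: "e \<in> E" "z \<in> carrier_vec n" "y - B *\<^sub>v single q = e + P *\<^sub>v z"
      using E(1) x car single unfolding lattice_transversal_def by (metis minus_carrier_vec mult_mat_vec_carrier)
    have Bq: "B *\<^sub>v single q \<in> carrier_vec n" "P *\<^sub>v z \<in> carrier_vec n"
      using car single ez by (auto intro: mult_mat_vec_carrier)
    have y: "y = e + (B *\<^sub>v single q + P *\<^sub>v z)"
    proof (rule eq_vecI)
      fix i assume "i < dim_vec (e + (B *\<^sub>v single q + P *\<^sub>v z))"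
      then have i: "i < n" using car by simp
      have "(y - B *\<^sub>v single q) $ i = (e + P *\<^sub>v z) $ i" using ez(3) by simp
      then show "y $ i = (e + (B *\<^sub>v single q + P *\<^sub>v z)) $ i"
        using i car x(1) Ec[OF ez(1)] by (simp del: index_mult_mat_vec)
    qed (use x Bq car in simp)
    have "x = (single (a mod \<bar>d\<bar>) @\<^sub>v e) + N *\<^sub>v (single q @\<^sub>v z)"
      using x y a Ec[OF ez(1)] Bq by (simp add: Nmult[OF ez(2)] add_app)
    moreover have "single (a mod \<bar>d\<bar>) @\<^sub>v e \<in> F" using d ez by (auto simp: F_def)
    moreover have "single q @\<^sub>v z \<in> carrier_vec (Suc n)"
      using append_carrier_vec[OF single(1)[of q] ez(2)] by simp
    ultimately show "\<exists>e\<in>F. \<exists>y\<in>carrier_vec (Suc n). x = e + N *\<^sub>v y" by blast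
  next
    fix e e' y assume *: "e \<in> F" "e' \<in> F" "y \<in> carrier_vec (Suc n)" "e = e' + N *\<^sub>v y"
    obtain a e1 where e: "e = single a @\<^sub>v e1" "a \<in> {0..<\<bar>d\<bar>}" "e1 \<in> E" using *(1) by (auto simp: F_def)
    obtain b e2 where e': "e' = single b @\<^sub>v e2" "b \<in> {0..<\<bar>d\<bar>}" "e2 \<in> E" using *(2) by (auto simp: F_def)
    obtain q z where y: "z \<in> carrier_vec n" "y = single q @\<^sub>v z" using split *(3) by blast
    have Bq: "B *\<^sub>v single q \<in> carrier_vec n" "P *\<^sub>v z \<in> carrier_vec n"
      using car single y by (auto intro: mult_mat_vec_carrier)
    have "single a @\<^sub>v e1 = single (b + d * q) @\<^sub>v (e2 + (B *\<^sub>v single q + P *\<^sub>v z))"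
      using *(4) e e' y Ec Bq by (simp add: Nmult add_app)
    then have ab: "a = b + d * q" and e12: "e1 = e2 + (B *\<^sub>v single q + P *\<^sub>v z)" using app_inj by auto
    have "a mod \<bar>d\<bar> = b mod \<bar>d\<bar>" using ab by (simp add: mod_eq_dvd_iff)
    then have "a = b" using e(2) e'(2) by simp
    then have "q = 0" using ab d by simp
    then have "B *\<^sub>v single q = 0\<^sub>v n" using car by (intro eq_vecI) (auto simp: single_def scalar_prod_def)
    then have "e1 = e2 + P *\<^sub>v z" using e12 Bq by simp
    then have "e1 = e2" using E(1) e e' y unfolding lattice_transversal_def by blast
    then show "e = e'" using e e' \<open>a = b\<close> by simp
  qed
  have "inj_on (\<lambda>(a, e). single a @\<^sub>v e) ({0..<\<bar>d\<bar>} \<times> E)"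
    by (rule inj_onI) (auto simp: app_inj)
  then have "card F = card ({0..<\<bar>d\<bar>} \<times> E)" unfolding F_def by (rule card_image)
  also have "\<dots> = nat \<bar>det N\<bar>" using E detN by (simp add: card_cartesian_product abs_mult nat_mult_distrib)
  finally have "card F = nat \<bar>det M\<bar>" using detM by simp
  moreover have "finite F" using E by (simp add: F_def)
  ultimately show ?case using lattice_transversal_column_equiv[OF Suc.prems(1) eq F] by blast
qed

text \<open>A nonzero vector \<open>v\<close> in the kernel of the transpose is a linear functional
  vanishing on the image of \<open>M\<close>. It separates the multiples of a unit vector at a
  position where \<open>v\<close> does not vanish.\<close>

lemma infinite_lattice_cosets:
  fixes M :: "int mat"
  assumes M: "M \<in> carrier_mat n n" and "det M = 0"
  shows "\<exists>E. E \<subseteq> carrier_vec n \<and> infinite E \<and>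
    (\<forall>e\<in>E. \<forall>e'\<in>E. \<forall>y\<in>carrier_vec n. e = e' + M *\<^sub>v y \<longrightarrow> e = e')"
proof -
  have "det (transpose_mat M) = 0" using det_transpose[OF M] assms by simp
  then obtain v where v: "v \<in> carrier_vec n" "v \<noteq> 0\<^sub>v n" "transpose_mat M *\<^sub>v v = 0\<^sub>v n"
    using det_0_iff_vec_prod_zero[of "transpose_mat M" n] M by auto
  then obtain i where i: "i < n" "v $ i \<noteq> 0" by (metis eq_vecI carrier_vecD index_zero_vec)
  have ker: "v \<bullet> (M *\<^sub>v y) = 0" if "y \<in> carrier_vec n" for y
  proof -
    have "v \<bullet> (M *\<^sub>v y) = (transpose_mat M *\<^sub>v v) \<bullet> y"
      using transpose_vec_mult_scalar[OF M that v(1)] by simp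
    then show ?thesis using v that by simp
  qed
  define E where "E = range (\<lambda>t :: int. t \<cdot>\<^sub>v unit_vec n i)"
  have val: "v \<bullet> (t \<cdot>\<^sub>v unit_vec n i) = t * v $ i" for t using v i by simp
  have inj: "inj (\<lambda>t :: int. t \<cdot>\<^sub>v unit_vec n i)"
  proof (rule injI)
    fix s t :: int assume "s \<cdot>\<^sub>v unit_vec n i = t \<cdot>\<^sub>v unit_vec n i"
    then have "s * v $ i = t * v $ i" using val by metis
    then show "s = t" using i by simp
  qed
  show ?thesis
  proof (intro exI[of _ E] conjI ballI impI)
    show "infinite E" unfolding E_def using finite_imageD[OF _ inj] infinite_UNIV_int by blast
    show "E \<subseteq> carrier_vec n" by (auto simp: E_def)
    fix e e' y assume *: "e \<in> E" "e' \<in> E" "y \<in> carrier_vec n" "e = e' + M *\<^sub>v y"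
    then obtain s t where st: "e = s \<cdot>\<^sub>v unit_vec n i" "e' = t \<cdot>\<^sub>v unit_vec n i" by (auto simp: E_def)
    have "v \<bullet> e = v \<bullet> e' + v \<bullet> (M *\<^sub>v y)"
      unfolding *(4) using v M *(3) st by (intro scalar_prod_add_distrib[of _ n]) auto
    then have "s * v $ i = t * v $ i" using ker[OF *(3)] st val by simp
    then show "e = e'" using i st by simp
  qed
qed

section \<open>Polynomial functions and companion matrices\<close>

text \<open>Used twice: for polynomial functions of one variable, which carry the deformation, and
  for functions given by multivariate polynomials, which give the final answer.\<close>

locale fun_subring =
  fixes S :: "('x \<Rightarrow> int) set"
  assumes const: "(\<lambda>_. c) \<in> S"
    and add: "f \<in> S \<Longrightarrow> g \<in> S \<Longrightarrow> (\<lambda>x. f x + g x) \<in> S"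
    and mult: "f \<in> S \<Longrightarrow> g \<in> S \<Longrightarrow> (\<lambda>x. f x * g x) \<in> S"
begin

lemma uminus: "f \<in> S \<Longrightarrow> (\<lambda>x. - f x) \<in> S"
  using mult[OF const[of "-1"], of f] by simp

lemma diff: "f \<in> S \<Longrightarrow> g \<in> S \<Longrightarrow> (\<lambda>x. f x - g x) \<in> S"
  using add[OF _ uminus, of f g] by simp

lemma sum: "(\<And>i. i \<in> I \<Longrightarrow> f i \<in> S) \<Longrightarrow> (\<lambda>x. \<Sum>i\<in>I. f i x) \<in> S"
  by (induction I rule: infinite_finite_induct) (auto intro: const add)

lemma prod: "(\<And>i. i \<in> I \<Longrightarrow> f i \<in> S) \<Longrightarrow> (\<lambda>x. \<Prod>i\<in>I. f i x) \<in> S"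
  by (induction I rule: infinite_finite_induct) (auto intro: const mult)

lemma det:
  assumes "\<And>x. A x \<in> carrier_mat n n" "\<And>i j. i < n \<Longrightarrow> j < n \<Longrightarrow> (\<lambda>x. A x $$ (i, j)) \<in> S"
  shows "(\<lambda>x. det (A x)) \<in> S"
proof -
  have "(\<lambda>x. \<Sum>p\<in>{p. p permutes {0..<n}}. signof p * (\<Prod>i = 0..<n. A x $$ (i, p i))) \<in> S"
    by (intro sum mult const prod assms(2)) (auto dest: permutes_in_image)
  then show ?thesis by (simp add: det_def'[OF assms(1)])
qed

text \<open>The polynomials \<open>F x\<close> have an indeterminate of their own, independent of
  \<open>x\<close>: a characteristic polynomial is a determinant over \<open>int poly\<close>, and
  its coefficients are to be followed as functions of \<open>x\<close>.\<close>

definition poly_coeffs_in :: "('x \<Rightarrow> int poly) \<Rightarrow> bool" where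
  "poly_coeffs_in F \<longleftrightarrow> (\<forall>k. (\<lambda>x. coeff (F x) k) \<in> S)"

lemma poly_coeffs_in_mult: "poly_coeffs_in F \<Longrightarrow> poly_coeffs_in H \<Longrightarrow> poly_coeffs_in (\<lambda>x. F x * H x)"
  unfolding poly_coeffs_in_def coeff_mult by (intro allI sum mult) auto

lemma poly_coeffs_in_sum: "(\<And>i. i \<in> I \<Longrightarrow> poly_coeffs_in (F i)) \<Longrightarrow> poly_coeffs_in (\<lambda>x. \<Sum>i\<in>I. F i x)"
  unfolding poly_coeffs_in_def coeff_sum by (intro allI sum) auto

lemma poly_coeffs_in_const: "poly_coeffs_in (\<lambda>_. p)"
  unfolding poly_coeffs_in_def by (intro allI const)

lemma poly_coeffs_in_prod: "(\<And>i. i \<in> I \<Longrightarrow> poly_coeffs_in (F i)) \<Longrightarrow> poly_coeffs_in (\<lambda>x. \<Prod>i\<in>I. F i x)"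
  by (induction I rule: infinite_finite_induct) (auto intro: poly_coeffs_in_const poly_coeffs_in_mult)

lemma char_poly_coeff:
  assumes "\<And>x. A x \<in> carrier_mat n n" "\<And>i j. i < n \<Longrightarrow> j < n \<Longrightarrow> (\<lambda>x. A x $$ (i, j)) \<in> S"
  shows "(\<lambda>x. coeff (char_poly (A x)) k) \<in> S"
proof -
  have entry: "poly_coeffs_in (\<lambda>x. char_poly_matrix (A x) $$ (i, j))" if ij: "i < n" "j < n" for i j
  proof -
    have dims: "dim_row (A x) = n" "dim_col (A x) = n" for x using assms(1)[of x] by auto
    have "char_poly_matrix (A x) $$ (i, j) = (if i = j then [:0, 1:] else 0) + [: - A x $$ (i, j) :]" for x
      unfolding char_poly_matrix_def using ij dims by simp
    then have eq: "coeff (char_poly_matrix (A x) $$ (i, j)) k =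
        coeff (if i = j then [:0, 1:] else 0) k + (if k = 0 then - A x $$ (i, j) else 0)" for x k
      by (simp add: coeff_pCons split: nat.split)
    have "(\<lambda>x. if k = 0 then - A x $$ (i, j) else 0) \<in> S" for k
      using uminus[OF assms(2)[OF ij]] const[of 0] by (cases "k = 0") auto
    then show ?thesis unfolding poly_coeffs_in_def eq by (intro allI add const)
  qed
  have cm: "char_poly_matrix (A x) \<in> carrier_mat n n" for x using assms(1) by simp
  have "poly_coeffs_in (\<lambda>x. \<Sum>p\<in>{p. p permutes {0..<n}}. signof p * (\<Prod>i = 0..<n. char_poly_matrix (A x) $$ (i, p i)))"
    by (intro poly_coeffs_in_sum poly_coeffs_in_mult poly_coeffs_in_const poly_coeffs_in_prod entry)
       (auto dest: permutes_in_image)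
  then show ?thesis
    unfolding char_poly_def det_def'[OF cm] by (simp add: poly_coeffs_in_def)
qed

lemma mult_mat_vec:
  assumes "\<And>x. A x \<in> carrier_mat n n" "\<And>i j. i < n \<Longrightarrow> j < n \<Longrightarrow> (\<lambda>x. A x $$ (i, j)) \<in> S"
    and "\<And>x. v x \<in> carrier_vec n" "\<And>i. i < n \<Longrightarrow> (\<lambda>x. v x $ i) \<in> S" and "i < n"
  shows "(\<lambda>x. (A x *\<^sub>v v x) $ i) \<in> S"
proof -
  have "(A x *\<^sub>v v x) $ i = (\<Sum>j = 0..<n. A x $$ (i, j) * v x $ j)" for x
    using assms(1,3)[of x] assms(5) by (auto simp: scalar_prod_def intro!: sum.cong)
  moreover have "(\<lambda>x. \<Sum>j = 0..<n. A x $$ (i, j) * v x $ j) \<in> S"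
    using assms by (intro sum mult) auto
  ultimately show ?thesis by simp
qed

end

section \<open>Cayley-Hamilton and Krylov matrices\<close>

definition companion_mat :: "nat \<Rightarrow> (nat \<Rightarrow> int) \<Rightarrow> int mat" where
  "companion_mat n a = mat n n (\<lambda>(i, j). if j = n - 1 then - a i else if i = Suc j then 1 else 0)"

definition mat_iter :: "int mat \<Rightarrow> nat \<Rightarrow> int vec \<Rightarrow> int vec" where
  "mat_iter A k v = ((\<lambda>v. A *\<^sub>v v) ^^ k) v"

lemma mat_iter_0 [simp]: "mat_iter A 0 v = v"
  by (simp add: mat_iter_def)

lemma mat_iter_Suc: "mat_iter A (Suc k) v = A *\<^sub>v mat_iter A k v"
  by (simp add: mat_iter_def)

lemma mat_iter_Suc': "mat_iter A (Suc k) v = mat_iter A k (A *\<^sub>v v)"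
  by (simp add: mat_iter_def funpow_swap1)

lemma mat_iter_carrier [simp]: "A \<in> carrier_mat n n \<Longrightarrow> v \<in> carrier_vec n \<Longrightarrow> mat_iter A k v \<in> carrier_vec n"
  by (induction k) (auto simp: mat_iter_Suc)

lemma mat_iter_add:
  "A \<in> carrier_mat n n \<Longrightarrow> v \<in> carrier_vec n \<Longrightarrow> w \<in> carrier_vec n \<Longrightarrow>
    mat_iter A k (v + w) = mat_iter A k v + mat_iter A k w"
  by (induction k) (auto simp: mat_iter_Suc mult_add_distrib_mat_vec[of _ n n])

lemma mat_iter_smult:
  assumes "A \<in> carrier_mat n n" "v \<in> carrier_vec n"
  shows "mat_iter A k (c \<cdot>\<^sub>v v) = c \<cdot>\<^sub>v mat_iter A k v"
proof (induction k)
  case (Suc k)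
  have "A *\<^sub>v (c \<cdot>\<^sub>v w) = c \<cdot>\<^sub>v (A *\<^sub>v w)" if w: "w \<in> carrier_vec n" for w
    using assms(1) w by (intro eq_vecI) (auto simp: scalar_prod_smult_distrib[of _ n])
  then show ?case
    unfolding mat_iter_Suc Suc using mat_iter_carrier[OF assms] by blast
qed simp

text \<open>Cayley-Hamilton applied to a unit vector. The product of
  \<open>char_poly_matrix A\<close> with its adjugate is the characteristic polynomial times the
  identity; comparing coefficients in column \<open>j\<close> gives relations that telescope once
  the \<open>k\<close>-th one is multiplied by the \<open>k\<close>-th power of
  \<open>A\<close>.\<close>

lemma char_poly_apply:
  assumes A: "A \<in> carrier_mat n n" and j: "j < n" and i: "i < n"
  shows "(\<Sum>k\<le>n. coeff (char_poly A) k * mat_iter A k (unit_vec n j) $ i) = 0"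
proof -
  define B where "B = adj_mat (char_poly_matrix A)"
  have cA: "char_poly_matrix A \<in> carrier_mat n n" using A by simp
  have B: "B \<in> carrier_mat n n" and AB: "char_poly_matrix A * B = char_poly A \<cdot>\<^sub>m 1\<^sub>m n"
    using adj_mat[OF cA] by (auto simp: B_def char_poly_def)
  \<comment> \<open>\<open>b k\<close> is the coefficient of the \<open>k\<close>-th power of the
    indeterminate in column \<open>j\<close> of the adjugate.\<close>
  define b where "b k = vec n (\<lambda>l. coeff (B $$ (l, j)) k)" for k
  have b: "b k \<in> carrier_vec n" for k by (simp add: b_def)
  have entry: "(if l = j then char_poly A else 0) = [:0, 1:] * B $$ (l, j) - (\<Sum>q = 0..<n. [:A $$ (l, q):] * B $$ (q, j))"
    if l: "l < n" for l
  proof -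
    have "(char_poly_matrix A * B) $$ (l, j) = (\<Sum>q = 0..<n. char_poly_matrix A $$ (l, q) * B $$ (q, j))"
      using l j cA B by (auto simp: scalar_prod_def intro!: sum.cong)
    also have "\<dots> = (\<Sum>q = 0..<n. (if q = l then [:0, 1:] * B $$ (q, j) else 0) - [:A $$ (l, q):] * B $$ (q, j))"
      using l A by (intro sum.cong) (auto simp: char_poly_matrix_def algebra_simps)
    also have "\<dots> = [:0, 1:] * B $$ (l, j) - (\<Sum>q = 0..<n. [:A $$ (l, q):] * B $$ (q, j))"
      unfolding sum_subtractf using l by (simp add: sum.delta)
    finally show ?thesis using AB l j by (simp split: if_splits)
  qed
  have Ab: "(A *\<^sub>v b k) $ l = (\<Sum>q = 0..<n. A $$ (l, q) * coeff (B $$ (q, j)) k)" if "l < n" for l k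
    using that A by (auto simp: b_def scalar_prod_def intro!: sum.cong)
  have c0: "coeff (char_poly A) 0 \<cdot>\<^sub>v unit_vec n j = - (A *\<^sub>v b 0)"
  proof (rule eq_vecI)
    fix l assume "l < dim_vec (- (A *\<^sub>v b 0))"
    then have l: "l < n" using A by simp
    from arg_cong[OF entry[OF l], of "\<lambda>p. coeff p 0"]
    show "(coeff (char_poly A) 0 \<cdot>\<^sub>v unit_vec n j) $ l = (- (A *\<^sub>v b 0)) $ l"
      using l A j Ab[OF l, of 0] by (simp add: coeff_sum split: if_splits del: index_mult_mat_vec)
  qed (use A in simp)
  have cS: "coeff (char_poly A) (Suc k) \<cdot>\<^sub>v unit_vec n j = b k + - (A *\<^sub>v b (Suc k))" for k
  proof (rule eq_vecI)
    fix l assume "l < dim_vec (b k + - (A *\<^sub>v b (Suc k)))"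
    then have l: "l < n" using A by simp
    from arg_cong[OF entry[OF l], of "\<lambda>p. coeff p (Suc k)"]
    show "(coeff (char_poly A) (Suc k) \<cdot>\<^sub>v unit_vec n j) $ l = (b k + - (A *\<^sub>v b (Suc k))) $ l"
      using l A j Ab[OF l, of "Suc k"] b[of k]
      by (simp add: coeff_sum b_def[of k] split: if_splits del: index_mult_mat_vec)
  qed (use A b in auto)
  have neg: "- v = (-1) \<cdot>\<^sub>v v" for v :: "int vec" by auto
  have tele: "(\<Sum>k\<le>N. coeff (char_poly A) k * mat_iter A k (unit_vec n j) $ i) = - (mat_iter A (Suc N) (b N) $ i)" for N
  proof (induction N)
    case 0
    have "coeff (char_poly A) 0 * unit_vec n j $ i = (coeff (char_poly A) 0 \<cdot>\<^sub>v unit_vec n j) $ i"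
      using i by simp
    also have "\<dots> = - ((A *\<^sub>v b 0) $ i)" unfolding c0 using i A by simp
    finally show ?case by (simp add: mat_iter_Suc)
  next
    case (Suc N)
    have "coeff (char_poly A) (Suc N) * mat_iter A (Suc N) (unit_vec n j) $ i =
        mat_iter A (Suc N) (coeff (char_poly A) (Suc N) \<cdot>\<^sub>v unit_vec n j) $ i"
      using i mat_iter_smult[OF A, of "unit_vec n j" "Suc N"]
        carrier_vecD[OF mat_iter_carrier[OF A, of "unit_vec n j" "Suc N"]] by simp
    also have "\<dots> = (mat_iter A (Suc N) (b N) + (-1) \<cdot>\<^sub>v mat_iter A (Suc N) (A *\<^sub>v b (Suc N))) $ i"
      unfolding cS neg using A b
      by (simp add: mat_iter_add[of _ n] mat_iter_smult[of _ n] mult_mat_vec_carrier[of _ n n])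
    also have "\<dots> = mat_iter A (Suc N) (b N) $ i - mat_iter A (Suc (Suc N)) (b (Suc N)) $ i"
      using i mat_iter_carrier[OF A b, of "Suc N" N] mat_iter_carrier[OF A b, of "Suc (Suc N)" "Suc N"]
      by (simp add: mat_iter_Suc'[of A "Suc N"] del: mat_iter_carrier)
    finally show ?case using Suc by simp
  qed
  \<comment> \<open>Beyond all degrees in column \<open>j\<close>, so that \<open>b N\<close> and
    with it the telescoped remainder vanish, and at least \<open>n\<close>, so that no coefficient
    of the characteristic polynomial is cut off.\<close>
  define N where "N = n + (\<Sum>q = 0..<n. Suc (degree (B $$ (q, j))))"
  have "degree (B $$ (q, j)) < N" if "q < n" for q
  proof -
    have "Suc (degree (B $$ (q, j))) \<le> (\<Sum>q = 0..<n. Suc (degree (B $$ (q, j))))"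
      using that by (intro member_le_sum) auto
    then show ?thesis by (simp add: N_def)
  qed
  then have "b N = 0 \<cdot>\<^sub>v b N" by (intro eq_vecI) (auto simp: b_def coeff_eq_0)
  then have "mat_iter A (Suc N) (b N) = 0 \<cdot>\<^sub>v mat_iter A (Suc N) (b N)" using mat_iter_smult[OF A b] by metis
  then have "mat_iter A (Suc N) (b N) $ i = 0"
    using i mat_iter_carrier[OF A b, of "Suc N" N] by (metis carrier_vecD index_smult_vec(1) mult_zero_left)
  then have "(\<Sum>k\<le>N. coeff (char_poly A) k * mat_iter A k (unit_vec n j) $ i) = 0" using tele by simp
  moreover have "(\<Sum>k\<le>n. coeff (char_poly A) k * mat_iter A k (unit_vec n j) $ i) =
      (\<Sum>k\<le>N. coeff (char_poly A) k * mat_iter A k (unit_vec n j) $ i)"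
    by (rule sum.mono_neutral_left) (auto simp: N_def coeff_eq_0 degree_monic_char_poly[OF A])
  ultimately show ?thesis by simp
qed

definition krylov_mat :: "nat \<Rightarrow> int mat \<Rightarrow> int mat" where
  "krylov_mat n A = mat n n (\<lambda>(i, j). mat_iter A j (unit_vec n 0) $ i)"

text \<open>Both sides shift the columns of the Krylov matrix by one; in the last column this is
  Cayley-Hamilton. It holds for every \<open>A\<close>; cyclicity of the first unit vector enters
  only when the Krylov matrix is cancelled.\<close>

lemma krylov_companion:
  assumes A: "A \<in> carrier_mat n n" and n: "n > 0"
  shows "A * krylov_mat n A = krylov_mat n A * companion_mat n (coeff (char_poly A))"
proof (rule eq_matI)
  let ?e = "unit_vec n 0" and ?a = "coeff (char_poly A)"
  show "dim_row (A * krylov_mat n A) = dim_row (krylov_mat n A * companion_mat n ?a)"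
    "dim_col (A * krylov_mat n A) = dim_col (krylov_mat n A * companion_mat n ?a)"
    using A by (simp_all add: krylov_mat_def companion_mat_def)
  fix i j assume "i < dim_row (krylov_mat n A * companion_mat n ?a)" "j < dim_col (krylov_mat n A * companion_mat n ?a)"
  then have ij: "i < n" "j < n" by (simp_all add: krylov_mat_def companion_mat_def)
  have col: "col (krylov_mat n A) j = mat_iter A j ?e"
    using ij mat_iter_carrier[OF A, of ?e j] by (intro eq_vecI) (auto simp: krylov_mat_def)
  have lhs: "(A * krylov_mat n A) $$ (i, j) = mat_iter A (Suc j) ?e $ i"
    using ij A col by (simp add: mat_iter_Suc krylov_mat_def)
  have rhs: "(krylov_mat n A * companion_mat n ?a) $$ (i, j) =
      (\<Sum>l = 0..<n. mat_iter A l ?e $ i * (if j = n - 1 then - ?a l else if l = Suc j then 1 else 0))"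
    using ij by (auto simp: krylov_mat_def companion_mat_def scalar_prod_def intro!: sum.cong)
  show "(A * krylov_mat n A) $$ (i, j) = (krylov_mat n A * companion_mat n ?a) $$ (i, j)"
  proof (cases "j = n - 1")
    case True
    have "{..n} = insert n {0..<n}" by auto
    then have "?a n * mat_iter A n ?e $ i + (\<Sum>l = 0..<n. ?a l * mat_iter A l ?e $ i) = 0"
      using char_poly_apply[OF A n ij(1)] by simp
    moreover have "?a n = 1" using degree_monic_char_poly[OF A] by auto
    ultimately show ?thesis
      unfolding lhs rhs using True n by (simp add: sum_negf mult.commute)
  next
    case False
    then have "Suc j < n" using ij by simp
    have "(\<Sum>l = 0..<n. mat_iter A l ?e $ i * (if l = Suc j then 1 else 0)) =
        (\<Sum>l = 0..<n. if l = Suc j then mat_iter A (Suc j) ?e $ i else 0)"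
      by (intro sum.cong) auto
    then show ?thesis unfolding lhs rhs using False \<open>Suc j < n\<close> by (simp add: sum.delta)
  qed
qed

text \<open>For the shift matrix the first unit vector is cyclic. This supplies the one point at
  which the Krylov determinant in the deformation is visibly nonzero.\<close>

lemma krylov_shift:
  assumes n: "n > 0"
  shows "krylov_mat n (companion_mat n (\<lambda>_. 0)) = 1\<^sub>m n"
proof -
  let ?C = "companion_mat n (\<lambda>_. 0)"
  have "mat_iter ?C j (unit_vec n 0) = unit_vec n j" if "j < n" for j
    using that
  proof (induction j)
    case (Suc j)
    have "?C *\<^sub>v unit_vec n j = unit_vec n (Suc j)"
    proof (rule eq_vecI)
      fix i assume "i < dim_vec (unit_vec n (Suc j))"
      then have i: "i < n" by simp
      have "(?C *\<^sub>v unit_vec n j) $ i = ?C $$ (i, j)"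
        using i Suc.prems by (simp add: companion_mat_def)
      then show "(?C *\<^sub>v unit_vec n j) $ i = unit_vec n (Suc j) $ i"
        using i Suc.prems by (auto simp: companion_mat_def)
    qed (simp add: companion_mat_def)
    then show ?case using Suc by (simp add: mat_iter_Suc)
  qed simp
  then show ?thesis by (intro eq_matI) (auto simp: krylov_mat_def unit_vec_def)
qed

section \<open>Polynomial functions of one variable\<close>

definition polynomial_functions :: "(int \<Rightarrow> int) set" where
  "polynomial_functions = {f. \<exists>p. \<forall>t. f t = poly p t}"

lemma fun_subring_polynomial_functions: "fun_subring polynomial_functions"
proof
  fix c show "(\<lambda>_. c) \<in> polynomial_functions"
    unfolding polynomial_functions_def by (auto intro: exI[of _ "[:c:]"])
next
  fix f g assume "f \<in> polynomial_functions" "g \<in> polynomial_functions"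
  then obtain p q where "\<And>t. f t = poly p t" "\<And>t. g t = poly q t"
    unfolding polynomial_functions_def by blast
  then show "(\<lambda>x. f x + g x) \<in> polynomial_functions" "(\<lambda>x. f x * g x) \<in> polynomial_functions"
    unfolding polynomial_functions_def by (auto intro: exI[of _ "p + q"] exI[of _ "p * q"])
qed

text \<open>The product of the two polynomials vanishes at every integer, so it is zero, and integer
  polynomials have no zero divisors.\<close>

lemma polynomial_function_eq_0:
  assumes "f \<in> polynomial_functions" "g \<in> polynomial_functions"
    and "g a \<noteq> 0" and "\<And>t. g t \<noteq> 0 \<Longrightarrow> f t = 0"
  shows "f t = 0"
proof -
  obtain p q where p: "\<And>t. f t = poly p t" and q: "\<And>t. g t = poly q t"
    using assms unfolding polynomial_functions_def by blast
  have "poly (p * q) t = 0" for t using assms(4)[of t] p q by (cases "g t = 0") auto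
  then have "p * q = 0" using poly_all_0_iff_0 by blast
  moreover have "q \<noteq> 0" using assms(3) q by auto
  ultimately show ?thesis using p by simp
qed

section \<open>Evaluation of multivariate integer polynomials\<close>

lemma mpoly_eval_superset:
  assumes "finite K" "Poly_Mapping.keys p \<subseteq> K"
  shows "mpoly_eval x p = (\<Sum>m\<in>K. Poly_Mapping.lookup p m * (\<Prod>i\<in>Poly_Mapping.keys m. x i ^ Poly_Mapping.lookup m i))"
  unfolding mpoly_eval_def using assms
  by (intro sum.mono_neutral_left) (auto simp: in_keys_iff)

lemma mpoly_eval_add: "mpoly_eval x (p + q) = mpoly_eval x p + mpoly_eval x q"
proof -
  let ?K = "Poly_Mapping.keys p \<union> Poly_Mapping.keys q"
  have K: "finite ?K" by simp
  show ?thesis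
    using mpoly_eval_superset[OF K, of "p + q" x] mpoly_eval_superset[OF K, of p x]
      mpoly_eval_superset[OF K, of q x] Poly_Mapping.keys_add[of p q]
    by (simp add: lookup_add algebra_simps sum.distrib)
qed

lemma mpoly_eval_0: "mpoly_eval x 0 = 0"
  by (simp add: mpoly_eval_def)

lemma mpoly_eval_sum: "mpoly_eval x (\<Sum>i\<in>I. p i) = (\<Sum>i\<in>I. mpoly_eval x (p i))"
  by (induction I rule: infinite_finite_induct) (auto simp: mpoly_eval_add mpoly_eval_0)

lemma mpoly_eval_single:
  "mpoly_eval x (Poly_Mapping.single m c) = c * (\<Prod>i\<in>Poly_Mapping.keys m. x i ^ Poly_Mapping.lookup m i)"
  by (simp add: mpoly_eval_def)

lemma monomial_eval_add:
  fixes m n :: "nat \<Rightarrow>\<^sub>0 nat" and x :: "nat \<Rightarrow> int"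
  shows "(\<Prod>i\<in>Poly_Mapping.keys (m + n). x i ^ Poly_Mapping.lookup (m + n) i) =
    (\<Prod>i\<in>Poly_Mapping.keys m. x i ^ Poly_Mapping.lookup m i) * (\<Prod>i\<in>Poly_Mapping.keys n. x i ^ Poly_Mapping.lookup n i)"
proof -
  let ?K = "Poly_Mapping.keys m \<union> Poly_Mapping.keys n"
  have super: "(\<Prod>i\<in>Poly_Mapping.keys l. x i ^ Poly_Mapping.lookup l i) = (\<Prod>i\<in>?K. x i ^ Poly_Mapping.lookup l i)"
    if "Poly_Mapping.keys l \<subseteq> ?K" for l
    using that by (intro prod.mono_neutral_left) (auto simp: in_keys_iff)
  show ?thesis
    using super[of "m + n"] super[of m] super[of n] Poly_Mapping.keys_add[of m n]
    by (simp add: lookup_add power_add prod.distrib)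
qed

lemma poly_mapping_sum_singles:
  fixes p :: int_mpoly
  shows "p = (\<Sum>m\<in>Poly_Mapping.keys p. Poly_Mapping.single m (Poly_Mapping.lookup p m))"
proof (rule poly_mapping_eqI)
  fix k
  show "Poly_Mapping.lookup p k = Poly_Mapping.lookup (\<Sum>m\<in>Poly_Mapping.keys p. Poly_Mapping.single m (Poly_Mapping.lookup p m)) k"
    by (simp add: lookup_sum lookup_single when_def in_keys_iff)
qed

lemma mpoly_eval_mult: "mpoly_eval x (p * q) = mpoly_eval x p * mpoly_eval x q"
proof -
  have "p * q = (\<Sum>m\<in>Poly_Mapping.keys p. Poly_Mapping.single m (Poly_Mapping.lookup p m)) *
      (\<Sum>n\<in>Poly_Mapping.keys q. Poly_Mapping.single n (Poly_Mapping.lookup q n))"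
    using poly_mapping_sum_singles[of p] poly_mapping_sum_singles[of q] by simp
  also have "\<dots> = (\<Sum>m\<in>Poly_Mapping.keys p. \<Sum>n\<in>Poly_Mapping.keys q.
      Poly_Mapping.single (m + n) (Poly_Mapping.lookup p m * Poly_Mapping.lookup q n))"
    by (simp add: sum_product mult_single)
  finally show ?thesis
    by (simp only: mpoly_eval_sum mpoly_eval_single monomial_eval_add)
       (simp add: mpoly_eval_def sum_product algebra_simps)
qed

definition mpoly_functions :: "nat set \<Rightarrow> ((nat \<Rightarrow> int) \<Rightarrow> int) set" where
  "mpoly_functions V = {f. \<exists>p\<in>mpolys_in V. \<forall>x. f x = mpoly_eval x p}"

lemma fun_subring_mpoly_functions: "fun_subring (mpoly_functions V)"
proof
  fix c show "(\<lambda>_. c) \<in> mpoly_functions V"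
    unfolding mpoly_functions_def mpolys_in_def
    by (auto intro!: exI[of _ "Poly_Mapping.single 0 c"] simp: mpoly_eval_single split: if_splits)
next
  fix f g assume "f \<in> mpoly_functions V" "g \<in> mpoly_functions V"
  then obtain p q where p: "p \<in> mpolys_in V" "\<And>x. f x = mpoly_eval x p"
    and q: "q \<in> mpolys_in V" "\<And>x. g x = mpoly_eval x q"
    unfolding mpoly_functions_def by blast
  have "p + q \<in> mpolys_in V"
    using p(1) q(1) Poly_Mapping.keys_add[of p q] unfolding mpolys_in_def by blast
  then show "(\<lambda>x. f x + g x) \<in> mpoly_functions V"
    unfolding mpoly_functions_def using p q by (auto simp: mpoly_eval_add intro!: bexI[of _ "p + q"])
  have "Poly_Mapping.keys m \<subseteq> V" if m: "m \<in> Poly_Mapping.keys (p * q)" for m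
  proof -
    obtain a b where "a \<in> Poly_Mapping.keys p" "b \<in> Poly_Mapping.keys q" "m = a + b"
      using m keys_mult[of p q] by blast
    then show ?thesis using p(1) q(1) Poly_Mapping.keys_add[of a b] unfolding mpolys_in_def by blast
  qed
  then have "p * q \<in> mpolys_in V" by (simp add: mpolys_in_def)
  then show "(\<lambda>x. f x * g x) \<in> mpoly_functions V"
    unfolding mpoly_functions_def using p q by (auto simp: mpoly_eval_mult intro!: bexI[of _ "p * q"])
qed

lemma var_mpoly_functions: "i \<in> V \<Longrightarrow> (\<lambda>x. x i) \<in> mpoly_functions V"
  unfolding mpoly_functions_def mpolys_in_def
  by (auto intro!: exI[of _ "Poly_Mapping.single (Poly_Mapping.single i 1) 1"] simp: mpoly_eval_single split: if_splits)

text \<open>The relation \<open>A * K = K * C\<close> passes through \<open>M\<close>, and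
  \<open>M K\<close> may be cancelled under the determinant: \<open>M K\<close> times the image of
  the adjugate of \<open>K\<close> is a power of \<open>det K\<close> times the identity, so
  \<open>det (M K)\<close> is nonzero.\<close>

lemma det_intertwined:
  fixes M :: "int mat \<Rightarrow> int mat"
  assumes Mc: "\<And>A. A \<in> carrier_mat r r \<Longrightarrow> M A \<in> carrier_mat m m"
    and Mm: "\<And>A B. A \<in> carrier_mat r r \<Longrightarrow> B \<in> carrier_mat r r \<Longrightarrow> M (A * B) = M A * M B"
    and Ms: "\<And>c. M (c \<cdot>\<^sub>m 1\<^sub>m r) = (c ^ d) \<cdot>\<^sub>m 1\<^sub>m m"
    and car: "A \<in> carrier_mat r r" "K \<in> carrier_mat r r" "C \<in> carrier_mat r r"
    and eq: "A * K = K * C" and K: "det K \<noteq> 0"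
  shows "det (1\<^sub>m m - M A) = det (1\<^sub>m m - M C)"
proof -
  note c = Mc[OF car(1)] Mc[OF car(2)] Mc[OF car(3)]
  have adj: "adj_mat K \<in> carrier_mat r r" "K * adj_mat K = det K \<cdot>\<^sub>m 1\<^sub>m r" using adj_mat[OF car(2)] by auto
  have "M K * M (adj_mat K) = (det K ^ d) \<cdot>\<^sub>m 1\<^sub>m m" using Mm[OF car(2) adj(1)] Ms adj(2) by simp
  then have "det (M K) * det (M (adj_mat K)) = (det K ^ d) ^ m"
    using det_mult[OF c(2) Mc[OF adj(1)]] by simp
  then have nz: "det (M K) \<noteq> 0" using K by auto
  have "(1\<^sub>m m - M A) * M K = M K - M A * M K"
    using c by (simp add: minus_mult_distrib_mat[of _ m m])
  also have "M A * M K = M K * M C" using Mm car eq by metis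
  also have "M K - M K * M C = M K * (1\<^sub>m m - M C)"
    using c mult_minus_distrib_mat[OF c(2) one_carrier_mat c(3)] by simp
  finally have "det (1\<^sub>m m - M A) * det (M K) = det (M K) * det (1\<^sub>m m - M C)"
    using det_mult[OF minus_carrier_mat[OF c(1)] c(2), of "1\<^sub>m m"]
      det_mult[OF c(2) minus_carrier_mat[OF c(3)], of "1\<^sub>m m"] by metis
  then show ?thesis using nz by simp
qed

text \<open>A generic matrix has a cyclic vector, hence is conjugate to the companion matrix of its
  characteristic polynomial; the general case follows by deforming to the shift matrix.\<close>

lemma det_companion:
  fixes M :: "int mat \<Rightarrow> int mat"
  assumes r: "r > 0"
    and Mc: "\<And>A. A \<in> carrier_mat r r \<Longrightarrow> M A \<in> carrier_mat m m"
    and Mm: "\<And>A B. A \<in> carrier_mat r r \<Longrightarrow> B \<in> carrier_mat r r \<Longrightarrow> M (A * B) = M A * M B"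
    and Ms: "\<And>c. M (c \<cdot>\<^sub>m 1\<^sub>m r) = (c ^ d) \<cdot>\<^sub>m 1\<^sub>m m"
    and Mp: "\<And>B i j. (\<And>t. B t \<in> carrier_mat r r) \<Longrightarrow>
      (\<And>i j. i < r \<Longrightarrow> j < r \<Longrightarrow> (\<lambda>t. B t $$ (i, j)) \<in> polynomial_functions) \<Longrightarrow>
      i < m \<Longrightarrow> j < m \<Longrightarrow> (\<lambda>t. M (B t) $$ (i, j)) \<in> polynomial_functions"
    and A: "A \<in> carrier_mat r r"
  shows "det (1\<^sub>m m - M A) = det (1\<^sub>m m - M (companion_mat r (coeff (char_poly A))))"
proof -
  interpret P: fun_subring polynomial_functions by (rule fun_subring_polynomial_functions)
  define C where "C t = companion_mat r t" for t :: "nat \<Rightarrow> int"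
  have C: "C t \<in> carrier_mat r r" for t by (simp add: C_def companion_mat_def)
  \<comment> \<open>The line from the shift matrix at \<open>t = 0\<close> to \<open>A\<close> at
    \<open>t = 1\<close>.\<close>
  define B where "B t = t \<cdot>\<^sub>m A + (1 - t) \<cdot>\<^sub>m C (\<lambda>_. 0)" for t
  have B: "B t \<in> carrier_mat r r" for t using A C by (simp add: B_def)
  have id: "(\<lambda>t. t) \<in> polynomial_functions"
    unfolding polynomial_functions_def by (auto intro: exI[of _ "[:0, 1:]"])
  have Be: "(\<lambda>t. B t $$ (i, j)) \<in> polynomial_functions" if "i < r" "j < r" for i j
  proof -
    have "(\<lambda>t. t * A $$ (i, j) + (1 - t) * C (\<lambda>_. 0) $$ (i, j)) \<in> polynomial_functions"
      by (intro P.add P.mult P.diff P.const id)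
    moreover have "B t $$ (i, j) = t * A $$ (i, j) + (1 - t) * C (\<lambda>_. 0) $$ (i, j)" for t
      using that A C[of "\<lambda>_. 0"] by (simp add: B_def)
    ultimately show ?thesis by simp
  qed
  define a where "a t = coeff (char_poly (B t))" for t
  have ae: "(\<lambda>t. a t i) \<in> polynomial_functions" for i
    unfolding a_def by (rule P.char_poly_coeff[of B r]) (use B Be in auto)
  have Ce: "(\<lambda>t. C (a t) $$ (i, j)) \<in> polynomial_functions" if "i < r" "j < r" for i j
    using that ae[of i] by (cases "j = r - Suc 0") (auto simp: C_def companion_mat_def intro: P.uminus P.const)
  have D: "(\<lambda>t. det (1\<^sub>m m - M (X t))) \<in> polynomial_functions"
    if "\<And>t. X t \<in> carrier_mat r r" "\<And>i j. i < r \<Longrightarrow> j < r \<Longrightarrow> (\<lambda>t. X t $$ (i, j)) \<in> polynomial_functions" for X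
  proof (rule P.det)
    fix t show "1\<^sub>m m - M (X t) \<in> carrier_mat m m" by (rule minus_carrier_mat[OF Mc[OF that(1)]])
  next
    fix i j assume ij: "i < m" "j < m"
    have "(1\<^sub>m m - M (X t)) $$ (i, j) = 1\<^sub>m m $$ (i, j) - M (X t) $$ (i, j)" for t
      using ij Mc[OF that(1), of t] by simp
    then show "(\<lambda>t. (1\<^sub>m m - M (X t)) $$ (i, j)) \<in> polynomial_functions"
      using P.diff[OF P.const Mp[OF that ij]] by simp
  qed
  define f where "f t = det (1\<^sub>m m - M (B t)) - det (1\<^sub>m m - M (C (a t)))" for t
  \<comment> \<open>\<open>g t\<close> nonzero says that the first unit vector is cyclic for
    \<open>B t\<close> over the rationals; at such \<open>t\<close> the defect \<open>f t\<close> is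
    zero.\<close>
  define g where "g t = det (krylov_mat r (B t))" for t
  have f: "f \<in> polynomial_functions"
    unfolding f_def by (intro P.diff D) (use B Be C Ce in auto)
  have iter: "(\<lambda>t. mat_iter (B t) k (unit_vec r 0) $ i) \<in> polynomial_functions" if "i < r" for i k
    using that
  proof (induction k arbitrary: i)
    case (Suc k)
    then show ?case unfolding mat_iter_Suc
      using B Be by (intro P.mult_mat_vec[of _ r]) auto
  qed (auto intro: P.const)
  have g: "g \<in> polynomial_functions"
    unfolding g_def by (rule P.det[of _ r]) (use iter in \<open>auto simp: krylov_mat_def\<close>)
  have "B 0 = C (\<lambda>_. 0)" "B 1 = A" using A C[of "\<lambda>_. 0"] by (auto simp: B_def)
  then have g0: "g 0 \<noteq> 0" using krylov_shift[OF r] by (simp add: g_def C_def)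
  have "f t = 0" if "g t \<noteq> 0" for t
    unfolding f_def a_def C_def
    using det_intertwined[of r M m d, OF Mc Mm Ms B _ _ krylov_companion[OF B r]] that
    by (simp add: g_def krylov_mat_def companion_mat_def)
  from polynomial_function_eq_0[OF f g g0 this] have "f 1 = 0" .
  then show ?thesis using \<open>B 1 = A\<close> by (simp add: f_def a_def C_def)
qed

text \<open>By \<open>det_companion\<close> it is enough to evaluate at a companion matrix with
  indeterminate coefficients. Variables are numbered from 1 and coefficients from 0, which explains
  \<open>Suc i\<close> in the companion matrix and \<open>i - 1\<close> in the conclusion.\<close>

lemma det_mpoly_char_poly:
  fixes M :: "int mat \<Rightarrow> int mat"
  assumes r: "r > 0"
    and Mc: "\<And>A. A \<in> carrier_mat r r \<Longrightarrow> M A \<in> carrier_mat m m"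
    and Mm: "\<And>A B. A \<in> carrier_mat r r \<Longrightarrow> B \<in> carrier_mat r r \<Longrightarrow> M (A * B) = M A * M B"
    and Ms: "\<And>c. M (c \<cdot>\<^sub>m 1\<^sub>m r) = (c ^ d) \<cdot>\<^sub>m 1\<^sub>m m"
    and Mp: "\<And>B i j. (\<And>t. B t \<in> carrier_mat r r) \<Longrightarrow>
      (\<And>i j. i < r \<Longrightarrow> j < r \<Longrightarrow> (\<lambda>t. B t $$ (i, j)) \<in> polynomial_functions) \<Longrightarrow>
      i < m \<Longrightarrow> j < m \<Longrightarrow> (\<lambda>t. M (B t) $$ (i, j)) \<in> polynomial_functions"
    and Mq: "\<And>B i j. (\<And>t. B t \<in> carrier_mat r r) \<Longrightarrow>
      (\<And>i j. i < r \<Longrightarrow> j < r \<Longrightarrow> (\<lambda>t. B t $$ (i, j)) \<in> mpoly_functions {1..r}) \<Longrightarrow>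
      i < m \<Longrightarrow> j < m \<Longrightarrow> (\<lambda>t. M (B t) $$ (i, j)) \<in> mpoly_functions {1..r}"
  shows "\<exists>p\<in>mpolys_in {1..r}. \<forall>A\<in>carrier_mat r r.
    det (1\<^sub>m m - M A) = mpoly_eval (\<lambda>i. coeff (char_poly A) (i - 1)) p"
proof -
  interpret P: fun_subring "mpoly_functions {1..r}" by (rule fun_subring_mpoly_functions)
  define C where "C x = companion_mat r (\<lambda>i. x (Suc i))" for x :: "nat \<Rightarrow> int"
  have C: "C x \<in> carrier_mat r r" for x by (simp add: C_def companion_mat_def)
  have Ce: "(\<lambda>x. C x $$ (i, j)) \<in> mpoly_functions {1..r}" if "i < r" "j < r" for i j
    using that var_mpoly_functions[of "Suc i" "{1..r}"]
    by (cases "j = r - 1") (auto simp: C_def companion_mat_def simp del: One_nat_def intro: P.uminus P.const)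
  have "(\<lambda>x. det (1\<^sub>m m - M (C x))) \<in> mpoly_functions {1..r}"
  proof (rule P.det)
    fix x show "1\<^sub>m m - M (C x) \<in> carrier_mat m m" by (rule minus_carrier_mat[OF Mc[OF C]])
  next
    fix i j assume ij: "i < m" "j < m"
    have "(1\<^sub>m m - M (C x)) $$ (i, j) = 1\<^sub>m m $$ (i, j) - M (C x) $$ (i, j)" for x
      using ij Mc[OF C, of x] by simp
    then show "(\<lambda>x. (1\<^sub>m m - M (C x)) $$ (i, j)) \<in> mpoly_functions {1..r}"
      using P.diff[OF P.const Mq[OF C Ce ij]] by simp
  qed
  then obtain p where p: "p \<in> mpolys_in {1..r}" "\<And>x. det (1\<^sub>m m - M (C x)) = mpoly_eval x p"
    unfolding mpoly_functions_def by blast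
  have "det (1\<^sub>m m - M A) = mpoly_eval (\<lambda>i. coeff (char_poly A) (i - 1)) p" if A: "A \<in> carrier_mat r r" for A
  proof -
    have "det (1\<^sub>m m - M A) = det (1\<^sub>m m - M (companion_mat r (coeff (char_poly A))))"
      by (rule det_companion[OF r, where d = d]) (fact Mc Mm Ms Mp A)+
    also have "companion_mat r (coeff (char_poly A)) = C (\<lambda>i. coeff (char_poly A) (i - 1))"
      by (simp add: C_def)
    finally show ?thesis using p(2) by simp
  qed
  then show ?thesis using p(1) by blast
qed

section \<open>Noncommutative power series\<close>

text \<open>The Cauchy product of two coefficient functions, over all ways to cut the word.
  Recursion on the word, instead of the sum in \<open>nc_conv_sum\<close>, reduces associativity to
  a short induction.\<close>

fun nc_conv :: "(nat list \<Rightarrow> int) \<Rightarrow> (nat list \<Rightarrow> int) \<Rightarrow> nat list \<Rightarrow> int" where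
  "nc_conv f g [] = f [] * g []"
| "nc_conv f g (x # w) = f [] * g (x # w) + nc_conv (\<lambda>v. f (x # v)) g w"

lemma nc_conv_sum: "nc_conv f g w = (\<Sum>k\<le>length w. f (take k w) * g (drop k w))"
  by (induction w arbitrary: f) (auto simp: sum.atMost_Suc_shift simp del: sum.atMost_Suc)

lemma nc_conv_add_left: "nc_conv (\<lambda>v. f v + g v) h w = nc_conv f h w + nc_conv g h w"
  by (simp add: nc_conv_sum sum.distrib algebra_simps)

lemma nc_conv_add_right: "nc_conv f (\<lambda>v. g v + h v) w = nc_conv f g w + nc_conv f h w"
  by (simp add: nc_conv_sum sum.distrib algebra_simps)

lemma nc_conv_scale_left: "nc_conv (\<lambda>v. c * f v) g w = c * nc_conv f g w"
  by (simp add: nc_conv_sum sum_distrib_left algebra_simps)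

lemma nc_conv_sum_left:
  "finite Y \<Longrightarrow> nc_conv (\<lambda>v. \<Sum>y\<in>Y. f y v) g w = (\<Sum>y\<in>Y. nc_conv (f y) g w)"
  by (simp add: nc_conv_sum sum_distrib_right sum.swap[of _ Y])

lemma nc_conv_assoc: "nc_conv (nc_conv f g) h w = nc_conv f (nc_conv g h) w"
proof (induction w arbitrary: f g)
  case (Cons x w)
  then show ?case
    by (simp add: nc_conv_add_left nc_conv_scale_left algebra_simps)
qed (simp add: algebra_simps)

lemma nc_conv_one_left: "nc_conv (\<lambda>v. if v = [] then 1 else 0) f w = f w"
proof (cases w)
  case (Cons x v)
  have "nc_conv (\<lambda>_. 0) f v = 0" by (simp add: nc_conv_sum)
  with Cons show ?thesis by simp
qed simp

lemma nc_conv_one_right: "nc_conv f (\<lambda>v. if v = [] then 1 else 0) w = f w"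
  by (induction w arbitrary: f) auto

text \<open>Every natural number is a letter, although only letters below \<open>r\<close> carry
  meaning. Hence comparisons involving an \<open>r\<close> by \<open>r\<close> matrix are restricted
  to words over \<open>{..<r}\<close>.\<close>

typedef ncps = "UNIV :: (nat list \<Rightarrow> int) set"
  morphisms nc_nth Abs_ncps by simp

setup_lifting type_definition_ncps

lemma ncps_eqI: "(\<And>w. nc_nth f w = nc_nth g w) \<Longrightarrow> f = g"
  by (simp add: nc_nth_inject[symmetric] fun_eq_iff)

instantiation ncps :: ring_1
begin
lift_definition zero_ncps :: ncps is "\<lambda>_. 0" .
lift_definition one_ncps :: ncps is "\<lambda>v. if v = [] then 1 else 0" .
lift_definition plus_ncps :: "ncps \<Rightarrow> ncps \<Rightarrow> ncps" is "\<lambda>f g v. f v + g v" .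
lift_definition minus_ncps :: "ncps \<Rightarrow> ncps \<Rightarrow> ncps" is "\<lambda>f g v. f v - g v" .
lift_definition uminus_ncps :: "ncps \<Rightarrow> ncps" is "\<lambda>f v. - f v" .
lift_definition times_ncps :: "ncps \<Rightarrow> ncps \<Rightarrow> ncps" is nc_conv .
instance
proof
  fix a b c :: ncps
  show "a * b * c = a * (b * c)"
    by (transfer, rule ext, rule nc_conv_assoc)
  show "1 * a = a" by (transfer, rule ext, rule nc_conv_one_left)
  show "a * 1 = a" by (transfer, rule ext, rule nc_conv_one_right)
  show "(a + b) * c = a * c + b * c" by (transfer, rule ext, rule nc_conv_add_left)
  show "a * (b + c) = a * b + a * c" by (transfer, rule ext, rule nc_conv_add_right)
  show "(0::ncps) \<noteq> 1" by transfer (metis zero_neq_one)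
qed (transfer; simp add: fun_eq_iff)+
end

lemmas nc_nth_simps [simp] = zero_ncps.rep_eq plus_ncps.rep_eq minus_ncps.rep_eq uminus_ncps.rep_eq
lemmas nc_nth_one = one_ncps.rep_eq

lemma nc_nth_mult: "nc_nth (f * g) w = (\<Sum>k\<le>length w. nc_nth f (take k w) * nc_nth g (drop k w))"
  by transfer (rule nc_conv_sum)

lemma nc_nth_mult_Nil [simp]: "nc_nth (f * g) [] = nc_nth f [] * nc_nth g []"
  by (simp add: nc_nth_mult)

lift_definition nc_var :: "nat \<Rightarrow> ncps" is "\<lambda>i v. if v = [i] then 1 else 0" .

definition nc_order_ge :: "nat \<Rightarrow> ncps \<Rightarrow> bool" where
  "nc_order_ge k f \<longleftrightarrow> (\<forall>w. length w < k \<longrightarrow> nc_nth f w = 0)"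

lemma nc_order_ge_add: "nc_order_ge k f \<Longrightarrow> nc_order_ge k g \<Longrightarrow> nc_order_ge k (f + g)"
  by (simp add: nc_order_ge_def)

lemma nc_order_ge_diff: "nc_order_ge k f \<Longrightarrow> nc_order_ge k g \<Longrightarrow> nc_order_ge k (f - g)"
  by (simp add: nc_order_ge_def)

lemma nc_order_ge_mono: "nc_order_ge k f \<Longrightarrow> l \<le> k \<Longrightarrow> nc_order_ge l f"
  by (simp add: nc_order_ge_def)

text \<open>In the lowest possible degree \<open>i + j\<close> the only cut at which neither factor
  vanishes is the one after \<open>i\<close> letters.\<close>

lemma nc_nth_mult_order:
  assumes "nc_order_ge i f" "nc_order_ge j g" "length w \<le> i + j"
  shows "nc_nth (f * g) w = (if length w = i + j then nc_nth f (take i w) * nc_nth g (drop i w) else 0)"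
proof -
  have "nc_nth f (take k w) * nc_nth g (drop k w) = 0" if "k \<le> length w" "k \<noteq> i \<or> length w \<noteq> i + j" for k
  proof (cases "k < i")
    case True
    then show ?thesis using assms(1) that by (simp add: nc_order_ge_def)
  next
    case False
    then show ?thesis using assms that by (auto simp: nc_order_ge_def)
  qed
  then have "nc_nth (f * g) w =
    (\<Sum>k\<le>length w. if k = i \<and> length w = i + j then nc_nth f (take i w) * nc_nth g (drop i w) else 0)"
    unfolding nc_nth_mult by (intro sum.cong) auto
  then show ?thesis by (auto simp: sum.delta)
qed

lemma nc_order_ge_mult: "nc_order_ge i f \<Longrightarrow> nc_order_ge j g \<Longrightarrow> nc_order_ge (i + j) (f * g)"
  using nc_nth_mult_order by (auto simp: nc_order_ge_def)

lift_definition nc_hom_part :: "nat \<Rightarrow> ncps \<Rightarrow> ncps" is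
  "\<lambda>k f w. if length w = k then f w else 0" .

lemmas nc_nth_hom_part = nc_hom_part.rep_eq

lemma nc_hom_part_add: "nc_hom_part k (f + g) = nc_hom_part k f + nc_hom_part k g"
  by (rule ncps_eqI) (simp add: nc_nth_hom_part)

lemma nc_hom_part_diff: "nc_hom_part k (f - g) = nc_hom_part k f - nc_hom_part k g"
  by (rule ncps_eqI) (simp add: nc_nth_hom_part)

lemma nc_hom_part_0: "nc_order_ge (Suc k) f \<Longrightarrow> nc_hom_part k f = 0"
  by (rule ncps_eqI) (simp add: nc_nth_hom_part nc_order_ge_def)

lemma nc_order_ge_hom_part: "nc_order_ge k (nc_hom_part k f)"
  by (simp add: nc_order_ge_def nc_nth_hom_part)

lemma nc_nth_mult_hom_part:
  "nc_nth (nc_hom_part i f * nc_hom_part j g) w =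
     (if length w = i + j then nc_nth f (take i w) * nc_nth g (drop i w) else 0)"
proof (cases "length w \<le> i + j")
  case True
  then show ?thesis
    by (simp add: nc_nth_mult_order[OF nc_order_ge_hom_part nc_order_ge_hom_part] nc_nth_hom_part)
next
  case False
  then have "nc_nth (nc_hom_part i f) (take k w) * nc_nth (nc_hom_part j g) (drop k w) = 0" for k
    by (auto simp: nc_nth_hom_part)
  then have "nc_nth (nc_hom_part i f * nc_hom_part j g) w = 0"
    unfolding nc_nth_mult by (intro sum.neutral ballI)
  then show ?thesis using False by simp
qed

lemma nc_hom_part_mult:
  assumes "nc_order_ge i f" "nc_order_ge j g"
  shows "nc_hom_part (i + j) (f * g) = nc_hom_part i f * nc_hom_part j g"
  by (rule ncps_eqI) (simp add: nc_nth_mult_hom_part nc_nth_hom_part nc_nth_mult_order[OF assms])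

text \<open>On the homogeneous part of degree \<open>k\<close> this is the \<open>k\<close>-th tensor power of \<open>A\<close>.\<close>

fun nc_actf :: "int mat \<Rightarrow> (nat list \<Rightarrow> int) \<Rightarrow> nat list \<Rightarrow> int" where
  "nc_actf A f [] = f []"
| "nc_actf A f (x # w) = nc_actf A (\<lambda>v. \<Sum>y<dim_col A. A $$ (x, y) * f (y # v)) w"

lemma nc_actf_add: "nc_actf A (\<lambda>v. f v + g v) w = nc_actf A f w + nc_actf A g w"
  by (induction w arbitrary: f g) (simp_all add: distrib_left sum.distrib)

lemma nc_actf_scale: "nc_actf A (\<lambda>v. c * f v) w = c * nc_actf A f w"
proof (induction w arbitrary: f)
  case (Cons x w)
  have "(\<lambda>v. \<Sum>y<dim_col A. A $$ (x, y) * (c * f (y # v))) =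
      (\<lambda>v. c * (\<Sum>y<dim_col A. A $$ (x, y) * f (y # v)))"
    by (simp add: sum_distrib_left mult.left_commute)
  then show ?case by (simp only: nc_actf.simps Cons.IH)
qed simp

lemma nc_actf_sum: "nc_actf A (\<lambda>v. \<Sum>y\<in>Y. c y * f y v) w = (\<Sum>y\<in>Y. c y * nc_actf A (f y) w)"
proof (induction Y rule: infinite_finite_induct)
  case (insert y Y)
  then show ?case by (simp add: nc_actf_add nc_actf_scale)
qed (use nc_actf_scale[of A 0 "\<lambda>_. 0"] in auto)

text \<open>The action is a linear substitution of variables: the variable of letter
  \<open>y\<close> is replaced by the combination with coefficients in column \<open>y\<close> of
  \<open>A\<close>. Substitutions respect products.\<close>

lemma nc_actf_conv: "nc_actf A (nc_conv f g) w = nc_conv (nc_actf A f) (nc_actf A g) w"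
proof (induction w arbitrary: f)
  case (Cons x w)
  have "(\<Sum>y<dim_col A. A $$ (x, y) * nc_conv f g (y # v)) =
      f [] * (\<Sum>y<dim_col A. A $$ (x, y) * g (y # v))
         + nc_conv (\<lambda>v. \<Sum>y<dim_col A. A $$ (x, y) * f (y # v)) g v" for v
  proof -
    have "(\<Sum>y<dim_col A. A $$ (x, y) * nc_conv f g (y # v)) =
        (\<Sum>y<dim_col A. f [] * (A $$ (x, y) * g (y # v)))
          + (\<Sum>y<dim_col A. A $$ (x, y) * nc_conv (\<lambda>v. f (y # v)) g v)"
      by (simp only: nc_conv.simps distrib_left sum.distrib mult.left_commute[of _ "f []"])
    then show ?thesis
      by (simp only: nc_conv_sum_left finite_lessThan nc_conv_scale_left sum_distrib_left)
  qed
  then show ?case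
    by (simp add: nc_actf_add nc_actf_scale Cons)
qed simp

text \<open>The letters of \<open>w\<close> serve as row indices, and entries of the matrices
  outside the \<open>r\<close> by \<open>r\<close> range are meaningless; this is the reason for the
  bound on \<open>w\<close>.\<close>

lemma nc_actf_mult:
  assumes "A \<in> carrier_mat r r" "B \<in> carrier_mat r r" "set w \<subseteq> {..<r}"
  shows "nc_actf (A * B) f w = nc_actf A (nc_actf B f) w"
  using assms(3)
proof (induction w arbitrary: f)
  case (Cons x w)
  have "(\<lambda>v. \<Sum>y<r. A $$ (x, y) * nc_actf B f (y # v)) =
      nc_actf B (\<lambda>v. \<Sum>y<r. A $$ (x, y) * (\<Sum>z<r. B $$ (y, z) * f (z # v)))"
    using assms(2) by (auto simp: nc_actf_sum[symmetric])
  also have "(\<lambda>v. \<Sum>y<r. A $$ (x, y) * (\<Sum>z<r. B $$ (y, z) * f (z # v))) =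
      (\<lambda>v. \<Sum>z<r. (A * B) $$ (x, z) * f (z # v))"
  proof
    fix v
    have "(\<Sum>z<r. (A * B) $$ (x, z) * f (z # v)) = (\<Sum>z<r. (\<Sum>y<r. A $$ (x, y) * B $$ (y, z)) * f (z # v))"
      using assms Cons.prems by (intro sum.cong) (auto simp: scalar_prod_def atLeast0LessThan)
    also have "\<dots> = (\<Sum>z<r. \<Sum>y<r. A $$ (x, y) * B $$ (y, z) * f (z # v))"
      by (simp add: sum_distrib_right)
    also have "\<dots> = (\<Sum>y<r. \<Sum>z<r. A $$ (x, y) * B $$ (y, z) * f (z # v))"
      by (rule sum.swap)
    finally show "(\<Sum>y<r. A $$ (x, y) * (\<Sum>z<r. B $$ (y, z) * f (z # v))) =
        (\<Sum>z<r. (A * B) $$ (x, z) * f (z # v))"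
      by (simp add: sum_distrib_left mult.assoc)
  qed
  finally show ?case using Cons assms by simp
qed simp

lemma nc_actf_smult_one:
  assumes "set w \<subseteq> {..<r}"
  shows "nc_actf (d \<cdot>\<^sub>m 1\<^sub>m r) f w = d ^ length w * f w"
  using assms
proof (induction w arbitrary: f)
  case (Cons x w)
  have "(\<Sum>y<r. (d \<cdot>\<^sub>m 1\<^sub>m r) $$ (x, y) * f (y # v)) = d * f (x # v)" for v
  proof -
    have "(\<Sum>y<r. (d \<cdot>\<^sub>m 1\<^sub>m r) $$ (x, y) * f (y # v)) = (\<Sum>y<r. if y = x then d * f (x # v) else 0)"
      using Cons.prems by (intro sum.cong) auto
    then show ?thesis using Cons.prems by (simp add: sum.delta)
  qed
  then show ?case using Cons by (simp add: nc_actf_scale)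
qed simp

lemma nc_actf_cong:
  assumes "\<And>v. length v = length w \<Longrightarrow> f v = g v"
  shows "nc_actf A f w = nc_actf A g w"
  using assms
proof (induction w arbitrary: f g)
  case (Cons x w)
  show ?case
    unfolding nc_actf.simps by (rule Cons.IH, rule sum.cong) (simp_all add: Cons.prems)
qed simp

lift_definition nc_act :: "int mat \<Rightarrow> ncps \<Rightarrow> ncps" is nc_actf .

lemma nc_act_mult: "nc_act A (f * g) = nc_act A f * nc_act A g"
  by (transfer, rule ext, rule nc_actf_conv)

lemma nc_act_add: "nc_act A (f + g) = nc_act A f + nc_act A g"
  by (transfer, rule ext, rule nc_actf_add)

lemma nc_act_diff: "nc_act A (f - g) = nc_act A f - nc_act A g"
  using nc_act_add[of A "f - g" g] by simp

lemma nc_act_0: "nc_act A 0 = 0"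
  using nc_act_add[of A 0 0] by simp

lemma nc_act_uminus: "nc_act A (- f) = - nc_act A f"
  using nc_act_diff[of A 0 f] by (simp add: nc_act_0)

lemma nc_act_rep: "nc_nth (nc_act A f) w = nc_actf A (nc_nth f) w"
  by (simp add: nc_act.rep_eq)

lemma nc_actf_eq_0: "(\<And>v. length v = length w \<Longrightarrow> f v = 0) \<Longrightarrow> nc_actf A f w = 0"
  using nc_actf_cong[of w f "\<lambda>v. 0 * f v" A] nc_actf_scale[of A 0 f w] by simp

lemma nc_actf_cong_letters:
  assumes "A \<in> carrier_mat r r" "set w \<subseteq> {..<r}"
    and "\<And>v. set v \<subseteq> {..<r} \<Longrightarrow> f v = g v"
  shows "nc_actf A f w = nc_actf A g w"
  using assms(2,3)
proof (induction w arbitrary: f g)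
  case (Cons x w)
  show ?case
    unfolding nc_actf.simps
    by (rule Cons.IH) (use Cons.prems assms(1) in \<open>auto intro!: sum.cong\<close>)
qed simp

lemma nc_nth_mult_cong_letters:
  assumes "set w \<subseteq> R" "\<And>v. set v \<subseteq> R \<Longrightarrow> nc_nth f v = nc_nth f' v"
    and "\<And>v. set v \<subseteq> R \<Longrightarrow> nc_nth g v = nc_nth g' v"
  shows "nc_nth (f * g) w = nc_nth (f' * g') w"
  unfolding nc_nth_mult
proof (rule sum.cong)
  fix k
  have "set (take k w) \<subseteq> R" "set (drop k w) \<subseteq> R"
    using assms(1) set_take_subset[of k w] set_drop_subset[of k w] by auto
  then show "nc_nth f (take k w) * nc_nth g (drop k w) = nc_nth f' (take k w) * nc_nth g' (drop k w)"
    using assms by simp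
qed simp

lemma (in fun_subring) nc_actf_mem:
  assumes "\<And>x. B x \<in> carrier_mat r r" "\<And>i j. i < r \<Longrightarrow> j < r \<Longrightarrow> (\<lambda>x. B x $$ (i, j)) \<in> S"
    and "set w \<subseteq> {..<r}" "\<And>v. (\<lambda>x. f x v) \<in> S"
  shows "(\<lambda>x. nc_actf (B x) (f x) w) \<in> S"
  using assms(3,4)
proof (induction w arbitrary: f)
  case (Cons y w)
  have dim: "dim_col (B x) = r" for x using assms(1)[of x] by auto
  have "(\<lambda>x. \<Sum>z<r. B x $$ (y, z) * f x (z # v)) \<in> S" for v
    using Cons.prems assms(2) by (intro sum mult) auto
  then show ?case
    using Cons.IH[of "\<lambda>x v. \<Sum>z<r. B x $$ (y, z) * f x (z # v)"] Cons.prems by (simp add: dim)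
qed simp

section \<open>Lyndon words\<close>

lemma list_less_append_cancel [simp]: "x @ u < x @ v \<longleftrightarrow> u < (v :: nat list)"
  by (induction x) auto

lemma list_less_append_self: "v \<noteq> [] \<Longrightarrow> u < u @ (v :: nat list)"
  by (metis append.right_neutral list_less_append_cancel Nil_less_Cons neq_Nil_conv)

text \<open>Either the smaller word is a proper prefix, or the two differ at some position; then the
  comparison is decided there and survives any extension of both words.\<close>

lemma list_less_cases:
  assumes "u < (w :: nat list)"
  obtains z where "w = u @ z" "z \<noteq> []" | "\<And>v z. u @ v < w @ z"
proof -
  have "(\<exists>z. w = u @ z \<and> z \<noteq> []) \<or> (\<forall>v z. u @ v < w @ z)"
    using assms
  proof (induction u arbitrary: w)
    case Nil
    then show ?case by (cases w) auto
  next
    case (Cons a u)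
    then obtain b w' where w: "w = b # w'" by (cases w) auto
    show ?case
    proof (cases "a < b")
      case False
      then have "a = b" "u < w'" using Cons.prems w by auto
      then show ?thesis using Cons.IH[of w'] w by auto
    qed (use w in auto)
  qed
  then show thesis using that by blast
qed

lemma list_less_append_length:
  assumes "u < (w :: nat list)" "length w \<le> length u"
  shows "u @ v < w @ z"
  using assms by (cases rule: list_less_cases) auto

text \<open>The description by proper suffixes, in the lexicographic order in which a prefix
  precedes its extensions.\<close>

definition lyndon :: "nat list \<Rightarrow> bool" where
  "lyndon w \<longleftrightarrow> w \<noteq> [] \<and> (\<forall>u v. w = u @ v \<longrightarrow> u \<noteq> [] \<longrightarrow> v \<noteq> [] \<longrightarrow> w < v)"

lemma lyndonD: "lyndon (u @ v) \<Longrightarrow> u \<noteq> [] \<Longrightarrow> v \<noteq> [] \<Longrightarrow> u @ v < v"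
  by (auto simp: lyndon_def)

lemma lyndon_nonempty: "lyndon w \<Longrightarrow> w \<noteq> []"
  by (auto simp: lyndon_def)

lemma lyndon_single: "lyndon [x]"
  by (auto simp: lyndon_def Cons_eq_append_conv)

text \<open>The only delicate case is \<open>v = u @ z\<close>: then \<open>v < z\<close> because
  \<open>v\<close> is Lyndon, and prefixing both sides with \<open>u\<close> gives the
  claim.\<close>

lemma lyndon_append_less:
  assumes "lyndon v" "u < v" "u \<noteq> []"
  shows "u @ v < v"
  using assms(2)
proof (cases rule: list_less_cases)
  case (1 z)
  then show ?thesis using lyndonD[of u z] assms by auto
next
  case 2
  then show ?thesis using 2[of v "[]"] by simp
qed

text \<open>A proper suffix either starts inside \<open>u\<close>, where \<open>u < s\<close> is
  already decided within the shorter word \<open>s\<close>, or lies in \<open>v\<close>, where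
  \<open>u @ v < v\<close> settles it.\<close>

lemma lyndon_append:
  assumes "lyndon u" "lyndon v" "u < v"
  shows "lyndon (u @ v)"
  unfolding lyndon_def
proof (intro conjI allI impI)
  show "u @ v \<noteq> []" using assms by (auto simp: lyndon_def)
next
  fix a b assume ab: "u @ v = a @ b" "a \<noteq> []" "b \<noteq> []"
  have uv: "u @ v < v" using lyndon_append_less assms lyndon_nonempty by blast
  from ab(1) consider s where "u = a @ s" "b = s @ v" | s where "v = s @ b" "a = u @ s"
    by (auto simp: append_eq_append_conv2)
  then show "u @ v < b"
  proof cases
    case (1 s)
    show ?thesis
    proof (cases "s = []")
      case False
      have "u < s" using lyndonD[of a s] 1 False ab assms(1) by auto
      then show ?thesis using list_less_append_length[of u s v v] 1 by auto
    qed (use uv 1 in auto)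
  next
    case (2 s)
    show ?thesis
    proof (cases "s = []")
      case False
      have "v < b" using lyndonD[of s b] 2 False ab assms(2) by auto
      then show ?thesis using uv by auto
    qed (use uv 2 in auto)
  qed
qed

text \<open>The right factor of the standard factorization of a Lyndon word.\<close>

definition min_suffix :: "nat list \<Rightarrow> nat list" where
  "min_suffix w = Min {drop i w | i. 0 < i \<and> i < length w}"

definition min_suffix_rest :: "nat list \<Rightarrow> nat list" where
  "min_suffix_rest w = take (length w - length (min_suffix w)) w"

lemma min_suffix_props:
  assumes "length w \<ge> 2"
  shows "w = min_suffix_rest w @ min_suffix w" "min_suffix_rest w \<noteq> []" "min_suffix w \<noteq> []"
    and "\<And>u v. w = u @ v \<Longrightarrow> u \<noteq> [] \<Longrightarrow> v \<noteq> [] \<Longrightarrow> min_suffix w \<le> v"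
proof -
  let ?S = "{drop i w | i. 0 < i \<and> i < length w}"
  have fin: "finite ?S" by simp
  have "drop 1 w \<in> ?S" using assms by (intro CollectI exI[of _ 1]) auto
  then have "?S \<noteq> {}" by blast
  then have "min_suffix w \<in> ?S" unfolding min_suffix_def by (intro Min_in fin)
  then obtain i where i: "0 < i" "i < length w" "min_suffix w = drop i w" by auto
  then show "w = min_suffix_rest w @ min_suffix w" "min_suffix_rest w \<noteq> []" "min_suffix w \<noteq> []"
    by (auto simp: min_suffix_rest_def)
  fix u v assume uv: "w = u @ v" "u \<noteq> []" "v \<noteq> []"
  then have "v \<in> ?S" by (intro CollectI exI[of _ "length u"]) auto
  then show "min_suffix w \<le> v" unfolding min_suffix_def by (intro Min_le fin)
qed

lemma min_suffix_less:
  assumes "length w \<ge> 2" "w = u @ v" "u \<noteq> []" "v \<noteq> []" "v \<noteq> min_suffix w"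
  shows "min_suffix w < v"
  using min_suffix_props(4)[OF assms(1-4)] assms(5) by auto

lemma lyndon_min_suffix:
  assumes "length w \<ge> 2"
  shows "lyndon (min_suffix w)"
  unfolding lyndon_def
proof (intro conjI allI impI)
  show "min_suffix w \<noteq> []" using min_suffix_props assms by blast
  fix u v assume uv: "min_suffix w = u @ v" "u \<noteq> []" "v \<noteq> []"
  then show "min_suffix w < v"
    using min_suffix_less[OF assms, of "min_suffix_rest w @ u" v] min_suffix_props(1)[OF assms] by auto
qed

text \<open>Let \<open>s\<close> be a proper suffix of the left factor, smaller than it. If the left
  factor is \<open>s @ t\<close>, the Lyndon property of \<open>w\<close> forces
  \<open>t @ min_suffix w < min_suffix w\<close>, against minimality; otherwise the suffix of
  \<open>w\<close> beginning with \<open>s\<close> is smaller than \<open>w\<close>.\<close>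

lemma lyndon_min_suffix_rest:
  assumes "length w \<ge> 2" "lyndon w"
  shows "lyndon (min_suffix_rest w)"
  unfolding lyndon_def
proof (intro conjI allI impI)
  let ?u = "min_suffix_rest w" and ?v = "min_suffix w"
  show "?u \<noteq> []" using min_suffix_props assms by blast
  fix p s assume ps: "?u = p @ s" "p \<noteq> []" "s \<noteq> []"
  have w: "w = ?u @ ?v" using min_suffix_props(1)[OF assms(1)] .
  have wps: "w = p @ s @ ?v" using w unfolding ps(1) by simp
  show "?u < s"
  proof (rule ccontr)
    assume "\<not> ?u < s"
    moreover have "?u \<noteq> s" using ps by auto
    ultimately have "s < ?u" by auto
    then show False
    proof (cases rule: list_less_cases)
      case (1 t)
      have "w < s @ ?v" using lyndonD[of p "s @ ?v"] assms(2) wps ps by auto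
      then have "s @ (t @ ?v) < s @ ?v" using w unfolding 1 by simp
      then have "t @ ?v < ?v" by simp
      moreover have "?v < t @ ?v"
        by (rule min_suffix_less[OF assms(1), of s]) (use w 1 ps in auto)
      ultimately show False by auto
    next
      case 2
      have "w < s @ ?v" using lyndonD[of p "s @ ?v"] assms(2) wps ps by auto
      moreover have "s @ ?v < w" using 2[of ?v ?v] w by simp
      ultimately show False by auto
    qed
  qed
qed

lemma min_suffix_rest_less:
  assumes "length w \<ge> 2" "lyndon w"
  shows "min_suffix_rest w < min_suffix w"
proof -
  have "w < min_suffix w"
    using min_suffix_props[OF assms(1)] assms(2) lyndonD by metis
  moreover have "min_suffix_rest w < w"
    using min_suffix_props[OF assms(1)] list_less_append_self by metis
  ultimately show ?thesis by auto
qed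

text \<open>The condition on \<open>u\<close> characterizes standard factorizations. A suffix
  \<open>s @ v\<close> with \<open>s\<close> a proper suffix of \<open>u\<close> satisfies
  \<open>v \<le> min_suffix u \<le> s < s @ v\<close>; a proper suffix of \<open>v\<close> exceeds
  \<open>v\<close> because \<open>v\<close> is Lyndon.\<close>

lemma min_suffix_append:
  assumes "lyndon u" "lyndon v" and std: "length u = 1 \<or> min_suffix u \<ge> v"
  shows "min_suffix (u @ v) = v" "min_suffix_rest (u @ v) = u"
proof -
  have ne: "u \<noteq> []" "v \<noteq> []" using assms lyndon_nonempty by auto
  then have len: "length (u @ v) \<ge> 2" by (cases u; cases v) auto
  have ge: "v \<le> b" if ab: "u @ v = a @ b" "a \<noteq> []" "b \<noteq> []" for a b
  proof -
    from ab(1) consider s where "u = a @ s" "b = s @ v" | s where "v = s @ b" "a = u @ s"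
      by (auto simp: append_eq_append_conv2)
    then show ?thesis
    proof cases
      case (1 s)
      show ?thesis
      proof (cases "s = []")
        case False
        then have "length u \<ge> 2" using 1 ab by (cases a; cases s) auto
        then have "v \<le> s" using std min_suffix_props(4)[of u a s] 1 ab False by auto
        then show ?thesis using 1 list_less_append_self[OF ne(2), of s] by auto
      qed (use 1 in auto)
    next
      case (2 s)
      then show ?thesis using lyndonD[of s b] assms(2) ab by (cases "s = []") auto
    qed
  qed
  have "v \<le> min_suffix (u @ v)"
    using ge[OF min_suffix_props(1-3)[OF len]] by simp
  moreover have "min_suffix (u @ v) \<le> v"
    using min_suffix_props(4)[OF len _ ne] by simp
  ultimately show "min_suffix (u @ v) = v" by auto
  then show "min_suffix_rest (u @ v) = u" by (simp add: min_suffix_rest_def)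
qed

section \<open>Commutator calculus in the lower central series\<close>

definition group_comm :: "('a, 'b) monoid_scheme \<Rightarrow> 'a \<Rightarrow> 'a \<Rightarrow> 'a" where
  "group_comm G x y = x \<otimes>\<^bsub>G\<^esub> y \<otimes>\<^bsub>G\<^esub> inv\<^bsub>G\<^esub> x \<otimes>\<^bsub>G\<^esub> inv\<^bsub>G\<^esub> y"

context group
begin

abbreviation (input) "cm \<equiv> group_comm G"
abbreviation (input) "LC \<equiv> lower_central G"

lemma inv_mult_cancel [simp]:
  "x \<in> carrier G \<Longrightarrow> y \<in> carrier G \<Longrightarrow> inv x \<otimes> (x \<otimes> y) = y"
  "x \<in> carrier G \<Longrightarrow> y \<in> carrier G \<Longrightarrow> x \<otimes> (inv x \<otimes> y) = y"
  by (simp_all flip: m_assoc)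

lemma comm_closed [simp, intro]: "x \<in> carrier G \<Longrightarrow> y \<in> carrier G \<Longrightarrow> cm x y \<in> carrier G"
  by (simp add: group_comm_def)

lemma comm_self: "x \<in> carrier G \<Longrightarrow> cm x x = \<one>"
  by (simp add: group_comm_def m_assoc)

lemma inv_comm: "x \<in> carrier G \<Longrightarrow> y \<in> carrier G \<Longrightarrow> inv (cm x y) = cm y x"
  by (simp add: group_comm_def m_assoc inv_mult_group)

lemma comm_mult_left:
  "\<lbrakk>x \<in> carrier G; y \<in> carrier G; z \<in> carrier G\<rbrakk> \<Longrightarrow> cm (x \<otimes> y) z = x \<otimes> cm y z \<otimes> inv x \<otimes> cm x z"
  by (simp add: group_comm_def m_assoc inv_mult_group)

lemma comm_mult_right:
  "\<lbrakk>x \<in> carrier G; y \<in> carrier G; z \<in> carrier G\<rbrakk> \<Longrightarrow> cm x (y \<otimes> z) = cm x y \<otimes> (y \<otimes> cm x z \<otimes> inv y)"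
  by (simp add: group_comm_def m_assoc inv_mult_group)

lemma comm_inv_left:
  "\<lbrakk>x \<in> carrier G; z \<in> carrier G\<rbrakk> \<Longrightarrow> cm (inv x) z = inv x \<otimes> inv (cm x z) \<otimes> x"
  by (simp add: group_comm_def m_assoc inv_mult_group)

lemma comm_inv_right:
  "\<lbrakk>x \<in> carrier G; y \<in> carrier G\<rbrakk> \<Longrightarrow> cm x (inv y) = inv y \<otimes> inv (cm x y) \<otimes> y"
  by (simp add: group_comm_def m_assoc inv_mult_group)

lemma conj_eq_comm: "\<lbrakk>x \<in> carrier G; y \<in> carrier G\<rbrakk> \<Longrightarrow> x \<otimes> y \<otimes> inv x = cm x y \<otimes> y"
  by (simp add: group_comm_def m_assoc)

lemma conj_comm:
  "\<lbrakk>g \<in> carrier G; x \<in> carrier G; y \<in> carrier G\<rbrakk> \<Longrightarrow>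
    g \<otimes> cm x y \<otimes> inv g = cm (g \<otimes> x \<otimes> inv g) (g \<otimes> y \<otimes> inv g)"
  by (simp add: group_comm_def m_assoc inv_mult_group)

text \<open>The group form of the Jacobi identity. Its conjugations become invisible modulo higher
  terms of the series, see \<open>comm_conj_right_iff\<close>.\<close>

lemma hall_witt:
  assumes "x \<in> carrier G" "y \<in> carrier G" "z \<in> carrier G"
  shows "cm (cm x y) (y \<otimes> z \<otimes> inv y) \<otimes> (cm (cm y z) (z \<otimes> x \<otimes> inv z) \<otimes> cm (cm z x) (x \<otimes> y \<otimes> inv x)) = \<one>"
  using assms by (simp add: group_comm_def m_assoc inv_mult_group)

lemma normal_lower_central: "LC i \<lhd> G"
proof (induction i)
  case 0
  show ?case using normal_self by simp
next
  case (Suc j)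
  show ?case
  proof (cases j)
    case 0
    then show ?thesis using normal_self by simp
  next
  case i: (Suc i)
  interpret N: normal "LC (Suc i)" G using Suc i by simp
  show ?thesis
    unfolding i lower_central.simps commutator_subgroup_def group_comm_def[symmetric]
  proof (rule normal_generateI)
    show "{cm x y |x y. x \<in> LC (Suc i) \<and> y \<in> carrier G} \<subseteq> carrier G" by auto
    fix h g assume h: "h \<in> {cm x y |x y. x \<in> LC (Suc i) \<and> y \<in> carrier G}" and g: "g \<in> carrier G"
    then obtain x y where "h = cm x y" "x \<in> LC (Suc i)" "y \<in> carrier G" by blast
    then show "g \<otimes> h \<otimes> inv g \<in> {cm x y |x y. x \<in> LC (Suc i) \<and> y \<in> carrier G}"
      using g conj_comm[of g x y] N.mem_carrier N.inv_op_closed2 by blast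
  qed
  qed
qed

lemma subgroup_lower_central: "subgroup (LC i) G"
  using normal_lower_central normal_imp_subgroup by blast

lemma lower_central_carrier: "x \<in> LC i \<Longrightarrow> x \<in> carrier G"
  using subgroup.mem_carrier[OF subgroup_lower_central] .

lemma lower_central_conj: "x \<in> LC i \<Longrightarrow> g \<in> carrier G \<Longrightarrow> g \<otimes> x \<otimes> inv g \<in> LC i"
  using normal.inv_op_closed2[OF normal_lower_central] by blast

lemma lower_central_conj': "x \<in> LC i \<Longrightarrow> g \<in> carrier G \<Longrightarrow> inv g \<otimes> x \<otimes> g \<in> LC i"
  using normal.inv_op_closed1[OF normal_lower_central] by blast

lemma comm_mem_lower_central_Suc: "x \<in> LC i \<Longrightarrow> y \<in> carrier G \<Longrightarrow> cm x y \<in> LC (Suc i)"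
proof (cases i)
  case 0
  then show "x \<in> LC i \<Longrightarrow> y \<in> carrier G \<Longrightarrow> cm x y \<in> LC (Suc i)" by auto
next
  case (Suc j)
  assume "x \<in> LC i" "y \<in> carrier G"
  then show ?thesis
    unfolding Suc lower_central.simps commutator_subgroup_def group_comm_def[symmetric]
    by (intro generate.incl) blast
qed

text \<open>The condition \<open>i \<ge> 1\<close> keeps the dummy index 0 out: terms 0 and 1 are
  both the whole group and are not generated by commutators.\<close>

lemma lower_central_Suc_induct [consumes 2, case_names one incl inv mult]:
  assumes "g \<in> LC (Suc i)" "i \<ge> 1"
    and "P \<one>" "\<And>x y. x \<in> LC i \<Longrightarrow> y \<in> carrier G \<Longrightarrow> P (cm x y)"
    and "\<And>g. g \<in> LC (Suc i) \<Longrightarrow> P g \<Longrightarrow> P (inv g)"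
    and "\<And>g h. g \<in> LC (Suc i) \<Longrightarrow> P g \<Longrightarrow> h \<in> LC (Suc i) \<Longrightarrow> P h \<Longrightarrow> P (g \<otimes> h)"
  shows "P g"
proof -
  obtain j where i: "i = Suc j" using assms(2) by (cases i) auto
  have LC: "LC (Suc i) = generate G {cm x y |x y. x \<in> LC i \<and> y \<in> carrier G}"
    by (simp add: i commutator_subgroup_def group_comm_def)
  show ?thesis
    using assms(1) unfolding LC
  proof (induction rule: generate.induct)
    case (inv h)
    then obtain x y where "h = cm x y" "x \<in> LC i" "y \<in> carrier G" by blast
    then show ?case using assms(4,5) comm_mem_lower_central_Suc by blast
  next
    case (eng h1 h2)
    then show ?case using assms(6) by (simp add: LC)
  qed (use assms(3,4) in auto)
qed

lemma lower_central_Suc_subset: "LC (Suc i) \<subseteq> LC i"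
proof (cases "i = 0")
  case False
  interpret H: subgroup "LC i" G by (rule subgroup_lower_central)
  show ?thesis
  proof
    fix g assume "g \<in> LC (Suc i)"
    moreover have "i \<ge> 1" using False by simp
    ultimately show "g \<in> LC i"
    proof (induction rule: lower_central_Suc_induct)
      case (incl x y)
      have "cm x y = x \<otimes> (y \<otimes> inv x \<otimes> inv y)"
        using incl lower_central_carrier by (simp add: group_comm_def m_assoc)
      then show ?case using incl lower_central_conj by auto
    qed auto
  qed
qed simp

lemma lower_central_antimono: "i \<le> j \<Longrightarrow> LC j \<subseteq> LC i"
  by (rule lift_Suc_antimono_le[of LC, OF lower_central_Suc_subset])

lemma subgroup_induct_of:
  assumes "\<And>x. x \<in> S \<Longrightarrow> x \<in> carrier G" "\<one> \<in> S"
    and "\<And>x. x \<in> S \<Longrightarrow> inv x \<in> S" "\<And>x y. x \<in> S \<Longrightarrow> y \<in> S \<Longrightarrow> x \<otimes> y \<in> S"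
  shows "subgroup S G"
  using assms by (auto simp: subgroup_def)

text \<open>The three subgroups argument: induction on \<open>j\<close>, writing an element of the
  next term as a commutator of \<open>x\<close> and \<open>y\<close> and moving one bracket by
  Hall-Witt.\<close>

lemma comm_lower_central:
  assumes "i \<ge> 1" "j \<ge> 1"
  shows "a \<in> LC i \<Longrightarrow> b \<in> LC j \<Longrightarrow> cm a b \<in> LC (i + j)"
  using assms(2,1)
proof (induction j arbitrary: i a b rule: dec_induct)
  case base
  then show ?case using comm_mem_lower_central_Suc by simp
next
  case (step j)
  interpret H: subgroup "LC (i + Suc j)" G by (rule subgroup_lower_central)
  note [simp] = lower_central_carrier
  have "\<forall>a\<in>LC i. cm a b \<in> LC (i + Suc j)"
    using \<open>b \<in> LC (Suc j)\<close> \<open>1 \<le> j\<close>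
  proof (induction rule: lower_central_Suc_induct)
    case one
    have "cm a \<one> = \<one>" if "a \<in> LC i" for a using that by (simp add: group_comm_def)
    then show ?case using H.one_closed by metis
  next
    case (incl x y)
    show ?case
    proof
      fix a assume a: "a \<in> LC i"
      \<comment> \<open>Conjugating \<open>a\<close> backwards by \<open>y\<close> makes the first
        factor of the Hall-Witt identity exactly the commutator of \<open>cm x y\<close> with
        \<open>a\<close>.\<close>
      define a' where "a' = inv y \<otimes> a \<otimes> y"
      have a': "a' \<in> LC i" unfolding a'_def using a incl(2) by (rule lower_central_conj')
      have x: "x \<in> carrier G" using incl by simp
      have a'c: "a' \<in> carrier G" using a' by simp
      have 1: "cm (cm y a') (a' \<otimes> x \<otimes> inv a') \<in> LC (i + Suc j)"
      proof -
        have "inv (cm a' y) \<in> LC (Suc i)"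
          using subgroup.m_inv_closed[OF subgroup_lower_central] comm_mem_lower_central_Suc[OF a' incl(2)] .
        then have "cm y a' \<in> LC (Suc i)" using inv_comm a'c incl by simp
        moreover have "a' \<otimes> x \<otimes> inv a' \<in> LC j" using incl(1) a'c by (rule lower_central_conj)
        ultimately show ?thesis using step.IH[of "cm y a'" "Suc i"] by simp
      qed
      have 2: "cm (cm a' x) (x \<otimes> y \<otimes> inv x) \<in> LC (i + Suc j)"
        using comm_mem_lower_central_Suc[OF step.IH[OF a' incl(1) step.prems(3)]] x incl(2) by simp
      have "cm (cm x y) (y \<otimes> a' \<otimes> inv y) = inv (cm (cm y a') (a' \<otimes> x \<otimes> inv a') \<otimes> cm (cm a' x) (x \<otimes> y \<otimes> inv x))"
        using hall_witt[OF x incl(2) a'c] x incl(2) a'c by (intro inv_equality[symmetric]) auto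
      then have "cm (cm x y) (y \<otimes> a' \<otimes> inv y) \<in> LC (i + Suc j)"
        using 1 2 H.m_inv_closed H.m_closed by metis
      moreover have "y \<otimes> a' \<otimes> inv y = a" using a incl(2) by (simp add: a'_def m_assoc)
      ultimately have "inv (cm a (cm x y)) \<in> LC (i + Suc j)" using a x incl by (simp add: inv_comm)
      then have "inv (inv (cm a (cm x y))) \<in> LC (i + Suc j)" by (rule H.m_inv_closed)
      then show "cm a (cm x y) \<in> LC (i + Suc j)" using a x incl by simp
    qed
  next
    case (inv g)
    then show ?case by (auto simp: comm_inv_right simp del: add_Suc_right
          intro!: lower_central_conj' subgroup.m_inv_closed[OF subgroup_lower_central])
  next
    case (mult g h)
    show ?case
    proof
      fix a assume a: "a \<in> LC i"
      have ag: "cm a g \<in> LC (i + Suc j)" and ah: "cm a h \<in> LC (i + Suc j)" and g: "g \<in> carrier G"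
        using mult a by auto
      have "cm a g \<otimes> (g \<otimes> cm a h \<otimes> inv g) \<in> LC (i + Suc j)"
        using H.m_closed[OF ag lower_central_conj[OF ah g]] .
      then show "cm a (g \<otimes> h) \<in> LC (i + Suc j)" using mult a by (simp add: comm_mult_right)
    qed
  qed
  then show ?case using step.prems by blast
qed

text \<open>Such an \<open>H\<close> stands for a subgroup of the central quotient of term
  \<open>n\<close> by term \<open>n + 1\<close>; membership in \<open>H\<close> replaces congruences
  there.\<close>

definition between_lc :: "nat \<Rightarrow> 'a set \<Rightarrow> bool" where
  "between_lc n H \<longleftrightarrow> subgroup H G \<and> LC (Suc n) \<subseteq> H \<and> H \<subseteq> LC n"

lemma between_lc_conj:
  assumes "between_lc n H" "h \<in> H" "g \<in> carrier G"
  shows "g \<otimes> h \<otimes> inv g \<in> H" "inv g \<otimes> h \<otimes> g \<in> H"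
proof -
  interpret H: subgroup H G using assms by (simp add: between_lc_def)
  have conj: "x \<otimes> h \<otimes> inv x \<in> H" if "x \<in> carrier G" for x
  proof -
    have "inv (cm h x) \<in> H"
      using comm_mem_lower_central_Suc[of h n x] assms that by (auto simp: between_lc_def)
    then show ?thesis using that assms by (simp add: conj_eq_comm inv_comm)
  qed
  show "g \<otimes> h \<otimes> inv g \<in> H" using conj[OF assms(3)] .
  show "inv g \<otimes> h \<otimes> g \<in> H" using conj[of "inv g"] assms(3) by simp
qed

lemma between_lc_conj_iff:
  assumes "between_lc n H" "h \<in> carrier G" "g \<in> carrier G"
  shows "g \<otimes> h \<otimes> inv g \<in> H \<longleftrightarrow> h \<in> H"
proof
  assume "g \<otimes> h \<otimes> inv g \<in> H"
  from between_lc_conj(2)[OF assms(1) this assms(3)] show "h \<in> H"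
    using assms by (simp add: m_assoc)
qed (use between_lc_conj(1)[OF assms(1)] assms in auto)

text \<open>Linearity of the commutator in its left argument modulo \<open>H\<close>, which is
  invariant under conjugation. It reduces statements about all \<open>a\<close> to
  generators.\<close>

lemma subgroup_comm_left:
  assumes H: "between_lc n H" and b: "b \<in> carrier G"
  shows "subgroup {a \<in> carrier G. cm a b \<in> H} G"
proof -
  interpret H: subgroup H G using assms by (simp add: between_lc_def)
  show ?thesis
  proof (rule subgroup_induct_of)
    show "\<one> \<in> {a \<in> carrier G. cm a b \<in> H}" using b by (simp add: group_comm_def)
  next
    fix x assume "x \<in> {a \<in> carrier G. cm a b \<in> H}"
    then show "inv x \<in> {a \<in> carrier G. cm a b \<in> H}"
      using b between_lc_conj(2)[OF H, of "inv (cm x b)" x] H.m_inv_closed[of "cm x b"]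
      by (simp add: comm_inv_left)
  next
    fix x y assume "x \<in> {a \<in> carrier G. cm a b \<in> H}" "y \<in> {a \<in> carrier G. cm a b \<in> H}"
    then show "x \<otimes> y \<in> {a \<in> carrier G. cm a b \<in> H}"
      using b between_lc_conj(1)[OF H, of "cm y b" x] by (simp add: comm_mult_left)
  qed auto
qed

lemma comm_sym_mem:
  assumes "subgroup H G" "a \<in> carrier G" "b \<in> carrier G" "cm a b \<in> H"
  shows "cm b a \<in> H"
  using subgroup.m_inv_closed[OF assms(1,4)] assms by (simp add: inv_comm)

text \<open>Conjugating \<open>c\<close> by \<open>b\<close> changes the commutator by a conjugation
  and a factor containing \<open>cm x (cm b c)\<close>, which has weight
  \<open>p + q + s > n\<close> and so lies in \<open>H\<close>.\<close>

lemma comm_conj_right_iff: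
  assumes H: "between_lc n H"
    and "p \<ge> 1" "q \<ge> 1" "s \<ge> 1" "p + q = n" "x \<in> LC p" "c \<in> LC q" "b \<in> LC s"
  shows "cm x (b \<otimes> c \<otimes> inv b) \<in> H \<longleftrightarrow> cm x c \<in> H"
proof -
  interpret H: subgroup H G using H by (simp add: between_lc_def)
  note [simp] = lower_central_carrier
  have car: "x \<in> carrier G" "c \<in> carrier G" "b \<in> carrier G" using assms by auto
  have bc: "cm b c \<in> LC (s + q)" using comm_lower_central assms by simp
  have "cm x (cm b c) \<in> LC (p + (s + q))" using comm_lower_central[of p "s + q"] bc assms by simp
  then have 1: "cm x (cm b c) \<in> H"
    using lower_central_antimono[of "Suc n" "p + (s + q)"] assms by (auto simp: between_lc_def)
  have "cm x (b \<otimes> c \<otimes> inv b) = cm x (cm b c) \<otimes> (cm b c \<otimes> cm x c \<otimes> inv (cm b c))"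
    using car by (simp add: conj_eq_comm comm_mult_right del: inv_mult_group)
  moreover have "u \<otimes> v \<in> H \<longleftrightarrow> v \<in> H" if "u \<in> H" "v \<in> carrier G" for u v
  proof
    assume "u \<otimes> v \<in> H"
    then have "inv u \<otimes> (u \<otimes> v) \<in> H" using that by blast
    then show "v \<in> H" using that by simp
  qed (use that in auto)
  ultimately have "cm x (b \<otimes> c \<otimes> inv b) \<in> H \<longleftrightarrow> cm b c \<otimes> cm x c \<otimes> inv (cm b c) \<in> H"
    using 1 car by simp
  also have "\<dots> \<longleftrightarrow> cm x c \<in> H" using between_lc_conj_iff[OF H] car by simp
  finally show ?thesis .
qed

text \<open>Hall-Witt with its conjugations removed modulo \<open>H\<close>: when two of the three
  double commutators lie in \<open>H\<close>, so does the third.\<close>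

lemma jacobi_mod:
  assumes H: "between_lc n H"
    and ijk: "i \<ge> 1" "j \<ge> 1" "k \<ge> 1" "i + j + k = n"
    and abc: "a \<in> LC i" "b \<in> LC j" "c \<in> LC k"
    and 1: "cm (cm a c) b \<in> H" and 2: "cm a (cm b c) \<in> H"
  shows "cm (cm a b) c \<in> H"
proof -
  interpret H: subgroup H G using H by (simp add: between_lc_def)
  have car: "a \<in> carrier G" "b \<in> carrier G" "c \<in> carrier G" using abc lower_central_carrier by auto
  have ab: "cm a b \<in> LC (i + j)" and bc: "cm b c \<in> LC (j + k)" and ca: "cm c a \<in> LC (k + i)"
    using comm_lower_central ijk abc by auto
  have "cm (cm b c) a \<in> H" using comm_sym_mem[OF H.is_subgroup _ _ 2] car by simp
  then have P: "cm (cm b c) (c \<otimes> a \<otimes> inv c) \<in> H"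
    using comm_conj_right_iff[OF H, of "j + k" i k "cm b c" a c] ijk bc abc by simp
  have "inv (cm a c) \<in> {a \<in> carrier G. cm a b \<in> H}"
    using subgroup.m_inv_closed[OF subgroup_comm_left[OF H car(2)], of "cm a c"] 1 car by simp
  then have "cm (cm c a) b \<in> H" using car by (simp add: inv_comm)
  then have Q: "cm (cm c a) (a \<otimes> b \<otimes> inv a) \<in> H"
    using comm_conj_right_iff[OF H, of "k + i" j i "cm c a" b a] ijk ca abc by simp
  have "cm (cm a b) (b \<otimes> c \<otimes> inv b) = inv (cm (cm b c) (c \<otimes> a \<otimes> inv c) \<otimes> cm (cm c a) (a \<otimes> b \<otimes> inv a))"
    using hall_witt[OF car] car by (intro inv_equality[symmetric]) auto
  then have "cm (cm a b) (b \<otimes> c \<otimes> inv b) \<in> H" using P Q by simp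
  then show ?thesis
    using comm_conj_right_iff[OF H, of "i + j" k j "cm a b" c b] ijk ab abc by simp
qed

end

lemma (in group) lower_central_hom:
  assumes "\<phi> \<in> hom G G" "x \<in> LC i"
  shows "\<phi> x \<in> LC i"
proof -
  interpret h: group_hom G G \<phi> using assms(1) is_group by (auto simp: group_hom_def group_hom_axioms_def)
  show ?thesis
    using assms(2)
  proof (induction i arbitrary: x)
    case (Suc i)
    interpret H: subgroup "LC (Suc i)" G by (rule subgroup_lower_central)
    show ?case
    proof (cases "i = 0")
      case False
      then have "i \<ge> 1" by simp
      with Suc.prems show ?thesis
      proof (induction rule: lower_central_Suc_induct)
        case (incl x y)
        have "\<phi> (cm x y) = cm (\<phi> x) (\<phi> y)"
          using incl lower_central_carrier by (simp add: group_comm_def)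
        then show ?case using Suc.IH incl comm_mem_lower_central_Suc by simp
      next
        case (inv g)
        then show ?case using lower_central_carrier[of g "Suc i"] by simp
      next
        case (mult g h)
        then show ?case using lower_central_carrier[of _ "Suc i"] by simp
      qed simp
    qed (use Suc.prems in simp)
  qed simp
qed

section \<open>Twisted conjugacy along the lower central series\<close>

locale group_endo = group +
  fixes \<phi> :: "'a \<Rightarrow> 'a"
  assumes endo: "\<phi> \<in> hom G G"
begin

lemma endo_closed [simp]: "x \<in> carrier G \<Longrightarrow> \<phi> x \<in> carrier G"
  using endo by (auto simp: hom_def)

lemma endo_mult: "x \<in> carrier G \<Longrightarrow> y \<in> carrier G \<Longrightarrow> \<phi> (x \<otimes> y) = \<phi> x \<otimes> \<phi> y"
  using endo by (auto simp: hom_def)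

definition lc_cong :: "nat \<Rightarrow> 'a \<Rightarrow> 'a \<Rightarrow> bool" where
  "lc_cong n x y \<longleftrightarrow> x \<otimes> inv y \<in> LC n"

lemma lc_cong_refl: "x \<in> carrier G \<Longrightarrow> lc_cong n x x"
  using subgroup.one_closed[OF subgroup_lower_central] by (simp add: lc_cong_def)

lemma lc_cong_sym: "x \<in> carrier G \<Longrightarrow> y \<in> carrier G \<Longrightarrow> lc_cong n x y \<Longrightarrow> lc_cong n y x"
  using subgroup.m_inv_closed[OF subgroup_lower_central, of "x \<otimes> inv y" n]
  by (simp add: lc_cong_def inv_mult_group)

lemma lc_cong_trans:
  "x \<in> carrier G \<Longrightarrow> y \<in> carrier G \<Longrightarrow> z \<in> carrier G \<Longrightarrow> lc_cong n x y \<Longrightarrow> lc_cong n y z \<Longrightarrow> lc_cong n x z"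
  using subgroup.m_closed[OF subgroup_lower_central, of "x \<otimes> inv y" n "y \<otimes> inv z"]
  by (simp add: lc_cong_def m_assoc)

lemma lc_cong_mult_left:
  assumes "x \<in> carrier G" "y \<in> carrier G" "z \<in> carrier G" "lc_cong n x y"
  shows "lc_cong n (z \<otimes> x) (z \<otimes> y)"
  using lower_central_conj[of "x \<otimes> inv y" n z] assms by (simp add: lc_cong_def m_assoc inv_mult_group)

lemma lc_cong_mult_right:
  assumes "x \<in> carrier G" "y \<in> carrier G" "z \<in> carrier G" "lc_cong n x y"
  shows "lc_cong n (x \<otimes> z) (y \<otimes> z)"
  using assms by (simp add: lc_cong_def m_assoc inv_mult_group)

lemma lc_cong_mult_right_cancel:
  assumes "x \<in> carrier G" "y \<in> carrier G" "z \<in> carrier G" "lc_cong n (x \<otimes> z) (y \<otimes> z)"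
  shows "lc_cong n x y"
  using assms by (simp add: lc_cong_def m_assoc inv_mult_group)

lemma lc_cong_commute:
  assumes "x \<in> LC n" "y \<in> carrier G"
  shows "lc_cong (Suc n) (x \<otimes> y) (y \<otimes> x)"
  using comm_mem_lower_central_Suc[OF assms] lower_central_carrier assms
  by (simp add: lc_cong_def group_comm_def m_assoc inv_mult_group)

lemma lc_cong_mono: "n \<le> m \<Longrightarrow> lc_cong m x y \<Longrightarrow> lc_cong n x y"
  using lower_central_antimono[of n m] by (auto simp: lc_cong_def)

definition twisted_cong :: "nat \<Rightarrow> 'a \<Rightarrow> 'a \<Rightarrow> bool" where
  "twisted_cong n x y \<longleftrightarrow> (\<exists>z\<in>carrier G. lc_cong n x (z \<otimes> y \<otimes> inv (\<phi> z)))"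

definition twisted_separated :: "nat \<Rightarrow> 'a set \<Rightarrow> bool" where
  "twisted_separated n S \<longleftrightarrow> S \<subseteq> carrier G \<and> (\<forall>s\<in>S. \<forall>t\<in>S. twisted_cong n s t \<longrightarrow> s = t)"

definition twisted_covering :: "nat \<Rightarrow> 'a set \<Rightarrow> bool" where
  "twisted_covering n S \<longleftrightarrow> S \<subseteq> carrier G \<and> (\<forall>x\<in>carrier G. \<exists>s\<in>S. twisted_cong n x s)"

text \<open>Every twisted stabilizer in the quotient by term \<open>n\<close> is trivial. Without
  this, a stabilizer could merge cosets in a fibre over a class, and the determinant would
  overcount.\<close>

definition twisted_rigid :: "nat \<Rightarrow> bool" where
  "twisted_rigid n \<longleftrightarrow> (\<forall>s\<in>carrier G. \<forall>z\<in>carrier G. lc_cong n s (z \<otimes> s \<otimes> inv (\<phi> z)) \<longrightarrow> z \<in> LC n)"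

lemma twisted_cong_mono: "n \<le> m \<Longrightarrow> twisted_cong m x y \<Longrightarrow> twisted_cong n x y"
  unfolding twisted_cong_def using lc_cong_mono by blast

text \<open>\<open>\<kappa>\<close> induces an isomorphism from term \<open>k\<close> modulo term
  \<open>k + 1\<close> onto the integer vectors of length \<open>m\<close>, under which
  \<open>\<phi>\<close> becomes the matrix \<open>L\<close>. Outside term \<open>k\<close> its
  values are arbitrary.\<close>

definition lc_coordinates :: "nat \<Rightarrow> nat \<Rightarrow> ('a \<Rightarrow> int vec) \<Rightarrow> int mat \<Rightarrow> bool" where
  "lc_coordinates k m \<kappa> L \<longleftrightarrow> L \<in> carrier_mat m m \<and> \<kappa> ` LC k = carrier_vec m \<and>
     (\<forall>x\<in>LC k. \<forall>y\<in>LC k. \<kappa> (x \<otimes> y) = \<kappa> x + \<kappa> y) \<and>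
     (\<forall>x\<in>LC k. \<kappa> x = 0\<^sub>v m \<longrightarrow> x \<in> LC (Suc k)) \<and>
     (\<forall>x\<in>LC (Suc k). \<kappa> x = 0\<^sub>v m) \<and>
     (\<forall>x\<in>LC k. \<kappa> (\<phi> x) = L *\<^sub>v \<kappa> x)"

context
  fixes k m :: nat and \<kappa> :: "'a \<Rightarrow> int vec" and L :: "int mat"
  assumes coord: "lc_coordinates k m \<kappa> L"
begin

interpretation H: subgroup "LC k" G by (rule subgroup_lower_central)

lemma coord_carrier: "x \<in> LC k \<Longrightarrow> \<kappa> x \<in> carrier_vec m"
  using coord by (auto simp: lc_coordinates_def)

lemma coord_dim: "x \<in> LC k \<Longrightarrow> dim_vec (\<kappa> x) = m"
  using coord_carrier by auto

lemma coord_mult: "x \<in> LC k \<Longrightarrow> y \<in> LC k \<Longrightarrow> \<kappa> (x \<otimes> y) = \<kappa> x + \<kappa> y"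
  using coord by (simp add: lc_coordinates_def)

lemma coord_inv:
  assumes "x \<in> LC k"
  shows "\<kappa> (inv x) = - \<kappa> x"
proof -
  have "\<kappa> x + \<kappa> (inv x) = \<kappa> \<one>" using coord_mult[of x "inv x"] assms by simp
  also have "\<dots> = 0\<^sub>v m"
    using coord subgroup.one_closed[OF subgroup_lower_central] by (simp add: lc_coordinates_def)
  finally have *: "\<kappa> x + \<kappa> (inv x) = 0\<^sub>v m" .
  show ?thesis
  proof (rule eq_vecI)
    fix i assume "i < dim_vec (- \<kappa> x)"
    then have i: "i < m" using coord_dim assms by simp
    have "(\<kappa> x + \<kappa> (inv x)) $ i = 0" using * i by simp
    then show "\<kappa> (inv x) $ i = (- \<kappa> x) $ i" using i coord_dim assms by simp
  qed (simp add: coord_dim assms)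
qed

lemma lc_cong_coord:
  assumes "x \<in> LC k" "y \<in> LC k"
  shows "lc_cong (Suc k) x y \<longleftrightarrow> \<kappa> x = \<kappa> y"
proof -
  have "lc_cong (Suc k) x y \<longleftrightarrow> \<kappa> (x \<otimes> inv y) = 0\<^sub>v m"
    unfolding lc_cong_def using coord assms by (auto simp: lc_coordinates_def)
  also have "\<kappa> (x \<otimes> inv y) = \<kappa> x - \<kappa> y"
    using assms minus_add_uminus_vec[OF coord_carrier[OF assms(1)] coord_carrier[OF assms(2)]]
    by (simp add: coord_mult coord_inv)
  also have "\<kappa> x - \<kappa> y = 0\<^sub>v m \<longleftrightarrow> \<kappa> x = \<kappa> y"
  proof
    assume *: "\<kappa> x - \<kappa> y = 0\<^sub>v m"
    show "\<kappa> x = \<kappa> y"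
    proof (rule eq_vecI)
      fix i assume "i < dim_vec (\<kappa> y)"
      then have i: "i < m" using coord_dim assms by simp
      have "(\<kappa> x - \<kappa> y) $ i = 0" using * i by simp
      then show "\<kappa> x $ i = \<kappa> y $ i" using i coord_dim assms by simp
    qed (simp add: coord_dim assms)
  qed (use coord_carrier assms in auto)
  finally show ?thesis .
qed

text \<open>Inside term \<open>k\<close>, modulo term \<open>k + 1\<close>, twisted conjugation is
  translation by a vector in the image of \<open>1 - L\<close>. This turns classes in a fibre into
  cosets of a lattice.\<close>

lemma coord_twist:
  assumes "z \<in> LC k" "e \<in> LC k"
  shows "z \<otimes> e \<otimes> inv (\<phi> z) \<in> LC k"
    and "\<kappa> (z \<otimes> e \<otimes> inv (\<phi> z)) = \<kappa> e + (1\<^sub>m m - L) *\<^sub>v \<kappa> z"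
proof -
  have \<phi>z: "\<phi> z \<in> LC k" using lower_central_hom[OF endo assms(1)] .
  then show "z \<otimes> e \<otimes> inv (\<phi> z) \<in> LC k" using assms by auto
  have L: "L \<in> carrier_mat m m" "\<kappa> (\<phi> z) = L *\<^sub>v \<kappa> z" using coord assms by (auto simp: lc_coordinates_def)
  have "(1\<^sub>m m - L) *\<^sub>v \<kappa> z = \<kappa> z - L *\<^sub>v \<kappa> z"
    using L coord_carrier[OF assms(1)] by (simp add: minus_mult_distrib_mat_vec[of _ m m])
  moreover have "\<kappa> (z \<otimes> e \<otimes> inv (\<phi> z)) = \<kappa> z + \<kappa> e + - (L *\<^sub>v \<kappa> z)"
    using assms \<phi>z L by (simp add: coord_mult coord_inv)
  ultimately show "\<kappa> (z \<otimes> e \<otimes> inv (\<phi> z)) = \<kappa> e + (1\<^sub>m m - L) *\<^sub>v \<kappa> z"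
    using coord_carrier assms L by (intro eq_vecI) (auto simp: coord_dim)
qed

text \<open>Moving \<open>s\<close> past the inverse of \<open>\<phi> z\<close>, an element of term
  \<open>k\<close>, costs only an element of term \<open>k + 1\<close>. So \<open>z\<close> acts on
  the factor \<open>e\<close> and leaves \<open>s\<close> alone.\<close>

lemma lc_cong_twist_commute:
  assumes "z \<in> LC k" "e \<in> LC k" "s \<in> carrier G"
  shows "lc_cong (Suc k) (z \<otimes> (e \<otimes> s) \<otimes> inv (\<phi> z)) (z \<otimes> e \<otimes> inv (\<phi> z) \<otimes> s)"
proof -
  have \<phi>z: "inv (\<phi> z) \<in> LC k" using lower_central_hom[OF endo assms(1)] by simp
  have car: "z \<in> carrier G" "e \<in> carrier G" "inv (\<phi> z) \<in> carrier G"
    using assms \<phi>z lower_central_carrier by blast+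
  have "lc_cong (Suc k) (s \<otimes> inv (\<phi> z)) (inv (\<phi> z) \<otimes> s)"
    by (rule lc_cong_sym[OF _ _ lc_cong_commute[OF \<phi>z assms(3)]]) (use assms(3) car in auto)
  from lc_cong_mult_left[OF _ _ _ this, of "z \<otimes> e"] show ?thesis
    using car assms(3) by (simp add: m_assoc)
qed

text \<open>A stabilizing \<open>z\<close> lies in term \<open>k\<close> by the hypothesis one level
  below; there it translates by \<open>1 - L\<close> applied to its coordinates, so these lie in the
  kernel of an injective matrix.\<close>

lemma twisted_rigid_Suc:
  assumes "twisted_rigid k" "det (1\<^sub>m m - L) \<noteq> 0"
  shows "twisted_rigid (Suc k)"
  unfolding twisted_rigid_def
proof (intro ballI impI)
  fix s z assume s: "s \<in> carrier G" and zc: "z \<in> carrier G" and c: "lc_cong (Suc k) s (z \<otimes> s \<otimes> inv (\<phi> z))"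
  have "lc_cong k s (z \<otimes> s \<otimes> inv (\<phi> z))" by (rule lc_cong_mono[OF _ c]) simp
  then have z: "z \<in> LC k" using assms(1) s zc unfolding twisted_rigid_def by blast
  have one: "\<one> \<in> LC k" by simp
  have "lc_cong (Suc k) s (z \<otimes> \<one> \<otimes> inv (\<phi> z) \<otimes> s)"
  proof -
    have t: "lc_cong (Suc k) (z \<otimes> s \<otimes> inv (\<phi> z)) (z \<otimes> \<one> \<otimes> inv (\<phi> z) \<otimes> s)"
      using lc_cong_twist_commute[OF z one s] s by simp
    show ?thesis by (rule lc_cong_trans[OF _ _ _ c t]) (use s zc in auto)
  qed
  then have "lc_cong (Suc k) (\<one> \<otimes> s) (z \<otimes> \<one> \<otimes> inv (\<phi> z) \<otimes> s)" using s by simp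
  then have "lc_cong (Suc k) \<one> (z \<otimes> \<one> \<otimes> inv (\<phi> z))"
    by (rule lc_cong_mult_right_cancel[rotated 3]) (use s zc in auto)
  then have "\<kappa> \<one> = \<kappa> \<one> + (1\<^sub>m m - L) *\<^sub>v \<kappa> z"
    using lc_cong_coord[OF one coord_twist(1)[OF z one]] coord_twist(2)[OF z one] by simp
  moreover have L: "1\<^sub>m m - L \<in> carrier_mat m m" using coord by (auto simp: lc_coordinates_def)
  moreover have "\<kappa> \<one> = 0\<^sub>v m"
    using coord subgroup.one_closed[OF subgroup_lower_central] by (simp add: lc_coordinates_def)
  ultimately have "(1\<^sub>m m - L) *\<^sub>v \<kappa> z = 0\<^sub>v m"
    using coord_carrier[OF z] by (metis left_zero_vec mult_mat_vec_carrier)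
  then have "\<kappa> z = 0\<^sub>v m"
    using det_0_iff_vec_prod_zero[OF L] assms(2) coord_carrier[OF z] by blast
  then show "z \<in> LC (Suc k)" using coord z by (simp add: lc_coordinates_def)
qed

definition coord_section :: "int vec \<Rightarrow> 'a" where
  "coord_section v = (SOME x. x \<in> LC k \<and> \<kappa> x = v)"

lemma coord_section:
  assumes "v \<in> carrier_vec m"
  shows "coord_section v \<in> LC k" "\<kappa> (coord_section v) = v"
proof -
  have "v \<in> \<kappa> ` LC k" using coord assms by (simp add: lc_coordinates_def)
  then have "\<exists>x. x \<in> LC k \<and> \<kappa> x = v" by blast
  from someI_ex[OF this] show "coord_section v \<in> LC k" "\<kappa> (coord_section v) = v"
    by (auto simp: coord_section_def)
qed

text \<open>Reducing a conjugating element \<open>z\<close> to level \<open>k\<close> gives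
  \<open>s = s'\<close> by separation; rigidity then puts \<open>z\<close> into term
  \<open>k\<close>, where it only translates \<open>e'\<close> by a lattice vector.\<close>

lemma twisted_cong_pair_eq:
  assumes E: "E \<subseteq> carrier_vec m" "\<And>e e' y. e \<in> E \<Longrightarrow> e' \<in> E \<Longrightarrow> y \<in> carrier_vec m \<Longrightarrow>
        e = e' + (1\<^sub>m m - L) *\<^sub>v y \<Longrightarrow> e = e'"
    and rigid: "twisted_rigid k" and S: "twisted_separated k S"
    and mem: "e \<in> E" "e' \<in> E" "s \<in> S" "s' \<in> S"
    and c: "twisted_cong (Suc k) (coord_section e \<otimes> s) (coord_section e' \<otimes> s')"
  shows "e = e' \<and> s = s'"
proof -
  let ?e = "coord_section e" and ?e' = "coord_section e'"
  have e: "?e \<in> LC k" "?e' \<in> LC k" and \<kappa>e: "\<kappa> ?e = e" "\<kappa> ?e' = e'"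
    using coord_section E(1) mem by auto
  have s: "s \<in> carrier G" "s' \<in> carrier G" using S mem by (auto simp: twisted_separated_def)
  have ec: "?e \<in> carrier G" "?e' \<in> carrier G" using e lower_central_carrier by blast+
  obtain z where z: "z \<in> carrier G"
    and cz: "lc_cong (Suc k) (?e \<otimes> s) (z \<otimes> (?e' \<otimes> s') \<otimes> inv (\<phi> z))"
    using c unfolding twisted_cong_def by blast
  have triv: "lc_cong k (x \<otimes> t) t" if "x \<in> LC k" "t \<in> carrier G" for x t
    using that lower_central_carrier[of x k] by (simp add: lc_cong_def m_assoc)
  have a1: "lc_cong k s (?e \<otimes> s)" by (rule lc_cong_sym[OF _ _ triv[OF e(1) s(1)]]) (use ec s in auto)
  have a2: "lc_cong k (?e \<otimes> s) (z \<otimes> (?e' \<otimes> s') \<otimes> inv (\<phi> z))" using cz lc_cong_mono[of k "Suc k"] by simp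
  have a3: "lc_cong k (z \<otimes> (?e' \<otimes> s') \<otimes> inv (\<phi> z)) (z \<otimes> s' \<otimes> inv (\<phi> z))"
    using triv[OF e(2) s(2)] ec s z by (intro lc_cong_mult_right lc_cong_mult_left) auto
  have a4: "lc_cong k s (z \<otimes> (?e' \<otimes> s') \<otimes> inv (\<phi> z))"
    by (rule lc_cong_trans[OF _ _ _ a1 a2]) (use s ec z in auto)
  have sz: "lc_cong k s (z \<otimes> s' \<otimes> inv (\<phi> z))"
    by (rule lc_cong_trans[OF _ _ _ a4 a3]) (use s ec z in auto)
  then have "twisted_cong k s s'" using z by (auto simp: twisted_cong_def)
  then have ss: "s = s'" using S mem by (auto simp: twisted_separated_def)
  then have zk: "z \<in> LC k" using rigid sz s z unfolding twisted_rigid_def by blast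
  have "lc_cong (Suc k) (?e \<otimes> s) (z \<otimes> ?e' \<otimes> inv (\<phi> z) \<otimes> s)"
    by (rule lc_cong_trans[OF _ _ _ cz[folded ss] lc_cong_twist_commute[OF zk e(2) s(1)]])
       (use s z ec in auto)
  then have "lc_cong (Suc k) ?e (z \<otimes> ?e' \<otimes> inv (\<phi> z))"
    by (rule lc_cong_mult_right_cancel[rotated 3]) (use s z ec in auto)
  then have "e = e' + (1\<^sub>m m - L) *\<^sub>v \<kappa> z"
    using lc_cong_coord[OF e(1) coord_twist(1)[OF zk e(2)]] coord_twist(2)[OF zk e(2)] \<kappa>e by simp
  then show ?thesis using E(2)[OF mem(1,2) coord_carrier[OF zk]] ss by blast
qed

lemma twisted_covering_pairs:
  assumes E: "E \<subseteq> carrier_vec m" "\<And>x. x \<in> carrier_vec m \<Longrightarrow> \<exists>e\<in>E. \<exists>y\<in>carrier_vec m. x = e + (1\<^sub>m m - L) *\<^sub>v y"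
    and S: "twisted_covering k S"
  shows "twisted_covering (Suc k) ((\<lambda>(e, s). coord_section e \<otimes> s) ` (E \<times> S))"
  unfolding twisted_covering_def
proof (intro conjI ballI)
  have Sc: "s \<in> carrier G" if "s \<in> S" for s using S that by (auto simp: twisted_covering_def)
  have sec: "coord_section e \<in> carrier G" if "e \<in> E" for e
    using coord_section(1) lower_central_carrier E(1) that by blast
  show "(\<lambda>(e, s). coord_section e \<otimes> s) ` (E \<times> S) \<subseteq> carrier G" using Sc sec by auto
  fix x assume x: "x \<in> carrier G"
  then obtain s z where s: "s \<in> S" and z: "z \<in> carrier G" and xz: "lc_cong k x (z \<otimes> s \<otimes> inv (\<phi> z))"
    using S unfolding twisted_covering_def twisted_cong_def by blast
  note sc = Sc[OF s]
  \<comment> \<open>Twisting \<open>x\<close> back by \<open>z\<close> makes it congruent to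
    \<open>s\<close> modulo term \<open>k\<close>; what remains is a correction \<open>e'\<close>
    inside term \<open>k\<close>.\<close>
  define y where "y = inv z \<otimes> x \<otimes> \<phi> z"
  define e' where "e' = y \<otimes> inv s"
  have yc: "y \<in> carrier G" using x z by (simp add: y_def)
  have "lc_cong k y (inv z \<otimes> (z \<otimes> s \<otimes> inv (\<phi> z)) \<otimes> \<phi> z)"
    unfolding y_def using xz x z sc by (intro lc_cong_mult_right lc_cong_mult_left) auto
  then have e': "e' \<in> LC k" using z sc by (simp add: e'_def lc_cong_def m_assoc)
  then obtain e v where e: "e \<in> E" "v \<in> carrier_vec m" "\<kappa> e' = e + (1\<^sub>m m - L) *\<^sub>v v"
    using E(2) coord_carrier by blast
  define w where "w = coord_section v"
  let ?e = "coord_section e"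
  have w: "w \<in> LC k" "\<kappa> w = v" using coord_section e by (auto simp: w_def)
  have ek: "?e \<in> LC k" "\<kappa> ?e = e" using coord_section e E(1) by auto
  have wc: "w \<in> carrier G" and ec: "?e \<in> carrier G" using w ek lower_central_carrier by blast+
  have 1: "lc_cong (Suc k) e' (w \<otimes> ?e \<otimes> inv (\<phi> w))"
    using lc_cong_coord[OF e' coord_twist(1)[OF w(1) ek(1)]] coord_twist(2)[OF w(1) ek(1)] w ek e by simp
  have y: "y = e' \<otimes> s" using yc sc by (simp add: e'_def m_assoc)
  have e'c: "e' \<in> carrier G" using yc sc by (simp add: e'_def)
  have "lc_cong (Suc k) y (w \<otimes> ?e \<otimes> inv (\<phi> w) \<otimes> s)"
    unfolding y using 1 wc ec sc e'c by (intro lc_cong_mult_right) auto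
  moreover have "lc_cong (Suc k) (w \<otimes> ?e \<otimes> inv (\<phi> w) \<otimes> s) (w \<otimes> (?e \<otimes> s) \<otimes> inv (\<phi> w))"
    by (rule lc_cong_sym[OF _ _ lc_cong_twist_commute[OF w(1) ek(1) sc]]) (use wc ec sc in auto)
  ultimately have "lc_cong (Suc k) y (w \<otimes> (?e \<otimes> s) \<otimes> inv (\<phi> w))"
    by (rule lc_cong_trans[rotated 3]) (use wc ec sc yc in auto)
  then have "lc_cong (Suc k) (z \<otimes> y \<otimes> inv (\<phi> z)) (z \<otimes> (w \<otimes> (?e \<otimes> s) \<otimes> inv (\<phi> w)) \<otimes> inv (\<phi> z))"
    using wc ec sc yc z by (intro lc_cong_mult_right lc_cong_mult_left) auto
  moreover have "z \<otimes> y \<otimes> inv (\<phi> z) = x" using x z by (simp add: y_def m_assoc)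
  moreover have "z \<otimes> (w \<otimes> (?e \<otimes> s) \<otimes> inv (\<phi> w)) \<otimes> inv (\<phi> z) = (z \<otimes> w) \<otimes> (?e \<otimes> s) \<otimes> inv (\<phi> (z \<otimes> w))"
    using z wc ec sc by (simp add: m_assoc endo_mult inv_mult_group)
  ultimately have "twisted_cong (Suc k) x (?e \<otimes> s)"
    using z wc unfolding twisted_cong_def by (metis m_closed)
  then show "\<exists>t\<in>(\<lambda>(e, s). coord_section e \<otimes> s) ` (E \<times> S). twisted_cong (Suc k) x t"
    using e(1) s by force
qed

lemma twisted_transversal_Suc:
  assumes "det (1\<^sub>m m - L) \<noteq> 0" "twisted_rigid k"
    and S: "twisted_separated k S" "twisted_covering k S" "finite S"
  shows "\<exists>S'. twisted_separated (Suc k) S' \<and> twisted_covering (Suc k) S' \<and> finite S' \<and>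
    card S' = card S * nat \<bar>det (1\<^sub>m m - L)\<bar>"
proof -
  have L: "1\<^sub>m m - L \<in> carrier_mat m m" using coord by (auto simp: lc_coordinates_def)
  obtain E where E: "lattice_transversal m (1\<^sub>m m - L) E" "finite E" "card E = nat \<bar>det (1\<^sub>m m - L)\<bar>"
    using finite_lattice_transversal[OF L assms(1)] by blast
  let ?p = "\<lambda>(e, s). coord_section e \<otimes> s"
  have Em: "E \<subseteq> carrier_vec m" using E by (simp add: lattice_transversal_def)
  have cov: "twisted_covering (Suc k) (?p ` (E \<times> S))"
    by (rule twisted_covering_pairs[OF Em _ S(2)]) (use E in \<open>auto simp: lattice_transversal_def\<close>)
  have eq: "e = e' \<and> s = s'" if "e \<in> E" "e' \<in> E" "s \<in> S" "s' \<in> S"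
    "twisted_cong (Suc k) (coord_section e \<otimes> s) (coord_section e' \<otimes> s')" for e e' s s'
    by (rule twisted_cong_pair_eq[OF Em _ assms(2) S(1) that])
       (use E in \<open>auto simp: lattice_transversal_def\<close>)
  have sep: "twisted_separated (Suc k) (?p ` (E \<times> S))"
    unfolding twisted_separated_def
  proof (intro conjI ballI impI)
    show "?p ` (E \<times> S) \<subseteq> carrier G" using cov by (simp add: twisted_covering_def)
    fix x y assume "x \<in> ?p ` (E \<times> S)" "y \<in> ?p ` (E \<times> S)" and xy: "twisted_cong (Suc k) x y"
    then obtain e s e' s' where *: "e \<in> E" "s \<in> S" "x = coord_section e \<otimes> s"
      "e' \<in> E" "s' \<in> S" "y = coord_section e' \<otimes> s'" by auto
    then show "x = y" using eq[OF *(1,4,2,5)] xy by simp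
  qed
  have "inj_on ?p (E \<times> S)"
  proof (rule inj_onI, clarify)
    fix e s e' s' assume *: "e \<in> E" "s \<in> S" "e' \<in> E" "s' \<in> S"
      "coord_section e \<otimes> s = coord_section e' \<otimes> s'"
    have c: "coord_section e' \<otimes> s' \<in> carrier G" using cov * by (auto simp: twisted_covering_def)
    then have "twisted_cong (Suc k) (coord_section e' \<otimes> s') (coord_section e' \<otimes> s')"
      unfolding twisted_cong_def
      using lc_cong_refl[OF c] group_hom.hom_one[of G G \<phi>] endo is_group
      by (intro bexI[of _ \<one>]) (auto simp: group_hom_def group_hom_axioms_def)
    then show "e = e' \<and> s = s'" using eq[of e e' s s'] * by simp
  qed
  then have "card (?p ` (E \<times> S)) = card S * nat \<bar>det (1\<^sub>m m - L)\<bar>"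
    using E by (simp add: card_image card_cartesian_product mult.commute)
  then show ?thesis using sep cov E S by (intro exI[of _ "?p ` (E \<times> S)"]) auto
qed

text \<open>A single fibre suffices, the one over the class of the identity: it already contains
  infinitely many lattice cosets.\<close>

lemma infinite_twisted_separated_Suc:
  assumes "det (1\<^sub>m m - L) = 0" "twisted_rigid k"
  shows "\<exists>S. twisted_separated (Suc k) S \<and> infinite S"
proof -
  have L: "1\<^sub>m m - L \<in> carrier_mat m m" using coord by (auto simp: lc_coordinates_def)
  obtain E where E: "E \<subseteq> carrier_vec m" "infinite E"
    "\<And>e e' y. e \<in> E \<Longrightarrow> e' \<in> E \<Longrightarrow> y \<in> carrier_vec m \<Longrightarrow> e = e' + (1\<^sub>m m - L) *\<^sub>v y \<Longrightarrow> e = e'"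
    using infinite_lattice_cosets[OF L assms(1)] by blast
  have one: "twisted_separated k {\<one>}" by (simp add: twisted_separated_def)
  have sec: "coord_section e \<in> carrier G" if "e \<in> E" for e
    using coord_section(1) lower_central_carrier E(1) that by blast
  have eq: "e = e'" if "e \<in> E" "e' \<in> E" "twisted_cong (Suc k) (coord_section e) (coord_section e')" for e e'
    using twisted_cong_pair_eq[OF E(1,3) assms(2) one that(1,2) singletonI singletonI] that sec by simp
  have "inj_on coord_section E"
    by (rule inj_onI) (metis coord_section(2) E(1) subsetD)
  then have "infinite (coord_section ` E)" using E(2) finite_imageD by blast
  moreover have "twisted_separated (Suc k) (coord_section ` E)"
    using eq sec by (auto simp: twisted_separated_def)
  ultimately show ?thesis by blast
qed

end

lemma twisted_transversal:
  assumes "\<And>k. 1 \<le> k \<Longrightarrow> k \<le> c \<Longrightarrow> lc_coordinates k (m k) (\<kappa> k) (L k)"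
    and "\<And>k. 1 \<le> k \<Longrightarrow> k \<le> c \<Longrightarrow> det (1\<^sub>m (m k) - L k) \<noteq> 0"
  shows "twisted_rigid (Suc c)"
    and "\<exists>S. twisted_separated (Suc c) S \<and> twisted_covering (Suc c) S \<and> finite S \<and>
      card S = (\<Prod>k=1..c. nat \<bar>det (1\<^sub>m (m k) - L k)\<bar>)"
proof -
  have "twisted_rigid (Suc c) \<and> (\<exists>S. twisted_separated (Suc c) S \<and> twisted_covering (Suc c) S \<and> finite S \<and>
      card S = (\<Prod>k=1..c. nat \<bar>det (1\<^sub>m (m k) - L k)\<bar>))"
    using assms
  proof (induction c)
    case 0
    \<comment> \<open>Term 1 of the series is the whole group, so at this level there is one class,
      and rigidity holds trivially.\<close>
    have "twisted_covering (Suc 0) {\<one>}"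
      by (auto simp: twisted_covering_def twisted_cong_def lc_cong_def)
    then show ?case
      by (auto simp: twisted_rigid_def twisted_separated_def intro!: exI[of _ "{\<one>}"])
  next
    case (Suc c)
    then obtain S where S: "twisted_rigid (Suc c)" "twisted_separated (Suc c) S" "twisted_covering (Suc c) S"
      "finite S" "card S = (\<Prod>k=1..c. nat \<bar>det (1\<^sub>m (m k) - L k)\<bar>)" by auto
    have co: "lc_coordinates (Suc c) (m (Suc c)) (\<kappa> (Suc c)) (L (Suc c))"
      and nz: "det (1\<^sub>m (m (Suc c)) - L (Suc c)) \<noteq> 0" using Suc.prems by auto
    show ?case
      using twisted_rigid_Suc[OF co S(1) nz] twisted_transversal_Suc[OF co nz S(1-4)] S(5)
      by (simp add: prod.nat_ivl_Suc')
  qed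
  then show "twisted_rigid (Suc c)"
    and "\<exists>S. twisted_separated (Suc c) S \<and> twisted_covering (Suc c) S \<and> finite S \<and>
      card S = (\<Prod>k=1..c. nat \<bar>det (1\<^sub>m (m k) - L k)\<bar>)" by blast+
qed

text \<open>Rigidity holds up to the least index with zero determinant. The infinitely many classes
  found there stay distinct in the finer quotient by term \<open>c + 1\<close>.\<close>

lemma infinite_twisted_separated:
  assumes "\<And>k. 1 \<le> k \<Longrightarrow> k \<le> c \<Longrightarrow> lc_coordinates k (m k) (\<kappa> k) (L k)"
    and ex: "\<exists>k. 1 \<le> k \<and> k \<le> c \<and> det (1\<^sub>m (m k) - L k) = 0"
  shows "\<exists>S. twisted_separated (Suc c) S \<and> infinite S"
proof -
  define k where "k = (LEAST k. 1 \<le> k \<and> k \<le> c \<and> det (1\<^sub>m (m k) - L k) = 0)"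
  have k: "1 \<le> k" "k \<le> c" "det (1\<^sub>m (m k) - L k) = 0" using LeastI_ex[OF ex, folded k_def] by blast+
  have min: "det (1\<^sub>m (m j) - L j) \<noteq> 0" if "1 \<le> j" "j < k" for j
  proof -
    have "\<not> (1 \<le> j \<and> j \<le> c \<and> det (1\<^sub>m (m j) - L j) = 0)"
      using that(2) unfolding k_def by (rule not_less_Least)
    then show ?thesis using that k by auto
  qed
  obtain k' where k': "k = Suc k'" using k by (cases k) auto
  have "twisted_rigid (Suc k')"
    by (rule twisted_transversal(1)[of k' m \<kappa> L]) (use assms(1) min k k' in auto)
  then obtain S where "twisted_separated (Suc k) S" "infinite S"
    using infinite_twisted_separated_Suc[OF assms(1)[OF k(1,2)] k(3)] k' by auto
  moreover have "twisted_cong (Suc k) s t" if "twisted_cong (Suc c) s t" for s t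
    by (rule twisted_cong_mono[OF _ that]) (use k in simp)
  ultimately show ?thesis unfolding twisted_separated_def by meson
qed

end

section \<open>Commutators of Lyndon words\<close>

text \<open>The bracketing of a Lyndon word along its standard factorization. The last branch is
  meant for single letters; its value on the empty word is arbitrary.\<close>

function lyndon_comm :: "('a, 'b) monoid_scheme \<Rightarrow> (nat \<Rightarrow> 'a) \<Rightarrow> nat list \<Rightarrow> 'a" where
  "lyndon_comm G f w =
    (if 2 \<le> length w
     then group_comm G (lyndon_comm G f (min_suffix_rest w)) (lyndon_comm G f (min_suffix w))
     else f (hd w))"
  by auto
termination
proof (relation "measure (\<lambda>(G, f, w). length w)", goal_cases)
  case (2 G f w)
  then have "length w = length (min_suffix_rest w) + length (min_suffix w)"
    using min_suffix_props(1)[of w] by (metis length_append)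
  then show ?case using min_suffix_props(3)[OF 2] by simp
next
  case (3 G f w)
  then have "length w = length (min_suffix_rest w) + length (min_suffix w)"
    using min_suffix_props(1)[of w] by (metis length_append)
  then show ?case using min_suffix_props(2)[OF 3] by simp
qed simp

declare lyndon_comm.simps [simp del]

lemma lyndon_comm_single: "lyndon_comm G f [i] = f i"
  by (simp add: lyndon_comm.simps)

lemma lyndon_comm_append:
  assumes "lyndon u" "lyndon v" "length u = 1 \<or> min_suffix u \<ge> v"
  shows "lyndon_comm G f (u @ v) = group_comm G (lyndon_comm G f u) (lyndon_comm G f v)"
proof -
  have "length (u @ v) \<ge> 2" using assms(1,2)[THEN lyndon_nonempty] by (cases u; cases v) auto
  then show ?thesis
    using min_suffix_append[OF assms] by (subst lyndon_comm.simps) simp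
qed

text \<open>Induction along standard factorizations. The case \<open>append\<close> supplies the
  condition under which \<open>min_suffix_append\<close> recovers \<open>u\<close> and
  \<open>v\<close> from \<open>u @ v\<close>, so that \<open>lyndon_comm_append\<close>
  applies.\<close>

lemma lyndon_word_induct [consumes 1, case_names single append]:
  assumes "lyndon w"
    and "\<And>i. P [i]"
    and "\<And>u v. lyndon u \<Longrightarrow> lyndon v \<Longrightarrow> u < v \<Longrightarrow> lyndon (u @ v) \<Longrightarrow>
           length u = 1 \<or> min_suffix u \<ge> v \<Longrightarrow> P u \<Longrightarrow> P v \<Longrightarrow> P (u @ v)"
  shows "P w"
  using assms(1)
proof (induction w rule: length_induct)
  case (1 w)
  show ?case
  proof (cases "length w \<ge> 2")
    case False
    then obtain i where "w = [i]" using lyndon_nonempty[OF 1(2)] by (cases w; cases "tl w") auto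
    then show ?thesis using assms(2) by simp
  next
    case True
    let ?u = "min_suffix_rest w" and ?v = "min_suffix w"
    note props = min_suffix_props[OF True]
    have len: "length w = length ?u + length ?v" using props(1) by (metis length_append)
    have u: "lyndon ?u" and v: "lyndon ?v" and uv: "?u < ?v"
      using lyndon_min_suffix lyndon_min_suffix_rest min_suffix_rest_less True 1(2) by auto
    have std: "length ?u = 1 \<or> min_suffix ?u \<ge> ?v"
    proof (cases "length ?u = 1")
      case False
      then have lu: "length ?u \<ge> 2" using props(2) by (cases ?u; cases "tl ?u") auto
      let ?u1 = "min_suffix_rest ?u" and ?u2 = "min_suffix ?u"
      have u12: "?u = ?u1 @ ?u2" "?u1 \<noteq> []" "?u2 \<noteq> []" using min_suffix_props[OF lu] by auto
      \<comment> \<open>Otherwise \<open>?u2 @ ?v\<close> would be a proper suffix of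
        \<open>w\<close> smaller than the minimal one.\<close>
      have "?v \<le> ?u2"
      proof (rule ccontr)
        assume "\<not> ?v \<le> ?u2"
        then have "?u2 < ?v" by simp
        then have "?u2 @ ?v < ?v" using lyndon_append_less v u12 by blast
        moreover have "?v \<le> ?u2 @ ?v"
          by (rule props(4)[of ?u1]) (use props(1) u12 in \<open>simp_all add: append_assoc[symmetric] del: append_assoc\<close>)
        ultimately show False by simp
      qed
      then show ?thesis by simp
    qed simp
    have Pu: "P ?u" using 1(1) len props(3) u by simp
    have Pv: "P ?v" using 1(1) len props(2) v by simp
    have "lyndon (?u @ ?v)" using 1(2) props(1) by simp
    then have "P (?u @ ?v)" using assms(3) u v uv std Pu Pv by blast
    then show ?thesis using props(1) by simp
  qed
qed

text \<open>Generation of the lower central terms by Lyndon commutators holds in any group with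
  \<open>r\<close> generators. Freeness enters later, for independence.\<close>

locale generated_group = group +
  fixes r :: nat and f :: "nat \<Rightarrow> 'a"
  assumes gen_closed: "i < r \<Longrightarrow> f i \<in> carrier G"
    and carrier_gen: "carrier G \<subseteq> generate G (f ` {..<r})"
begin

abbreviation (input) "LY \<equiv> lyndon_comm G f"

definition lyndon_words :: "nat \<Rightarrow> nat list set" where
  "lyndon_words n = {w. lyndon w \<and> set w \<subseteq> {..<r} \<and> length w = n}"

text \<open>Including the next term of the series makes this a span modulo that term. The predicate
  \<open>P\<close> carries the bound on the words that the rewriting induction needs.\<close>

definition lyndon_span :: "nat \<Rightarrow> (nat list \<Rightarrow> bool) \<Rightarrow> 'a set" where
  "lyndon_span n P = generate G (LC (Suc n) \<union> {LY w |w. w \<in> lyndon_words n \<and> P w})"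

lemma lyndon_comm_mem:
  assumes "lyndon w" "set w \<subseteq> {..<r}"
  shows "LY w \<in> LC (length w)"
  using assms
proof (induction rule: lyndon_word_induct)
  case (single i)
  then show ?case by (simp add: lyndon_comm_single gen_closed)
next
  case (append u v)
  then show ?case
    using comm_lower_central[of "length u" "length v"] lyndon_nonempty[of u] lyndon_nonempty[of v]
    by (simp add: lyndon_comm_append Suc_le_eq)
qed

lemma lyndon_words_mem: "w \<in> lyndon_words n \<Longrightarrow> LY w \<in> LC n"
  using lyndon_comm_mem by (auto simp: lyndon_words_def)

lemma between_lyndon_span: "between_lc n (lyndon_span n P)"
proof -
  let ?S = "LC (Suc n) \<union> {LY w |w. w \<in> lyndon_words n \<and> P w}"
  have S: "?S \<subseteq> LC n" using lower_central_Suc_subset[of n] lyndon_words_mem by auto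
  then have "?S \<subseteq> carrier G" using lower_central_carrier by blast
  then have "subgroup (generate G ?S) G" by (rule generate_is_subgroup)
  moreover have "generate G ?S \<subseteq> LC n"
    using generate_subgroup_incl[OF S subgroup_lower_central] .
  moreover have "LC (Suc n) \<subseteq> generate G ?S" by (auto intro: generate.incl)
  ultimately show ?thesis by (simp add: between_lc_def lyndon_span_def)
qed

lemma lyndon_span_mono:
  assumes "\<And>w. P w \<Longrightarrow> Q w"
  shows "lyndon_span n P \<subseteq> lyndon_span n Q"
  unfolding lyndon_span_def by (rule mono_generate) (use assms in blast)

lemma lyndon_span_incl: "w \<in> lyndon_words n \<Longrightarrow> P w \<Longrightarrow> LY w \<in> lyndon_span n P"
  unfolding lyndon_span_def by (rule generate.incl) blast

text \<open>By \<open>subgroup_comm_left\<close> only generators matter, and those from term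
  \<open>i + 1\<close> have commutators with \<open>b\<close> in term \<open>i + j + 1\<close>,
  which is contained in \<open>H\<close>.\<close>

lemma comm_lyndon_span_left:
  assumes H: "between_lc (i + j) H" and "i \<ge> 1" "j \<ge> 1" and b: "b \<in> LC j"
    and gens: "\<And>w. w \<in> lyndon_words i \<Longrightarrow> P w \<Longrightarrow> cm (LY w) b \<in> H"
    and a: "a \<in> lyndon_span i P"
  shows "cm a b \<in> H"
proof -
  have "LC (Suc i) \<union> {LY w |w. w \<in> lyndon_words i \<and> P w} \<subseteq> {a \<in> carrier G. cm a b \<in> H}"
  proof
    fix x assume x: "x \<in> LC (Suc i) \<union> {LY w |w. w \<in> lyndon_words i \<and> P w}"
    then have "x \<in> carrier G" using lyndon_words_mem lower_central_carrier by blast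
    moreover have "cm x b \<in> H" if "x \<in> LC (Suc i)"
      using comm_lower_central[of "Suc i" j x b] that H assms(3) b by (auto simp: between_lc_def)
    ultimately show "x \<in> {a \<in> carrier G. cm a b \<in> H}" using x gens by blast
  qed
  then have "lyndon_span i P \<subseteq> {a \<in> carrier G. cm a b \<in> H}"
    unfolding lyndon_span_def
    by (rule generate_subgroup_incl) (rule subgroup_comm_left[OF H lower_central_carrier[OF b]])
  then show ?thesis using a by blast
qed

lemma finite_words: "finite {x. set x \<subseteq> {..<r} \<and> length x \<le> n}"
  by (rule finite_lists_length_le) simp

text \<open>The rewriting is well-founded because the Jacobi identity either shortens the total length
  or replaces the larger of the two words by a smaller one.\<close>

lemma comm_lyndon:
  assumes "lyndon u" "lyndon v" "set u \<subseteq> {..<r}" "set v \<subseteq> {..<r}" "u < v"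
  shows "cm (LY u) (LY v) \<in> lyndon_span (length u + length v) (\<lambda>w. w < v)"
proof -
  \<comment> \<open>The lexicographic order has infinite descending chains, such as
    \<open>[1]\<close>, \<open>[0, 1]\<close>, \<open>[0, 0, 1]\<close>. Counting the smaller words
    of bounded length over the finite alphabet gives a natural number that decreases.\<close>
  define rank where "rank n v = card {x. (set x \<subseteq> {..<r} \<and> length x \<le> n) \<and> x < v}" for n and v :: "nat list"
  have rank: "rank n x < rank n y" if "x < y" "set x \<subseteq> {..<r}" "length x \<le> n" for x y n
    unfolding rank_def
  proof (rule psubset_card_mono)
    show "finite {x. (set x \<subseteq> {..<r} \<and> length x \<le> n) \<and> x < y}"
      by (rule finite_subset[OF _ finite_words[of n]]) blast
  qed (use that in auto)
  show ?thesis
    using assms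
  proof (induction "(u, v)" arbitrary: u v
      rule: wf_induct_rule[OF wf_measures[of "[\<lambda>(u, v). length u + length v, \<lambda>(u, v). rank (length u + length v) v]"]])
    case (1 u v)
    let ?n = "length u + length v"
    let ?H = "lyndon_span ?n (\<lambda>w. w < v)"
    note u = 1(2) and v = 1(3) and ur = 1(4) and vr = 1(5) and uv = 1(6)
    have H: "between_lc ?n ?H" by (rule between_lyndon_span)
    then have Hs: "subgroup ?H G" by (simp add: between_lc_def)
    have IH: "cm (LY x) (LY y) \<in> lyndon_span (length x + length y) (\<lambda>w. w < y)"
      if "lyndon x" "lyndon y" "set x \<subseteq> {..<r}" "set y \<subseteq> {..<r}" "x < y"
        "length x + length y < ?n \<or> length x + length y = ?n \<and> y < v" for x y
      using 1(1)[OF _ that(1-5)] that(4,6) rank[of y v ?n] by auto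
    have IH_le: "cm (LY x) (LY y) \<in> ?H"
      if xy: "lyndon x" "lyndon y" "set x \<subseteq> {..<r}" "set y \<subseteq> {..<r}" "x < v" "y < v"
        "length x + length y = ?n" for x y
    proof -
      have less: "cm (LY x) (LY y) \<in> ?H"
        if "lyndon x" "lyndon y" "set x \<subseteq> {..<r}" "set y \<subseteq> {..<r}" "x < y" "y < v"
          "length x + length y = ?n" for x y
        using IH[of x y] that lyndon_span_mono[of "\<lambda>w. w < y" "\<lambda>w. w < v" ?n] by fastforce
      have car: "LY x \<in> carrier G" "LY y \<in> carrier G"
        using xy lyndon_comm_mem lower_central_carrier by blast+
      consider "x < y" | "y < x" | "x = y" by fastforce
      then show ?thesis
      proof cases
        case 1
        then show ?thesis using less xy by blast
      next
        case 2
        then have "cm (LY y) (LY x) \<in> ?H" using less[of y x] xy by (simp add: add.commute)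
        then show ?thesis using comm_sym_mem[OF Hs] car by blast
      next
        case 3
        then show ?thesis using comm_self car subgroup.one_closed[OF Hs] by simp
      qed
    qed
    show ?case
    proof (cases "length u = 1 \<or> v \<le> min_suffix u")
      case True
      \<comment> \<open>Here \<open>u\<close>, \<open>v\<close> is a standard factorization, so the
        commutator is itself the Lyndon commutator of \<open>u @ v\<close>.\<close>
      have "u @ v \<in> lyndon_words ?n" "u @ v < v"
        using lyndon_append[OF u v uv] lyndon_append_less[OF v uv] lyndon_nonempty[OF u] ur vr
        by (auto simp: lyndon_words_def)
      then have "LY (u @ v) \<in> ?H" by (rule lyndon_span_incl)
      then show ?thesis unfolding lyndon_comm_append[OF u v True] .
    next
      case False
      let ?u1 = "min_suffix_rest u" and ?u2 = "min_suffix u"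
      have lu: "length u \<ge> 2" using False lyndon_nonempty[OF u] by (cases u; cases "tl u") auto
      note props = min_suffix_props[OF lu]
      have len: "length u = length ?u1 + length ?u2" using props(1) by (metis length_append)
      have "set u = set ?u1 \<union> set ?u2" using props(1) by (metis set_append)
      then have sr: "set ?u1 \<subseteq> {..<r}" "set ?u2 \<subseteq> {..<r}" using ur by auto
      have ly: "lyndon ?u1" "lyndon ?u2" "?u1 < ?u2"
        using lyndon_min_suffix lyndon_min_suffix_rest min_suffix_rest_less lu u by auto
      have u2v: "?u2 < v" using False by auto
      then have u1v: "?u1 < v" using ly by auto
      have pos: "length ?u1 \<ge> 1" "length ?u2 \<ge> 1" "length v \<ge> 1"
        using props lyndon_nonempty[OF v] by (simp_all add: Suc_le_eq)
      let ?a = "LY ?u1" and ?b = "LY ?u2" and ?c = "LY v"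
      have mem: "?a \<in> LC (length ?u1)" "?b \<in> LC (length ?u2)" "?c \<in> LC (length v)"
        using lyndon_comm_mem ly sr v vr by auto
      have ac: "cm ?a ?c \<in> lyndon_span (length ?u1 + length v) (\<lambda>w. w < v)"
        using IH[of ?u1 v] ly sr v vr u1v len pos props(2,3) by auto
      have bc: "cm ?b ?c \<in> lyndon_span (length ?u2 + length v) (\<lambda>w. w < v)"
        using IH[of ?u2 v] ly sr v vr u2v len pos props(2,3) by auto
      \<comment> \<open>The inner commutator is shorter, so it expands into words below
        \<open>v\<close>; each of them is then bracketed with \<open>?u2\<close>, also below
        \<open>v\<close>, which is the situation of \<open>IH_le\<close>.\<close>
      have 1: "cm (cm ?a ?c) ?b \<in> ?H"
      proof (rule comm_lyndon_span_left[OF _ _ pos(2) mem(2) _ ac])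
        show "between_lc (length ?u1 + length v + length ?u2) ?H" using H len by (simp add: ac_simps)
        fix w assume "w \<in> lyndon_words (length ?u1 + length v)" "w < v"
        then show "cm (LY w) ?b \<in> ?H"
          using IH_le[of w ?u2] ly sr u2v len by (auto simp: lyndon_words_def)
      qed (use pos in simp)
      have "cm (cm ?b ?c) ?a \<in> ?H"
      proof (rule comm_lyndon_span_left[OF _ _ pos(1) mem(1) _ bc])
        show "between_lc (length ?u2 + length v + length ?u1) ?H" using H len by (simp add: ac_simps)
        fix w assume "w \<in> lyndon_words (length ?u2 + length v)" "w < v"
        then show "cm (LY w) ?a \<in> ?H"
          using IH_le[of w ?u1] ly sr u1v len by (auto simp: lyndon_words_def)
      qed (use pos in simp)
      then have 2: "cm ?a (cm ?b ?c) \<in> ?H"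
        using comm_sym_mem[OF Hs] mem lower_central_carrier by blast
      have "cm (cm ?a ?b) ?c \<in> ?H"
        by (rule jacobi_mod[OF H pos _ mem 1 2]) (simp add: len)
      moreover have "LY u = cm ?a ?b" using lu by (subst lyndon_comm.simps) simp
      ultimately show ?thesis by simp
    qed
  qed
qed

lemma comm_lyndon_words:
  assumes "u \<in> lyndon_words i" "v \<in> lyndon_words j"
  shows "cm (LY u) (LY v) \<in> lyndon_span (i + j) (\<lambda>_. True)"
proof -
  let ?H = "lyndon_span (i + j) (\<lambda>_. True)"
  have less: "cm (LY u) (LY v) \<in> lyndon_span (i + j) (\<lambda>_. True)"
    if "u \<in> lyndon_words i" "v \<in> lyndon_words j" "u < v" for u v i j
    using comm_lyndon[of u v] that lyndon_span_mono[of "\<lambda>w. w < v" "\<lambda>_. True" "i + j"]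
    by (auto simp: lyndon_words_def)
  have Hs: "subgroup ?H G" using between_lyndon_span by (simp add: between_lc_def)
  have car: "LY u \<in> carrier G" "LY v \<in> carrier G"
    using assms lyndon_words_mem lower_central_carrier by blast+
  consider "u < v" | "v < u" | "u = v" by fastforce
  then show ?thesis
  proof cases
    case 1
    then show ?thesis using less assms by blast
  next
    case 2
    then have "cm (LY v) (LY u) \<in> ?H" using less[of v j u i] assms by (simp add: add.commute)
    then show ?thesis using comm_sym_mem[OF Hs] car by blast
  next
    case 3
    then show ?thesis using comm_self car subgroup.one_closed[OF Hs] by simp
  qed
qed

text \<open>A generating commutator is linear in both arguments modulo the next term, so both may be
  taken to be Lyndon commutators, where \<open>comm_lyndon_words\<close> applies.\<close>

lemma lower_central_eq_lyndon_span:
  assumes "n \<ge> 1"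
  shows "LC n = lyndon_span n (\<lambda>_. True)"
proof
  show "lyndon_span n (\<lambda>_. True) \<subseteq> LC n" using between_lyndon_span by (simp add: between_lc_def)
  have "f i \<in> lyndon_span 1 (\<lambda>_. True)" if "i < r" for i
    using lyndon_span_incl[of "[i]" 1] that
    by (simp add: lyndon_words_def lyndon_single lyndon_comm_single)
  then have "generate G (f ` {..<r}) \<subseteq> lyndon_span 1 (\<lambda>_. True)"
    using between_lyndon_span[of 1] by (intro generate_subgroup_incl) (auto simp: between_lc_def)
  then have gens: "carrier G \<subseteq> lyndon_span 1 (\<lambda>_. True)" using carrier_gen by simp
  show "LC n \<subseteq> lyndon_span n (\<lambda>_. True)"
    using assms
  proof (induction n rule: dec_induct)
    case base
    then show ?case using gens by simp
  next
    case (step n)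
    let ?H = "lyndon_span (Suc n) (\<lambda>_. True)"
    have H: "between_lc (Suc n) ?H" by (rule between_lyndon_span)
    interpret H: subgroup ?H G using H by (simp add: between_lc_def)
    show ?case
    proof
      fix g assume "g \<in> LC (Suc n)"
      then show "g \<in> ?H"
        using step(1)
      proof (induction rule: lower_central_Suc_induct)
        case (incl x y)
        have x: "x \<in> lyndon_span n (\<lambda>_. True)" and y: "y \<in> lyndon_span 1 (\<lambda>_. True)"
          using incl step gens by auto
        show ?case
        proof (rule comm_lyndon_span_left[where j = 1, OF _ step(1) _ _ _ x])
          fix w assume w: "w \<in> lyndon_words n"
          have "cm y (LY w) \<in> ?H"
          proof (rule comm_lyndon_span_left[OF _ _ step(1) lyndon_words_mem[OF w] _ y])
            fix v assume "v \<in> lyndon_words 1"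
            from comm_lyndon_words[OF this w] show "cm (LY v) (LY w) \<in> ?H" by simp
          qed (use H in simp_all)
          then show "cm (LY w) y \<in> ?H"
            using comm_sym_mem[OF H.is_subgroup _ _] incl lyndon_words_mem[OF w] lower_central_carrier by blast
        qed (use H incl in simp_all)
      qed auto
    qed
  qed
qed

end

section \<open>Characteristic polynomials and Reidemeister numbers\<close>

lemma equiv_twisted_conj:
  assumes "group G" "\<phi> \<in> hom G G"
  shows "equiv (carrier G) (twisted_conj G \<phi>)"
proof -
  interpret group_hom G G \<phi> using assms by (auto simp: group_hom_def group_hom_axioms_def)
  show ?thesis
  proof (rule equivI)
    show "twisted_conj G \<phi> \<subseteq> carrier G \<times> carrier G" by (auto simp: twisted_conj_def)
    show "refl_on (carrier G) (twisted_conj G \<phi>)"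
      by (auto simp: refl_on_def twisted_conj_def intro!: bexI[of _ "\<one>\<^bsub>G\<^esub>"])
    show "sym (twisted_conj G \<phi>)"
    proof (rule symI)
      fix x y assume "(x, y) \<in> twisted_conj G \<phi>"
      then obtain z where z: "x \<in> carrier G" "y \<in> carrier G" "z \<in> carrier G"
        "x = z \<otimes>\<^bsub>G\<^esub> y \<otimes>\<^bsub>G\<^esub> inv\<^bsub>G\<^esub> (\<phi> z)" by (auto simp: twisted_conj_def)
      have "y = inv\<^bsub>G\<^esub> z \<otimes>\<^bsub>G\<^esub> x \<otimes>\<^bsub>G\<^esub> inv\<^bsub>G\<^esub> (\<phi> (inv\<^bsub>G\<^esub> z))"
        unfolding z(4) using z(1-3) by (simp add: G.m_assoc G.inv_mult_cancel)
      then show "(y, x) \<in> twisted_conj G \<phi>"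
        using z by (auto simp: twisted_conj_def intro!: bexI[of _ "inv\<^bsub>G\<^esub> z"])
    qed
    show "trans (twisted_conj G \<phi>)"
    proof (rule transI)
      fix x y w assume "(x, y) \<in> twisted_conj G \<phi>" "(y, w) \<in> twisted_conj G \<phi>"
      then obtain z z' where z: "x \<in> carrier G" "y \<in> carrier G" "w \<in> carrier G" "z \<in> carrier G" "z' \<in> carrier G"
        "x = z \<otimes>\<^bsub>G\<^esub> y \<otimes>\<^bsub>G\<^esub> inv\<^bsub>G\<^esub> (\<phi> z)" "y = z' \<otimes>\<^bsub>G\<^esub> w \<otimes>\<^bsub>G\<^esub> inv\<^bsub>G\<^esub> (\<phi> z')"
        by (auto simp: twisted_conj_def)
      have "x = (z \<otimes>\<^bsub>G\<^esub> z') \<otimes>\<^bsub>G\<^esub> w \<otimes>\<^bsub>G\<^esub> inv\<^bsub>G\<^esub> (\<phi> (z \<otimes>\<^bsub>G\<^esub> z'))"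
        unfolding z(6,7) using z(3-5) by (simp add: G.m_assoc G.inv_mult_group)
      then show "(x, w) \<in> twisted_conj G \<phi>"
        using z(1,3-5) unfolding twisted_conj_def by blast
    qed
  qed
qed

text \<open>The index set \<open>S\<close> and the map \<open>f\<close> are kept apart because
  \<open>S\<close> will consist of elements of the free group while the classes are counted in a
  quotient.\<close>

lemma reidemeister_number_transversal:
  assumes "group G" "\<phi> \<in> hom G G" and f: "\<And>s. s \<in> S \<Longrightarrow> f s \<in> carrier G"
    and sep: "\<And>s t. s \<in> S \<Longrightarrow> t \<in> S \<Longrightarrow> (f s, f t) \<in> twisted_conj G \<phi> \<Longrightarrow> s = t"
  shows "infinite S \<Longrightarrow> reidemeister_number G \<phi> = \<infinity>"
    and "finite S \<Longrightarrow> (\<And>x. x \<in> carrier G \<Longrightarrow> \<exists>s\<in>S. (x, f s) \<in> twisted_conj G \<phi>) \<Longrightarrow>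
      reidemeister_number G \<phi> = enat (card S)"
proof -
  let ?R = "twisted_conj G \<phi>" and ?q = "\<lambda>s. twisted_conj G \<phi> `` {f s}"
  have eq: "equiv (carrier G) ?R" using equiv_twisted_conj assms by blast
  have inj: "inj_on ?q S"
    by (rule inj_onI) (use eq_equiv_class[OF _ eq] f sep in blast)
  have sub: "?q ` S \<subseteq> carrier G // ?R" using f by (auto intro: quotientI)
  show "reidemeister_number G \<phi> = \<infinity>" if "infinite S"
  proof -
    have "infinite (carrier G // ?R)"
      using that inj sub finite_imageD finite_subset by blast
    then show ?thesis by (simp add: reidemeister_number_def)
  qed
  show "reidemeister_number G \<phi> = enat (card S)"
    if "finite S" and cov: "\<And>x. x \<in> carrier G \<Longrightarrow> \<exists>s\<in>S. (x, f s) \<in> ?R"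
  proof -
    have "carrier G // ?R \<subseteq> ?q ` S"
    proof
      fix X assume "X \<in> carrier G // ?R"
      then obtain x where x: "x \<in> carrier G" "X = ?R `` {x}" by (auto elim: quotientE)
      then obtain s where "s \<in> S" "(x, f s) \<in> ?R" using cov by blast
      then show "X \<in> ?q ` S" using equiv_class_eq[OF eq] x by blast
    qed
    then have "carrier G // ?R = ?q ` S" using sub by blast
    then show ?thesis using that(1) inj by (simp add: reidemeister_number_def card_image)
  qed
qed

lemma (in group) r_coset_eq_iff:
  assumes "subgroup H G" "x \<in> carrier G" "y \<in> carrier G"
  shows "H #> x = H #> y \<longleftrightarrow> x \<otimes> inv y \<in> H"
proof
  assume "H #> x = H #> y"
  then have "x \<in> H #> y" using rcos_self assms by blast
  then obtain h where "h \<in> H" "x = h \<otimes> y" by (auto simp: r_coset_def)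
  then show "x \<otimes> inv y \<in> H" using assms subgroup.mem_carrier[OF assms(1)] by (simp add: m_assoc)
next
  assume h: "x \<otimes> inv y \<in> H"
  then have "x \<in> H #> y"
    using assms by (auto simp: r_coset_def m_assoc intro!: bexI[of _ "x \<otimes> inv y"])
  then show "H #> x = H #> y" using repr_independence assms by metis
qed

lemma lower_central_surj_image:
  assumes "group_hom G H h" "h ` carrier G = carrier H"
  shows "lower_central H i = h ` lower_central G i"
proof -
  interpret group_hom G H h by fact
  show ?thesis
  proof (induction i rule: nat_less_induct)
    case (1 i)
    consider "i = 0" | "i = 1" | j where "i = Suc (Suc j)" by (metis One_nat_def not0_implies_Suc)
    then show ?case
    proof cases
      case (3 j)
      then have IH: "lower_central H (Suc j) = h ` lower_central G (Suc j)" using 1 by simp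
      let ?K = "{group_comm G x y |x y. x \<in> lower_central G (Suc j) \<and> y \<in> carrier G}"
      have "{group_comm H x y |x y. x \<in> lower_central H (Suc j) \<and> y \<in> carrier H} = h ` ?K"
      proof -
        have *: "h (group_comm G x y) = group_comm H (h x) (h y)"
          if "x \<in> lower_central G (Suc j)" "y \<in> carrier G" for x y
          using that G.lower_central_carrier by (simp add: group_comm_def)
        show ?thesis
          unfolding IH assms(2)[symmetric] using * by (auto simp: image_iff) (metis *)+
      qed
      moreover have "?K \<subseteq> carrier G" using G.lower_central_carrier by auto
      ultimately show ?thesis
        unfolding 3 lower_central.simps commutator_subgroup_def group_comm_def[symmetric]
        using generate_img by simp
    qed (use assms(2) in auto)
  qed
qed

section \<open>Integer bases of abelian groups and change of basis\<close>

context comm_group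
begin

definition int_comb :: "(nat \<Rightarrow> 'a) \<Rightarrow> nat \<Rightarrow> (nat \<Rightarrow> int) \<Rightarrow> 'a" where
  "int_comb b n k = finprod G (\<lambda>i. b i [^] k i) {..<n}"

lemma int_comb_closed: "b \<in> {..<n} \<rightarrow> carrier G \<Longrightarrow> int_comb b n k \<in> carrier G"
  unfolding int_comb_def by (rule finprod_closed) auto

lemma int_comb_cong: "b \<in> {..<n} \<rightarrow> carrier G \<Longrightarrow> (\<And>i. i < n \<Longrightarrow> k i = l i) \<Longrightarrow> int_comb b n k = int_comb b n l"
  unfolding int_comb_def by (intro finprod_cong') auto

lemma int_comb_add:
  assumes "b \<in> {..<n} \<rightarrow> carrier G"
  shows "int_comb b n (\<lambda>i. k i + l i) = int_comb b n k \<otimes> int_comb b n l"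
proof -
  have "int_comb b n (\<lambda>i. k i + l i) = finprod G (\<lambda>i. b i [^] k i \<otimes> b i [^] l i) {..<n}"
    unfolding int_comb_def using assms by (intro finprod_cong') (auto simp: int_pow_mult Pi_iff)
  also have "\<dots> = int_comb b n k \<otimes> int_comb b n l"
    unfolding int_comb_def using assms by (intro finprod_multf) auto
  finally show ?thesis .
qed

lemma finprod_int_pow:
  assumes "f \<in> {..<n::nat} \<rightarrow> carrier G"
  shows "finprod G f {..<n} [^] (c::int) = finprod G (\<lambda>i. f i [^] c) {..<n}"
  using assms
proof (induction n)
  case (Suc n)
  then have f: "f \<in> {..<n} \<rightarrow> carrier G" "f n \<in> carrier G" by auto
  then have "finprod G f {..<n} \<in> carrier G" "(\<lambda>i. f i [^] c) \<in> {..<n} \<rightarrow> carrier G" by auto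
  then show ?case
    using Suc.IH[OF f(1)] f by (simp add: lessThan_Suc int_pow_mult_distrib m_comm)
qed simp

lemma int_comb_pow:
  assumes "b \<in> {..<n} \<rightarrow> carrier G"
  shows "int_comb b n k [^] (c::int) = int_comb b n (\<lambda>i. k i * c)"
  unfolding int_comb_def using assms
  by (subst finprod_int_pow) (auto simp: int_pow_pow Pi_iff intro!: finprod_cong')

lemma int_comb_int_comb:
  assumes "b \<in> {..<n} \<rightarrow> carrier G"
  shows "int_comb (\<lambda>j. int_comb b n (K j)) m c = int_comb b n (\<lambda>i. \<Sum>j<m. K j i * c j)"
proof (induction m)
  case 0
  then show ?case using assms by (auto simp: int_comb_def intro!: finprod_one_eqI[symmetric])
next
  case (Suc m)
  have cl: "(\<lambda>j. int_comb b n (K j) [^] c j) \<in> {..<m} \<rightarrow> carrier G"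
    using int_comb_closed[OF assms] by auto
  have "int_comb (\<lambda>j. int_comb b n (K j)) (Suc m) c =
      int_comb b n (K m) [^] c m \<otimes> int_comb (\<lambda>j. int_comb b n (K j)) m c"
    using cl int_comb_closed[OF assms] by (simp add: int_comb_def[of "\<lambda>j. int_comb b n (K j)"] lessThan_Suc)
  also have "\<dots> = int_comb b n (\<lambda>i. K m i * c m + (\<Sum>j<m. K j i * c j))"
    unfolding Suc int_comb_pow[OF assms] int_comb_add[OF assms] ..
  finally show ?case by (simp add: add.commute)
qed

lemma Z_basis_closed: "Z_basis G n b \<Longrightarrow> b \<in> {..<n} \<rightarrow> carrier G"
  by (simp add: Z_basis_def)

lemma Z_basis_unique:
  assumes "Z_basis G n b" "int_comb b n k = int_comb b n l" "i < n"
  shows "k i = l i"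
proof -
  note b = Z_basis_closed[OF assms(1)]
  have ex1: "\<exists>!k. k \<in> extensional {..<n} \<and> int_comb b n l = int_comb b n k"
    using assms(1) int_comb_closed[OF b] unfolding Z_basis_def int_comb_def by blast
  have "int_comb b n l = int_comb b n (restrict k {..<n})" "int_comb b n l = int_comb b n (restrict l {..<n})"
    using assms(2) int_comb_cong[OF b, of k "restrict k {..<n}"] int_comb_cong[OF b, of l "restrict l {..<n}"] by auto
  then have "restrict k {..<n} = restrict l {..<n}"
    using ex1 restrict_extensional by blast
  then show ?thesis using assms(3) by (metis lessThan_iff restrict_apply')
qed

lemma Z_basis_change:
  assumes b: "Z_basis G n b" and b': "b' \<in> {..<n} \<rightarrow> carrier G"
  shows "\<exists>P\<in>carrier_mat n n. \<forall>j<n. b' j = int_comb b n (\<lambda>i. P $$ (i, j))"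
proof -
  have "\<exists>k. b' j = int_comb b n k" if "j < n" for j
    using b b' that unfolding Z_basis_def int_comb_def by blast
  then obtain k where k: "\<And>j. j < n \<Longrightarrow> b' j = int_comb b n (k j)" by metis
  have "b' j = int_comb b n (\<lambda>i. mat n n (\<lambda>(i, j). k j i) $$ (i, j))" if "j < n" for j
    unfolding k[OF that] by (rule int_comb_cong[OF Z_basis_closed[OF b]]) (use that in simp)
  then show ?thesis by (intro bexI[of _ "mat n n (\<lambda>(i, j). k j i)"]) auto
qed

lemma int_comb_mat_mult:
  assumes b: "b \<in> {..<n} \<rightarrow> carrier G" and b': "\<And>j. j < n \<Longrightarrow> b' j = int_comb b n (\<lambda>i. P $$ (i, j))"
    and P: "P \<in> carrier_mat n n" and Q: "Q \<in> carrier_mat n n" and j: "j < n"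
  shows "int_comb b' n (\<lambda>i. Q $$ (i, j)) = int_comb b n (\<lambda>i. (P * Q) $$ (i, j))"
proof -
  have "int_comb b' n (\<lambda>i. Q $$ (i, j)) =
      int_comb (\<lambda>j. int_comb b n (\<lambda>i. P $$ (i, j))) n (\<lambda>i. Q $$ (i, j))"
    unfolding int_comb_def[of b'] int_comb_def[of "\<lambda>j. int_comb b n (\<lambda>i. P $$ (i, j))"]
    using b' int_comb_closed[OF b] by (intro finprod_cong') auto
  also have "\<dots> = int_comb b n (\<lambda>i. \<Sum>q<n. P $$ (i, q) * Q $$ (q, j))"
    by (rule int_comb_int_comb[OF b])
  also have "\<dots> = int_comb b n (\<lambda>i. (P * Q) $$ (i, j))"
    using P Q j by (intro int_comb_cong[OF b]) (auto simp: scalar_prod_def lessThan_atLeast0 intro!: sum.cong)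
  finally show ?thesis .
qed

lemma hom_int_comb:
  assumes "\<psi> \<in> hom G G" "b \<in> {..<n} \<rightarrow> carrier G"
  shows "\<psi> (int_comb b n k) = int_comb (\<lambda>i. \<psi> (b i)) n k"
proof -
  interpret h: group_hom G G \<psi> using assms is_group by (auto simp: group_hom_def group_hom_axioms_def)
  show ?thesis
    using assms(2)
  proof (induction n)
    case (Suc n)
    then have b: "b \<in> {..<n} \<rightarrow> carrier G" "b n \<in> carrier G" by auto
    then have cl: "(\<lambda>i. b i [^] k i) \<in> {..<n} \<rightarrow> carrier G" "(\<lambda>i. \<psi> (b i) [^] k i) \<in> {..<n} \<rightarrow> carrier G"
      by (auto simp: Pi_iff)
    then show ?case using Suc.IH[OF b(1)] b
      by (simp add: int_comb_def lessThan_Suc h.hom_int_pow)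
  qed (simp add: int_comb_def)
qed

text \<open>The description in \<open>endo_char_poly\<close> is unambiguous because the matrices for
  two bases are conjugate: \<open>P\<close> and \<open>Q\<close> express each basis in the other,
  uniqueness of coordinates makes them mutually inverse, and \<open>M' = Q * M * P\<close>.\<close>

lemma endo_char_poly_eq:
  assumes b: "Z_basis G n b" and M: "M \<in> carrier_mat n n" and \<psi>: "\<psi> \<in> hom G G"
    and Mb: "\<And>j. j < n \<Longrightarrow> \<psi> (b j) = int_comb b n (\<lambda>i. M $$ (i, j))"
  shows "endo_char_poly G n \<psi> = char_poly M"
  unfolding endo_char_poly_def
proof (rule the_equality)
  show "\<exists>b M'. Z_basis G n b \<and> M' \<in> carrier_mat n n \<and>
     (\<forall>j<n. \<psi> (b j) = finprod G (\<lambda>i. b i [^] (M' $$ (i, j))) {..<n}) \<and> char_poly M = char_poly M'"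
    using b M Mb unfolding int_comb_def by blast
next
  fix p :: "int poly" assume "\<exists>b M. Z_basis G n b \<and> M \<in> carrier_mat n n \<and>
     (\<forall>j<n. \<psi> (b j) = finprod G (\<lambda>i. b i [^] (M $$ (i, j))) {..<n}) \<and> p = char_poly M"
  then obtain b' M' where b': "Z_basis G n b'" and M': "M' \<in> carrier_mat n n"
    and Mb': "\<And>j. j < n \<Longrightarrow> \<psi> (b' j) = int_comb b' n (\<lambda>i. M' $$ (i, j))" and p: "p = char_poly M'"
    unfolding int_comb_def by blast
  note cl = Z_basis_closed[OF b] and cl' = Z_basis_closed[OF b']
  obtain P where P: "P \<in> carrier_mat n n" "\<And>j. j < n \<Longrightarrow> b' j = int_comb b n (\<lambda>i. P $$ (i, j))"
    using Z_basis_change[OF b cl'] by blast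
  obtain Q where Q: "Q \<in> carrier_mat n n" "\<And>j. j < n \<Longrightarrow> b j = int_comb b' n (\<lambda>i. Q $$ (i, j))"
    using Z_basis_change[OF b' cl] by blast
  have id: "int_comb d n (\<lambda>i. (1\<^sub>m n :: int mat) $$ (i, j)) = d j" if "d \<in> {..<n} \<rightarrow> carrier G" "j < n" for d j
  proof -
    have "int_comb d n (\<lambda>i. (1\<^sub>m n :: int mat) $$ (i, j)) = finprod G (\<lambda>i. if j = i then d i else \<one>) {..<n}"
      unfolding int_comb_def using that by (intro finprod_cong') (auto simp: int_pow_1 Pi_iff)
    also have "\<dots> = d j" using that by (intro finprod_singleton) auto
    finally show ?thesis .
  qed
  have inverse: "X * Y = 1\<^sub>m n"
    if "Z_basis G n d" "d' \<in> {..<n} \<rightarrow> carrier G" "X \<in> carrier_mat n n" "Y \<in> carrier_mat n n"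
      "\<And>j. j < n \<Longrightarrow> d' j = int_comb d n (\<lambda>i. X $$ (i, j))" "\<And>j. j < n \<Longrightarrow> d j = int_comb d' n (\<lambda>i. Y $$ (i, j))"
    for X Y d d'
  proof (rule eq_matI)
    fix i j assume "i < dim_row (1\<^sub>m n)" "j < dim_col (1\<^sub>m n)"
    then have ij: "i < n" "j < n" by auto
    have "int_comb d n (\<lambda>i. (X * Y) $$ (i, j)) = int_comb d n (\<lambda>i. 1\<^sub>m n $$ (i, j))"
      using int_comb_mat_mult[OF Z_basis_closed[OF that(1)] that(5,3,4) ij(2)] that(6)[OF ij(2)]
        id[OF Z_basis_closed[OF that(1)] ij(2)] by simp
    then show "(X * Y) $$ (i, j) = 1\<^sub>m n $$ (i, j)" by (rule Z_basis_unique[OF that(1) _ ij(1)])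
  qed (use that in auto)
  have PQ: "P * Q = 1\<^sub>m n" by (rule inverse[OF b cl' P(1) Q(1) P(2) Q(2)])
  have QP: "Q * P = 1\<^sub>m n" by (rule inverse[OF b' cl Q(1) P(1) Q(2) P(2)])
  have comm: "P * M' = M * P"
  proof (rule eq_matI)
    fix i j assume "i < dim_row (M * P)" "j < dim_col (M * P)"
    then have ij: "i < n" "j < n" using M P by auto
    have "int_comb b n (\<lambda>i. (P * M') $$ (i, j)) = int_comb b' n (\<lambda>i. M' $$ (i, j))"
      by (rule int_comb_mat_mult[OF cl P(2,1) M' ij(2), symmetric])
    also have "\<dots> = \<psi> (int_comb b n (\<lambda>i. P $$ (i, j)))" using Mb' P(2) ij by simp
    also have "\<dots> = int_comb (\<lambda>i. \<psi> (b i)) n (\<lambda>i. P $$ (i, j))" by (rule hom_int_comb[OF \<psi> cl])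
    also have "\<dots> = int_comb b n (\<lambda>i. (M * P) $$ (i, j))" by (rule int_comb_mat_mult[OF cl Mb M P(1) ij(2)])
    finally show "(P * M') $$ (i, j) = (M * P) $$ (i, j)" by (rule Z_basis_unique[OF b _ ij(1)])
  qed (use P M M' in auto)
  have "M' = (Q * P) * M'" using QP M' by simp
  also have "\<dots> = Q * (M * P)" unfolding assoc_mult_mat[OF Q(1) P(1) M'] comm ..
  also have "\<dots> = Q * M * P" unfolding assoc_mult_mat[OF Q(1) M P(1)] ..
  finally have "similar_mat_wit M' M Q P"
    by (intro similar_mat_witI[OF QP PQ _ M' M Q(1) P(1)])
  then have "similar_mat M' M" unfolding similar_mat_def by blast
  then show "p = char_poly M" using char_poly_similar p by blast
qed

end

section \<open>The Magnus expansion\<close>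

text \<open>The inverse of a series with constant term 1, solved word by word: the equation for the
  coefficient of a word involves only proper suffixes of it.\<close>

fun nc_inversef :: "(nat list \<Rightarrow> int) \<Rightarrow> nat list \<Rightarrow> int" where
  "nc_inversef f [] = 1"
| "nc_inversef f (x # w) = - (\<Sum>k\<le>length w. f (x # take k w) * nc_inversef f (drop k w))"

lemma nc_conv_inversef:
  assumes "f [] = 1"
  shows "nc_conv f (nc_inversef f) w = (if w = [] then 1 else 0)"
proof (cases w)
  case (Cons x v)
  have "nc_conv f (nc_inversef f) w = nc_inversef f (x # v) + nc_conv (\<lambda>u. f (x # u)) (nc_inversef f) v"
    using Cons assms by simp
  also have "nc_conv (\<lambda>u. f (x # u)) (nc_inversef f) v = - nc_inversef f (x # v)"
    by (simp add: nc_conv_sum)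
  finally show ?thesis using Cons by simp
qed (simp add: assms)

definition nc_units :: "ncps monoid" where
  "nc_units = \<lparr>carrier = {f. nc_nth f [] = 1}, monoid.mult = (*), one = 1\<rparr>"

lemma nc_units_simps [simp]: "monoid.mult nc_units = (*)" "\<one>\<^bsub>nc_units\<^esub> = 1"
  by (simp_all add: nc_units_def)

lemma nc_order_ge_uminus: "nc_order_ge k (- f) = nc_order_ge k f"
  by (simp add: nc_order_ge_def)

lemma nc_right_inverse:
  assumes "nc_nth f [] = 1"
  shows "\<exists>g. nc_nth g [] = 1 \<and> f * g = 1"
  using assms
proof (intro exI[of _ "Abs_ncps (nc_inversef (nc_nth f))"] conjI ncps_eqI)
  fix w show "nc_nth (f * Abs_ncps (nc_inversef (nc_nth f))) w = nc_nth 1 w"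
    using nc_conv_inversef[of "nc_nth f" w] assms
    by (simp add: times_ncps.rep_eq nc_nth_one Abs_ncps_inverse)
qed (simp add: Abs_ncps_inverse)

lemma group_nc_units: "group nc_units"
proof (rule groupI)
  fix f assume "f \<in> carrier nc_units"
  then obtain g where g: "nc_nth g [] = 1" "f * g = 1"
    using nc_right_inverse by (auto simp: nc_units_def)
  \<comment> \<open>Only right inverses were constructed; the right inverse of the right inverse
    turns out to be \<open>f\<close>, so \<open>g\<close> is two-sided.\<close>
  then obtain h where h: "g * h = 1" using nc_right_inverse by blast
  have "h = f * g * h" using g by simp
  also have "\<dots> = f" using h by (simp add: mult.assoc)
  finally have "g * f = 1" using h by simp
  then show "\<exists>g\<in>carrier nc_units. g \<otimes>\<^bsub>nc_units\<^esub> f = \<one>\<^bsub>nc_units\<^esub>"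
    using g by (auto simp: nc_units_def)
qed (auto simp: nc_units_def nc_nth_one mult.assoc)

definition free_gen :: "nat \<Rightarrow> letter list" where
  "free_gen i = [(True, i)]"

lemma free_gen_closed: "i < r \<Longrightarrow> free_gen i \<in> carrier (free_group r)"
  by (simp add: free_gen_def free_group_def)

lemma free_group_generated:
  "carrier (free_group r) \<subseteq> generate (free_group r) (free_gen ` {..<r})"
proof
  interpret F: group "free_group r" by (rule group_free_group)
  let ?H = "generate (free_group r) (free_gen ` {..<r})"
  have letter: "[(b, i)] \<in> ?H" if "i < r" for b i
  proof (cases b)
    case True
    have "free_gen i \<in> ?H" by (rule generate.incl) (use that in blast)
    then show ?thesis using True free_gen_def by metis
  next
    case False
    have "inv\<^bsub>free_group r\<^esub> (free_gen i) = [(False, i)]"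
      by (rule F.inv_equality) (use that in \<open>auto simp: free_group_def free_gen_def\<close>)
    then show ?thesis using that False generate.inv[of "free_gen i"] by (metis imageI lessThan_iff)
  qed
  fix w assume "w \<in> carrier (free_group r)"
  then show "w \<in> ?H"
  proof (induction w)
    case Nil
    then show ?case using generate.one[of "free_group r"] by (simp add: free_group_def)
  next
    case (Cons a w)
    have w: "w \<in> carrier (free_group r)" "snd a < r" "reduced (a # w)"
      using Cons.prems reduced_tl[of a w] by (auto simp: free_group_def)
    have "[a] \<otimes>\<^bsub>free_group r\<^esub> w = a # w"
      using w(3) by (cases w) (auto simp: free_group_def)
    moreover have "[a] \<in> ?H" using letter[OF w(2), of "fst a"] by simp
    ultimately show ?case using generate.eng[of "[a]"] Cons.IH[OF w(1)] by metis
  qed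
qed

lemma generated_group_free: "generated_group (free_group r) r free_gen"
  by (intro generated_group.intro generated_group_axioms.intro group_free_group
      free_gen_closed free_group_generated)

definition magnus :: "nat \<Rightarrow> letter list \<Rightarrow> ncps" where
  "magnus r = (SOME h. h \<in> hom (free_group r) nc_units \<and> (\<forall>i<r. h (free_gen i) = 1 + nc_var i))"

lemma magnus_props: "magnus r \<in> hom (free_group r) nc_units" "i < r \<Longrightarrow> magnus r (free_gen i) = 1 + nc_var i"
proof -
  have "nc_nth (1 + nc_var i) [] = 1" for i by (simp add: nc_nth_one nc_var.rep_eq)
  then have "(\<lambda>i. 1 + nc_var i) \<in> {..<r} \<rightarrow> carrier nc_units" by (auto simp: nc_units_def)
  from free_group_extend[OF group_nc_units this]
  have "\<exists>h. h \<in> hom (free_group r) nc_units \<and> (\<forall>i<r. h (free_gen i) = 1 + nc_var i)"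
    by (auto simp: free_gen_def)
  from someI_ex[OF this]
  show "magnus r \<in> hom (free_group r) nc_units" "i < r \<Longrightarrow> magnus r (free_gen i) = 1 + nc_var i"
    by (auto simp: magnus_def)
qed

text \<open>A leading term only for \<open>g\<close> in term \<open>k\<close> of the series, where
  the lower degrees vanish by \<open>magnus_order\<close>.\<close>

definition magnus_lead :: "nat \<Rightarrow> nat \<Rightarrow> letter list \<Rightarrow> ncps" where
  "magnus_lead r k g = nc_hom_part k (magnus r g - 1)"

context
  fixes r :: nat
begin

interpretation F: generated_group "free_group r" r free_gen
  by (rule generated_group_free)

interpretation mag: group_hom "free_group r" nc_units "magnus r"
  using F.is_group group_nc_units magnus_props by (auto simp: group_hom_def group_hom_axioms_def)

abbreviation (input) "FR \<equiv> free_group r"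
abbreviation (input) "lead \<equiv> magnus_lead r"

lemma magnus_mult:
  "g \<in> carrier FR \<Longrightarrow> h \<in> carrier FR \<Longrightarrow> magnus r (g \<otimes>\<^bsub>FR\<^esub> h) = magnus r g * magnus r h"
  by (simp add: nc_units_def)

lemma magnus_one: "magnus r \<one>\<^bsub>FR\<^esub> = 1"
  using mag.hom_one by (simp add: nc_units_def)

lemma magnus_inv_mult:
  assumes "g \<in> carrier FR"
  shows "magnus r g * magnus r (inv\<^bsub>FR\<^esub> g) = 1" "magnus r (inv\<^bsub>FR\<^esub> g) * magnus r g = 1"
  using assms magnus_mult[of g "inv\<^bsub>FR\<^esub> g"] magnus_mult[of "inv\<^bsub>FR\<^esub> g" g] magnus_one by auto

lemma magnus_Nil: "g \<in> carrier FR \<Longrightarrow> nc_nth (magnus r g) [] = 1"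
  using mag.hom_closed by (auto simp: nc_units_def)

lemma magnus_order_1: "g \<in> carrier FR \<Longrightarrow> nc_order_ge 1 (magnus r g - 1)"
  by (auto simp: nc_order_ge_def nc_nth_one magnus_Nil)

text \<open>Obtained by expanding the image of [g,h] hg = gh. The extra factor on the left is a unit
  with constant term 1, so group commutators turn into ring commutators in lowest degree.\<close>

lemma magnus_comm:
  assumes g: "g \<in> carrier FR" and h: "h \<in> carrier FR"
  shows "(magnus r (F.cm g h) - 1) * (magnus r h * magnus r g) =
     (magnus r g - 1) * (magnus r h - 1) - (magnus r h - 1) * (magnus r g - 1)"
proof -
  have "F.cm g h \<otimes>\<^bsub>FR\<^esub> (h \<otimes>\<^bsub>FR\<^esub> g) = g \<otimes>\<^bsub>FR\<^esub> h"
    using g h by (simp add: group_comm_def F.m_assoc)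
  then have "magnus r (F.cm g h) * (magnus r h * magnus r g) = magnus r g * magnus r h"
    using g h F.comm_closed by (metis magnus_mult F.m_closed)
  then show ?thesis by (simp add: algebra_simps)
qed

lemma magnus_comm_order:
  assumes g: "g \<in> carrier FR" and h: "h \<in> carrier FR"
    and "nc_order_ge i (magnus r g - 1)" "nc_order_ge j (magnus r h - 1)"
  shows "nc_order_ge (i + j) (magnus r (F.cm g h) - 1)"
proof -
  let ?d = "magnus r (F.cm g h) - 1" and ?y = "magnus r h * magnus r g"
  let ?x = "magnus r (inv\<^bsub>FR\<^esub> g) * magnus r (inv\<^bsub>FR\<^esub> h)"
  have "?y * ?x = magnus r h * (magnus r g * magnus r (inv\<^bsub>FR\<^esub> g)) * magnus r (inv\<^bsub>FR\<^esub> h)"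
    by (simp add: mult.assoc)
  then have "?y * ?x = 1" using magnus_inv_mult g h by simp
  then have "?d = (?d * ?y) * ?x" by (simp add: mult.assoc)
  moreover have "nc_order_ge (i + j) (?d * ?y)"
    unfolding magnus_comm[OF g h]
    using nc_order_ge_mult[OF assms(3,4)] nc_order_ge_mult[OF assms(4,3)]
    by (intro nc_order_ge_diff) (auto simp: add.commute)
  ultimately show ?thesis
    using nc_order_ge_mult[of "i + j" "?d * ?y" 0 ?x] by (simp add: nc_order_ge_def)
qed

lemma magnus_order_mult:
  assumes "g \<in> carrier FR" "h \<in> carrier FR"
    and "nc_order_ge k (magnus r g - 1)" "nc_order_ge k (magnus r h - 1)"
  shows "nc_order_ge k (magnus r (g \<otimes>\<^bsub>FR\<^esub> h) - 1)"
proof -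
  have eq: "magnus r (g \<otimes>\<^bsub>FR\<^esub> h) - 1 = (magnus r g - 1) * magnus r h + (magnus r h - 1)"
    using assms by (simp add: magnus_mult algebra_simps)
  show ?thesis
    unfolding eq
    using nc_order_ge_mult[of k "magnus r g - 1" 0 "magnus r h"] assms(3,4)
    by (intro nc_order_ge_add) (simp_all add: nc_order_ge_def[of 0])
qed

lemma magnus_order_inv:
  assumes "g \<in> carrier FR" "nc_order_ge k (magnus r g - 1)"
  shows "nc_order_ge k (magnus r (inv\<^bsub>FR\<^esub> g) - 1)"
proof -
  have "magnus r (inv\<^bsub>FR\<^esub> g) - 1 = 0 - (magnus r g - 1) * magnus r (inv\<^bsub>FR\<^esub> g)"
    using magnus_inv_mult(1)[OF assms(1)] by (simp add: algebra_simps)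
  then show ?thesis
    using nc_order_ge_mult[of k "magnus r g - 1" 0 "magnus r (inv\<^bsub>FR\<^esub> g)"] assms(2)
    by (simp add: nc_order_ge_uminus nc_order_ge_def[of 0])
qed

lemma magnus_order:
  assumes "k \<ge> 1"
  shows "g \<in> F.LC k \<Longrightarrow> nc_order_ge k (magnus r g - 1)"
  using assms
proof (induction k arbitrary: g rule: dec_induct)
  case base
  then show ?case using magnus_order_1 by simp
next
  case (step k)
  note [simp] = F.lower_central_carrier
  from step.prems step.hyps(1) show ?case
  proof (induction rule: F.lower_central_Suc_induct)
    case one
    then show ?case by (simp add: magnus_one nc_order_ge_def)
  next
    case (incl x y)
    then show ?case
      using magnus_comm_order[OF _ _ step.IH[OF incl(1)] magnus_order_1[OF incl(2)]] by simp
  next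
    case (inv g)
    then show ?case using magnus_order_inv by auto
  next
    case (mult g h)
    then show ?case using magnus_order_mult by auto
  qed
qed

text \<open>The cross term has order at least \<open>2 * k\<close>, which exceeds \<open>k\<close>
  since \<open>k \<ge> 1\<close>, so it does not reach degree \<open>k\<close>.\<close>

lemma lead_mult:
  assumes "k \<ge> 1" "g \<in> F.LC k" "h \<in> F.LC k"
  shows "lead k (g \<otimes>\<^bsub>FR\<^esub> h) = lead k g + lead k h"
proof -
  have car: "g \<in> carrier FR" "h \<in> carrier FR" using assms F.lower_central_carrier by blast+
  have eq: "magnus r (g \<otimes>\<^bsub>FR\<^esub> h) - 1 = (magnus r g - 1) * (magnus r h - 1) + ((magnus r g - 1) + (magnus r h - 1))"
    using car by (simp add: magnus_mult algebra_simps)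
  have "nc_order_ge (Suc k) ((magnus r g - 1) * (magnus r h - 1))"
    by (rule nc_order_ge_mono[OF nc_order_ge_mult[OF magnus_order[OF assms(1,2)] magnus_order[OF assms(1,3)]]])
       (use assms(1) in simp)
  then have "nc_hom_part k ((magnus r g - 1) * (magnus r h - 1)) = 0" by (rule nc_hom_part_0)
  then show ?thesis unfolding magnus_lead_def eq nc_hom_part_add[of k "_ * _"] nc_hom_part_add[of k "_ - 1"] by simp
qed

lemma lead_Suc:
  assumes "g \<in> F.LC (Suc k)"
  shows "lead k g = 0"
  using magnus_order[of "Suc k" g] assms by (simp add: magnus_lead_def nc_hom_part_0)

lemma lead_one: "lead k \<one>\<^bsub>FR\<^esub> = 0"
  by (simp add: lead_Suc subgroup.one_closed[OF F.subgroup_lower_central])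

lemma lead_inv:
  assumes "k \<ge> 1" "g \<in> F.LC k"
  shows "lead k (inv\<^bsub>FR\<^esub> g) = - lead k g"
proof -
  have "lead k g + lead k (inv\<^bsub>FR\<^esub> g) = 0"
    using lead_mult[OF assms, of "inv\<^bsub>FR\<^esub> g"] assms F.lower_central_carrier lead_one
      subgroup.m_inv_closed[OF F.subgroup_lower_central] by simp
  then show ?thesis by (simp add: eq_neg_iff_add_eq_0 add.commute)
qed

text \<open>The unit \<open>?y\<close> differs from 1 only in positive degrees, so multiplying by it
  does not affect the part of degree \<open>i + j\<close>.\<close>

lemma lead_comm:
  assumes "i \<ge> 1" "j \<ge> 1" "g \<in> F.LC i" "h \<in> F.LC j"
  shows "lead (i + j) (F.cm g h) = lead i g * lead j h - lead j h * lead i g"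
proof -
  let ?d = "magnus r (F.cm g h) - 1" and ?y = "magnus r h * magnus r g"
  have car: "g \<in> carrier FR" "h \<in> carrier FR" using assms F.lower_central_carrier by blast+
  note og = magnus_order[OF assms(1,3)] and oh = magnus_order[OF assms(2,4)]
  have "nc_order_ge 1 (?y - 1)"
    using magnus_order_1[of "h \<otimes>\<^bsub>FR\<^esub> g"] car by (simp add: magnus_mult)
  then have "nc_order_ge (i + j + 1) (?d * (?y - 1))"
    using nc_order_ge_mult magnus_comm_order[OF car og oh] by blast
  then have "nc_hom_part (i + j) (?d * (?y - 1)) = 0" by (simp add: nc_hom_part_0)
  moreover have "?d * ?y = ?d * (?y - 1) + ?d" by (simp add: algebra_simps)
  ultimately have "nc_hom_part (i + j) ?d = nc_hom_part (i + j) (?d * ?y)"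
    by (simp add: nc_hom_part_add)
  also have "\<dots> = nc_hom_part (i + j) ((magnus r g - 1) * (magnus r h - 1))
      - nc_hom_part (j + i) ((magnus r h - 1) * (magnus r g - 1))"
    unfolding magnus_comm[OF car] add.commute[of j i] by (rule nc_hom_part_diff)
  also have "\<dots> = lead i g * lead j h - lead j h * lead i g"
    unfolding magnus_lead_def nc_hom_part_mult[OF og oh] nc_hom_part_mult[OF oh og] ..
  finally show ?thesis by (simp add: magnus_lead_def)
qed

lemma lead_gen: "i < r \<Longrightarrow> lead 1 (free_gen i) = nc_var i"
  by (rule ncps_eqI) (auto simp: magnus_lead_def magnus_props nc_nth_hom_part nc_var.rep_eq)

lemma nc_nth_lead_length: "length w \<noteq> k \<Longrightarrow> nc_nth (lead k g) w = 0"
  by (simp add: magnus_lead_def nc_nth_hom_part)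

text \<open>The triangularity behind linear independence. In the bracket of the two leading terms
  the smallest word of one product is \<open>u @ v\<close>, with coefficient 1; the other product
  starts only at \<open>v @ u\<close>, which is larger.\<close>

lemma lead_lyndon_comm:
  assumes "lyndon w" "set w \<subseteq> {..<r}"
  shows "nc_nth (lead (length w) (F.LY w)) w = 1 \<and> (\<forall>x<w. nc_nth (lead (length w) (F.LY w)) x = 0)"
  using assms
proof (induction rule: lyndon_word_induct)
  case (single i)
  have "nc_nth (nc_var i) x = 0" if "x < [i]" for x
    using that by (auto simp: nc_var.rep_eq)
  then show ?case using single lead_gen[of i] by (simp add: lyndon_comm_single nc_var.rep_eq)
next
  case (append u v)
  let ?Lu = "lead (length u) (F.LY u)" and ?Lv = "lead (length v) (F.LY v)"
  have pos: "length u \<ge> 1" "length v \<ge> 1" using append lyndon_nonempty by (auto simp: Suc_le_eq)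
  have uv: "set u \<subseteq> {..<r}" "set v \<subseteq> {..<r}" using append by auto
  have eq: "lead (length (u @ v)) (F.LY (u @ v)) = ?Lu * ?Lv - ?Lv * ?Lu"
    using lead_comm[OF pos F.lyndon_comm_mem[OF append(1) uv(1)] F.lyndon_comm_mem[OF append(2) uv(2)]]
      lyndon_comm_append[OF append(1,2,5), of FR free_gen] by simp
  have hom: "?Lu = nc_hom_part (length u) ?Lu" "?Lv = nc_hom_part (length v) ?Lv"
    by (auto intro!: ncps_eqI simp: nc_nth_hom_part nc_nth_lead_length)
  have val: "nc_nth (lead (length (u @ v)) (F.LY (u @ v))) x =
     nc_nth ?Lu (take (length u) x) * nc_nth ?Lv (drop (length u) x)
       - nc_nth ?Lv (take (length v) x) * nc_nth ?Lu (drop (length v) x)"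
    if "length x = length u + length v" for x
    unfolding eq using that
      nc_nth_mult_hom_part[of "length u" ?Lu "length v" ?Lv x]
      nc_nth_mult_hom_part[of "length v" ?Lv "length u" ?Lu x] hom by simp
  have vu: "u @ v < v @ u"
    using lyndon_append_less[of v u] list_less_append_self[of u v] append lyndon_nonempty
    by (metis order_less_trans)
  \<comment> \<open>A nonzero product needs a first part at least \<open>v\<close> and a second part
    at least \<open>u\<close>, so that \<open>x\<close> would be at least
    \<open>v @ u\<close>.\<close>
  have second: "nc_nth ?Lv (take (length v) x) * nc_nth ?Lu (drop (length v) x) = 0"
    if x: "length x = length u + length v" "x \<le> u @ v" for x
  proof (rule ccontr)
    assume ne: "\<not> ?thesis"
    let ?a = "take (length v) x" and ?b = "drop (length v) x"
    have ab: "\<not> ?a < v" "\<not> ?b < u" using ne append.IH uv by auto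
    have "v @ u \<le> ?a @ ?b"
    proof (cases "?a = v")
      case True
      then have "u \<le> ?b" using ab by simp
      then have "v @ u \<le> v @ ?b" by (metis list_less_append_cancel order_le_less)
      then show ?thesis using True by simp
    next
      case False
      then have "v < ?a" using ab by auto
      then have "v @ u < ?a @ ?b" using x by (intro list_less_append_length) auto
      then show ?thesis by simp
    qed
    then show False using vu x by auto
  qed
  show ?case
  proof (intro conjI allI impI)
    show "nc_nth (lead (length (u @ v)) (F.LY (u @ v))) (u @ v) = 1"
      using val[of "u @ v"] second[of "u @ v"] append.IH uv by simp
    fix x assume x: "x < u @ v"
    show "nc_nth (lead (length (u @ v)) (F.LY (u @ v))) x = 0"
    proof (cases "length x = length u + length v")
      case True
      let ?a = "take (length u) x" and ?b = "drop (length u) x"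
      have "nc_nth ?Lu ?a * nc_nth ?Lv ?b = 0"
      proof (cases "?a = u")
        case eqa: True
        then have "u @ ?b < u @ v" using x by (metis append_take_drop_id)
        then have "?b < v" by simp
        then show ?thesis using append.IH uv by simp
      next
        case False
        have "\<not> u < ?a"
        proof
          assume "u < ?a"
          then have "u @ v < ?a @ ?b" using True by (intro list_less_append_length) auto
          then show False using x by auto
        qed
        then have "?a < u" using False by auto
        then show ?thesis using append.IH uv by simp
      qed
      then show ?thesis using val[OF True] second[OF True] x by simp
    qed (simp add: nc_nth_lead_length)
  qed
qed

lemma lead_lyndon_words:
  assumes "w \<in> F.lyndon_words k"
  shows "nc_nth (lead k (F.LY w)) w = 1" "x < w \<Longrightarrow> nc_nth (lead k (F.LY w)) x = 0"
  using lead_lyndon_comm[of w] assms by (auto simp: F.lyndon_words_def)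

lemma lead_int_pow:
  assumes "k \<ge> 1" "g \<in> F.LC k"
  shows "g [^]\<^bsub>FR\<^esub> n \<in> F.LC k \<and> nc_nth (lead k (g [^]\<^bsub>FR\<^esub> (n :: int))) w = n * nc_nth (lead k g) w"
proof -
  interpret H: subgroup "F.LC k" FR by (rule F.subgroup_lower_central)
  have car: "g \<in> carrier FR" using assms F.lower_central_carrier by blast
  have nat: "g [^]\<^bsub>FR\<^esub> n \<in> F.LC k \<and> nc_nth (lead k (g [^]\<^bsub>FR\<^esub> n)) w = int n * nc_nth (lead k g) w" for n :: nat
  proof (induction n)
    case (Suc n)
    then have n: "g [^]\<^bsub>FR\<^esub> n \<in> F.LC k" by blast
    show ?case using Suc lead_mult[OF assms(1) n assms(2)] H.m_closed[OF n assms(2)]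
      by (simp add: algebra_simps)
  qed (simp add: lead_one)
  show ?thesis
  proof (cases n)
    case (nonneg m)
    then show ?thesis using nat[of m] car by (simp add: int_pow_int)
  next
    case (neg m)
    let ?h = "g [^]\<^bsub>FR\<^esub> Suc m"
    have eq: "g [^]\<^bsub>FR\<^esub> n = inv\<^bsub>FR\<^esub> ?h"
      unfolding neg using car F.int_pow_neg_int[of g "Suc m"] by simp
    have h: "?h \<in> F.LC k" "nc_nth (lead k ?h) w = int (Suc m) * nc_nth (lead k g) w"
      using nat[of "Suc m"] by blast+
    have "nc_nth (lead k (g [^]\<^bsub>FR\<^esub> n)) w = - nc_nth (lead k ?h) w"
      unfolding eq lead_inv[OF assms(1) h(1)] by simp
    also have "\<dots> = n * nc_nth (lead k g) w" unfolding h(2) neg by (simp only: mult_minus_left)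
    finally show ?thesis using H.m_inv_closed[OF h(1)] eq by simp
  qed
qed

lemma lead_lyndon_span_below:
  assumes "k \<ge> 1" "A \<subseteq> F.lyndon_words k" "\<forall>a\<in>A. b < a" "g \<in> F.lyndon_span k (\<lambda>w. w \<in> A)"
  shows "nc_nth (lead k g) b = 0"
proof -
  interpret H: subgroup "F.LC k" FR by (rule F.subgroup_lower_central)
  let ?T = "{g \<in> F.LC k. nc_nth (lead k g) b = 0}"
  have "subgroup ?T FR"
    by (rule F.subgroup_induct_of) (use assms(1) F.lower_central_carrier in \<open>auto simp: lead_one lead_mult lead_inv\<close>)
  moreover have "F.LC (Suc k) \<union> {F.LY w |w. w \<in> F.lyndon_words k \<and> w \<in> A} \<subseteq> ?T"
    using F.lower_central_Suc_subset[of k] lead_Suc F.lyndon_words_mem lead_lyndon_words(2) assms(3) by auto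
  ultimately have "F.lyndon_span k (\<lambda>w. w \<in> A) \<subseteq> ?T"
    unfolding F.lyndon_span_def by (intro F.generate_subgroup_incl)
  then show ?thesis using assms(4) by blast
qed

text \<open>Elements that reach the smaller span after multiplication by a power of the commutator
  of \<open>b\<close> form a subgroup, since the span is invariant under conjugation, and they
  include all generators.\<close>

lemma lyndon_span_insert:
  assumes "k \<ge> 1" "b \<in> F.lyndon_words k" "g \<in> F.lyndon_span k (\<lambda>w. w \<in> insert b A)"
  shows "\<exists>n::int. g \<otimes>\<^bsub>FR\<^esub> F.LY b [^]\<^bsub>FR\<^esub> n \<in> F.lyndon_span k (\<lambda>w. w \<in> A)"
proof -
  let ?S = "F.lyndon_span k (\<lambda>w. w \<in> A)" and ?c = "F.LY b"
  have S: "F.between_lc k ?S" by (rule F.between_lyndon_span)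
  interpret S: subgroup ?S FR using S by (simp add: F.between_lc_def)
  have c: "?c \<in> carrier FR" using F.lyndon_words_mem[OF assms(2)] F.lower_central_carrier by blast
  let ?T = "{g \<in> carrier FR. \<exists>n::int. g \<otimes>\<^bsub>FR\<^esub> ?c [^]\<^bsub>FR\<^esub> n \<in> ?S}"
  have SI: "g \<otimes>\<^bsub>FR\<^esub> ?c [^]\<^bsub>FR\<^esub> (n::int) \<in> ?S \<Longrightarrow> g \<in> carrier FR \<Longrightarrow> g \<in> ?T" for g n by blast
  have "subgroup ?T FR"
  proof (rule F.subgroup_induct_of)
    show "\<one>\<^bsub>FR\<^esub> \<in> ?T" by (rule SI[of _ 0]) auto
  next
    fix x assume "x \<in> ?T"
    then obtain n :: int where x: "x \<in> carrier FR" and n: "x \<otimes>\<^bsub>FR\<^esub> ?c [^]\<^bsub>FR\<^esub> n \<in> ?S" by blast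
    let ?d = "?c [^]\<^bsub>FR\<^esub> n"
    have d: "?d \<in> carrier FR" using c by simp
    have "?d \<otimes>\<^bsub>FR\<^esub> inv\<^bsub>FR\<^esub> (x \<otimes>\<^bsub>FR\<^esub> ?d) \<otimes>\<^bsub>FR\<^esub> inv\<^bsub>FR\<^esub> ?d \<in> ?S"
      using F.between_lc_conj(1)[OF S S.m_inv_closed[OF n] d] .
    then have "inv\<^bsub>FR\<^esub> x \<otimes>\<^bsub>FR\<^esub> ?c [^]\<^bsub>FR\<^esub> (- n) \<in> ?S"
      using x d c by (simp add: F.inv_mult_group F.m_assoc F.int_pow_neg)
    then show "inv\<^bsub>FR\<^esub> x \<in> ?T" using x by (intro SI) auto
  next
    fix x y assume "x \<in> ?T" "y \<in> ?T"
    then obtain n m :: int where x: "x \<in> carrier FR" and n: "x \<otimes>\<^bsub>FR\<^esub> ?c [^]\<^bsub>FR\<^esub> n \<in> ?S"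
      and y: "y \<in> carrier FR" and m: "y \<otimes>\<^bsub>FR\<^esub> ?c [^]\<^bsub>FR\<^esub> m \<in> ?S" by blast
    let ?d = "?c [^]\<^bsub>FR\<^esub> n" and ?e = "?c [^]\<^bsub>FR\<^esub> m"
    have d: "?d \<in> carrier FR" "?e \<in> carrier FR" using c by simp_all
    have "inv\<^bsub>FR\<^esub> ?d \<otimes>\<^bsub>FR\<^esub> (y \<otimes>\<^bsub>FR\<^esub> ?e) \<otimes>\<^bsub>FR\<^esub> ?d \<in> ?S"
      using F.between_lc_conj(2)[OF S m d(1)] .
    then have "x \<otimes>\<^bsub>FR\<^esub> ?d \<otimes>\<^bsub>FR\<^esub> (inv\<^bsub>FR\<^esub> ?d \<otimes>\<^bsub>FR\<^esub> (y \<otimes>\<^bsub>FR\<^esub> ?e) \<otimes>\<^bsub>FR\<^esub> ?d) \<in> ?S"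
      using n by blast
    moreover have "x \<otimes>\<^bsub>FR\<^esub> ?d \<otimes>\<^bsub>FR\<^esub> (inv\<^bsub>FR\<^esub> ?d \<otimes>\<^bsub>FR\<^esub> (y \<otimes>\<^bsub>FR\<^esub> ?e) \<otimes>\<^bsub>FR\<^esub> ?d)
        = (x \<otimes>\<^bsub>FR\<^esub> y) \<otimes>\<^bsub>FR\<^esub> ?c [^]\<^bsub>FR\<^esub> (m + n)"
      using x y d c by (simp add: F.m_assoc F.int_pow_mult)
    ultimately show "x \<otimes>\<^bsub>FR\<^esub> y \<in> ?T" using x y by (intro SI) auto
  qed blast
  moreover have "F.LC (Suc k) \<union> {F.LY w |w. w \<in> F.lyndon_words k \<and> w \<in> insert b A} \<subseteq> ?T"
  proof
    fix x assume "x \<in> F.LC (Suc k) \<union> {F.LY w |w. w \<in> F.lyndon_words k \<and> w \<in> insert b A}"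
    then consider "x \<in> ?S" | "x = ?c"
      using S F.lyndon_span_incl[of _ k "\<lambda>w. w \<in> A"] by (auto simp: F.between_lc_def)
    then show "x \<in> ?T"
    proof cases
      case 1
      then show ?thesis by (intro SI[of _ 0]) auto
    next
      case 2
      then show ?thesis using c by (intro SI[of _ "-1"]) (auto simp: F.int_pow_neg F.int_pow_1)
    qed
  qed
  ultimately have "F.lyndon_span k (\<lambda>w. w \<in> insert b A) \<subseteq> ?T"
    unfolding F.lyndon_span_def by (intro F.generate_subgroup_incl)
  then show ?thesis using assms(3) by blast
qed

lemma finite_lyndon_words: "finite (F.lyndon_words k)"
  by (rule finite_subset[OF _ F.finite_words[of k]]) (auto simp: F.lyndon_words_def)

text \<open>The theorem of Magnus and Witt: leading terms detect the lower central series.\<close>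

lemma lead_kernel:
  assumes "k \<ge> 1" "g \<in> F.LC k" "\<And>w. w \<in> F.lyndon_words k \<Longrightarrow> nc_nth (lead k g) w = 0"
  shows "g \<in> F.LC (Suc k)"
proof -
  have "g \<in> F.LC (Suc k)"
    if "A \<subseteq> F.lyndon_words k" "g \<in> F.lyndon_span k (\<lambda>w. w \<in> A)" for A
    using finite_subset[OF that(1) finite_lyndon_words] that
  proof (induction A rule: finite_linorder_min_induct)
    case empty
    then show ?case
      using subgroup.subgroup_is_group F.generate_subgroup_incl[OF _ F.subgroup_lower_central, of "F.LC (Suc k)" "Suc k"]
      by (auto simp: F.lyndon_span_def)
  next
    case (insert b A)
    obtain n :: int where n: "g \<otimes>\<^bsub>FR\<^esub> F.LY b [^]\<^bsub>FR\<^esub> n \<in> F.lyndon_span k (\<lambda>w. w \<in> A)"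
      using lyndon_span_insert[OF assms(1) _ insert(5)] insert(4) by blast
    have b: "b \<in> F.lyndon_words k" using insert by simp
    have "0 = nc_nth (lead k (g \<otimes>\<^bsub>FR\<^esub> F.LY b [^]\<^bsub>FR\<^esub> n)) b"
      using lead_lyndon_span_below[OF assms(1) _ insert(2) n] insert(4) by simp
    also have "\<dots> = n"
      using lead_mult[OF assms(1,2), of "F.LY b [^]\<^bsub>FR\<^esub> n"] lead_int_pow[OF assms(1) F.lyndon_words_mem[OF b]]
        assms(3)[OF b] lead_lyndon_words(1)[OF b] by simp
    finally have "g \<in> F.lyndon_span k (\<lambda>w. w \<in> A)" using n F.lower_central_carrier[OF assms(2)] by simp
    then show ?case using insert by simp
  qed
  moreover have "g \<in> F.lyndon_span k (\<lambda>w. w \<in> F.lyndon_words k)"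
    using assms(2) F.lower_central_eq_lyndon_span[OF assms(1)] unfolding F.lyndon_span_def by simp
  ultimately show ?thesis by blast
qed

text \<open>A triangular system solved from the smallest word up: the power of the commutator of
  \<open>b\<close> fixes the coefficient at \<open>b\<close>, and the correction \<open>h\<close>,
  built from larger words, leaves it unchanged.\<close>

lemma lead_surj:
  assumes "k \<ge> 1"
  shows "\<exists>g\<in>F.LC k. \<forall>w\<in>F.lyndon_words k. nc_nth (lead k g) w = v w"
proof -
  have "\<exists>g\<in>F.lyndon_span k (\<lambda>w. w \<in> A). \<forall>w\<in>A. nc_nth (lead k g) w = v w"
    if "A \<subseteq> F.lyndon_words k" for A
    using finite_subset[OF that finite_lyndon_words] that
  proof (induction A arbitrary: v rule: finite_linorder_min_induct)
    case empty
    then show ?case by (auto simp: F.lyndon_span_def intro: generate.one)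
  next
    case (insert b A)
    have b: "b \<in> F.lyndon_words k" using insert by simp
    let ?S = "F.lyndon_span k (\<lambda>w. w \<in> insert b A)"
    interpret S: subgroup ?S FR using F.between_lyndon_span by (simp add: F.between_lc_def)
    define d where "d = F.LY b [^]\<^bsub>FR\<^esub> v b"
    have lc: "F.LY b \<in> F.LC k" using F.lyndon_words_mem[OF b] .
    have d: "d \<in> F.LC k" "nc_nth (lead k d) w = v b * nc_nth (lead k (F.LY b)) w" for w
      using lead_int_pow[OF assms lc] by (simp_all add: d_def)
    obtain h where h: "h \<in> F.lyndon_span k (\<lambda>w. w \<in> A)" "\<forall>w\<in>A. nc_nth (lead k h) w = v w - nc_nth (lead k d) w"
      using insert.IH[of "\<lambda>w. v w - nc_nth (lead k d) w"] insert.prems by auto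
    have hlc: "h \<in> F.LC k" using h(1) F.between_lyndon_span[of k "\<lambda>w. w \<in> A"] by (auto simp: F.between_lc_def)
    have "nc_nth (lead k h) b = 0"
      using lead_lyndon_span_below[OF assms _ insert(2) h(1)] insert.prems by simp
    then have "\<forall>w\<in>insert b A. nc_nth (lead k (d \<otimes>\<^bsub>FR\<^esub> h)) w = v w"
      using h lead_mult[OF assms d(1) hlc] d(2) lead_lyndon_words(1)[OF b] by simp
    moreover have "F.LY b \<in> ?S" using F.lyndon_span_incl[OF b] by simp
    then have "d \<in> ?S" unfolding d_def
      using F.subgroup_int_pow_closed[OF S.is_subgroup] by blast
    moreover have "h \<in> ?S" using h F.lyndon_span_mono[of "\<lambda>w. w \<in> A" "\<lambda>w. w \<in> insert b A" k] by blast
    ultimately show ?case by blast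
  qed
  then show ?thesis using F.between_lyndon_span[of k "\<lambda>w. w \<in> F.lyndon_words k"]
    by (metis F.between_lc_def subset_iff order_refl)
qed

section \<open>The action on the graded quotients\<close>

definition lyndon_list :: "nat \<Rightarrow> nat list list" where
  "lyndon_list k = sorted_list_of_set (F.lyndon_words k)"

definition lyndon_rank :: "nat \<Rightarrow> nat" where
  "lyndon_rank k = length (lyndon_list k)"

definition lyndon_coord :: "nat \<Rightarrow> letter list \<Rightarrow> int vec" where
  "lyndon_coord k g = vec (lyndon_rank k) (\<lambda>i. nc_nth (lead k g) (lyndon_list k ! i))"

text \<open>The abelianization: column \<open>j\<close> lists the exponent sums of the generators in
  the image of generator \<open>j\<close>, read off from the linear part of the Magnus
  expansion.\<close>

definition endo_matrix :: "(letter list \<Rightarrow> letter list) \<Rightarrow> int mat" where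
  "endo_matrix \<phi> = mat r r (\<lambda>(i, j). nc_nth (lead 1 (\<phi> (free_gen j))) [i])"

lemma endo_matrix_carrier: "endo_matrix \<phi> \<in> carrier_mat r r"
  by (simp add: endo_matrix_def)

lemma set_lyndon_list: "set (lyndon_list k) = F.lyndon_words k"
  by (simp add: lyndon_list_def finite_lyndon_words)

lemma lyndon_list_nth: "i < lyndon_rank k \<Longrightarrow> lyndon_list k ! i \<in> F.lyndon_words k"
  using set_lyndon_list by (metis lyndon_rank_def nth_mem)

lemma lyndon_list_letters: "i < lyndon_rank k \<Longrightarrow> set (lyndon_list k ! i) \<subseteq> {..<r}"
  using lyndon_list_nth by (auto simp: F.lyndon_words_def)

lemma lyndon_list_inj: "i < lyndon_rank k \<Longrightarrow> j < lyndon_rank k \<Longrightarrow> lyndon_list k ! i = lyndon_list k ! j \<longleftrightarrow> i = j"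
  by (simp add: lyndon_rank_def lyndon_list_def nth_eq_iff_index_eq)

lemma lyndon_coord_0:
  assumes "k \<ge> 1" "g \<in> F.LC k" "lyndon_coord k g = 0\<^sub>v (lyndon_rank k)"
  shows "g \<in> F.LC (Suc k)"
proof (rule lead_kernel[OF assms(1,2)])
  fix w assume "w \<in> F.lyndon_words k"
  then obtain i where i: "i < lyndon_rank k" "w = lyndon_list k ! i"
    using set_lyndon_list by (metis in_set_conv_nth lyndon_rank_def)
  have "lyndon_coord k g $ i = 0" using assms(3) i by simp
  then show "nc_nth (lead k g) w = 0" using i by (simp add: lyndon_coord_def)
qed

lemma lyndon_coord_surj:
  assumes "k \<ge> 1" "v \<in> carrier_vec (lyndon_rank k)"
  shows "\<exists>g\<in>F.LC k. lyndon_coord k g = v"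
proof -
  define u where "u w = (\<Sum>i<lyndon_rank k. if lyndon_list k ! i = w then v $ i else 0)" for w
  obtain g where g: "g \<in> F.LC k" "\<forall>w\<in>F.lyndon_words k. nc_nth (lead k g) w = u w"
    using lead_surj[OF assms(1), where v = u] by blast
  have "u (lyndon_list k ! i) = v $ i" if i: "i < lyndon_rank k" for i
  proof -
    have "u (lyndon_list k ! i) = (\<Sum>j<lyndon_rank k. if j = i then v $ i else 0)"
      unfolding u_def using i by (intro sum.cong) (auto simp: lyndon_list_inj)
    then show ?thesis using i by simp
  qed
  then have "lyndon_coord k g = v"
    using g lyndon_list_nth assms(2) by (intro eq_vecI) (auto simp: lyndon_coord_def)
  then show ?thesis using g by blast
qed

text \<open>Lyndon commutators are only triangular with respect to Lyndon coefficients; these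
  elements are exactly dual to them.\<close>

definition lyndon_dual :: "nat \<Rightarrow> nat \<Rightarrow> letter list" where
  "lyndon_dual k j = (SOME g. g \<in> F.LC k \<and> lyndon_coord k g = unit_vec (lyndon_rank k) j)"

lemma lyndon_dual:
  assumes "k \<ge> 1"
  shows "lyndon_dual k j \<in> F.LC k" "lyndon_coord k (lyndon_dual k j) = unit_vec (lyndon_rank k) j"
proof -
  have "\<exists>g. g \<in> F.LC k \<and> lyndon_coord k g = unit_vec (lyndon_rank k) j"
    using lyndon_coord_surj[OF assms] unit_vec_carrier by blast
  from someI_ex[OF this]
  show "lyndon_dual k j \<in> F.LC k" "lyndon_coord k (lyndon_dual k j) = unit_vec (lyndon_rank k) j"
    by (auto simp: lyndon_dual_def)
qed

lemma lead_lyndon_dual: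
  assumes "k \<ge> 1" "i < lyndon_rank k" "j < lyndon_rank k"
  shows "nc_nth (lead k (lyndon_dual k j)) (lyndon_list k ! i) = (if i = j then 1 else 0)"
proof -
  have "lyndon_coord k (lyndon_dual k j) $ i = unit_vec (lyndon_rank k) j $ i"
    using lyndon_dual(2)[OF assms(1)] by simp
  then show ?thesis using assms by (auto simp: lyndon_coord_def)
qed

lemma lead_linear_combination:
  assumes "k \<ge> 1"
  shows "\<exists>h\<in>F.LC k. \<forall>w. nc_nth (lead k h) w = (\<Sum>j<n. c j * nc_nth (lead k (lyndon_dual k j)) w)"
proof (induction n)
  case 0
  show ?case
    by (rule bexI[of _ "\<one>\<^bsub>FR\<^esub>"])
       (simp_all add: lead_one subgroup.one_closed[OF F.subgroup_lower_central])
next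
  case (Suc n)
  then obtain h where h: "h \<in> F.LC k"
    "\<forall>w. nc_nth (lead k h) w = (\<Sum>j<n. c j * nc_nth (lead k (lyndon_dual k j)) w)" by blast
  let ?d = "lyndon_dual k n [^]\<^bsub>FR\<^esub> c n"
  have d: "?d \<in> F.LC k" "nc_nth (lead k ?d) w = c n * nc_nth (lead k (lyndon_dual k n)) w" for w
    using lead_int_pow[OF assms lyndon_dual(1)[OF assms]] by simp_all
  have "h \<otimes>\<^bsub>FR\<^esub> ?d \<in> F.LC k"
    using subgroup.m_closed[OF F.subgroup_lower_central h(1) d(1)] .
  moreover have "\<forall>w. nc_nth (lead k (h \<otimes>\<^bsub>FR\<^esub> ?d)) w =
      (\<Sum>j<Suc n. c j * nc_nth (lead k (lyndon_dual k j)) w)"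
    using h(2) d(2) lead_mult[OF assms h(1) d(1)] by simp
  ultimately show ?case by blast
qed

text \<open>The Lyndon coefficients determine the coefficients at all other words: the quotient of
  \<open>g\<close> by the combination has zero coordinates, so it lies in the next term and its
  degree \<open>k\<close> part vanishes.\<close>

lemma lead_expansion:
  assumes "k \<ge> 1" "g \<in> F.LC k"
  shows "nc_nth (lead k g) w =
    (\<Sum>j<lyndon_rank k. lyndon_coord k g $ j * nc_nth (lead k (lyndon_dual k j)) w)"
proof -
  obtain h where h: "h \<in> F.LC k" "\<And>w. nc_nth (lead k h) w =
      (\<Sum>j<lyndon_rank k. lyndon_coord k g $ j * nc_nth (lead k (lyndon_dual k j)) w)"
    using lead_linear_combination[OF assms(1)] by metis
  have ih: "inv\<^bsub>FR\<^esub> h \<in> F.LC k" using subgroup.m_inv_closed[OF F.subgroup_lower_central h(1)] .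
  let ?q = "g \<otimes>\<^bsub>FR\<^esub> inv\<^bsub>FR\<^esub> h"
  have q: "?q \<in> F.LC k" using subgroup.m_closed[OF F.subgroup_lower_central assms(2) ih] .
  have lq: "lead k ?q = lead k g - lead k h"
    using lead_mult[OF assms ih] lead_inv[OF assms(1) h(1)] by simp
  have "lyndon_coord k ?q = 0\<^sub>v (lyndon_rank k)"
  proof (rule eq_vecI)
    fix i assume "i < dim_vec (0\<^sub>v (lyndon_rank k))"
    then have i: "i < lyndon_rank k" by simp
    have "nc_nth (lead k h) (lyndon_list k ! i) = (\<Sum>j<lyndon_rank k. if j = i then lyndon_coord k g $ i else 0)"
      unfolding h(2) using i by (intro sum.cong) (auto simp: lead_lyndon_dual[OF assms(1)])
    then show "lyndon_coord k ?q $ i = 0\<^sub>v (lyndon_rank k) $ i"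
      using i lq by (simp add: lyndon_coord_def)
  qed (simp add: lyndon_coord_def)
  then have "lead k ?q = 0" using lead_Suc lyndon_coord_0[OF assms(1) q] by blast
  then show ?thesis using lq h(2) by simp
qed

text \<open>In degree 1 it is checked on generators. It propagates along commutators because both
  \<open>lead_comm\<close> and \<open>nc_act\<close> respect products.\<close>

lemma lead_endo:
  assumes \<phi>: "\<phi> \<in> hom FR FR" and "k \<ge> 1"
  shows "g \<in> F.LC k \<Longrightarrow> set w \<subseteq> {..<r} \<Longrightarrow>
    nc_nth (lead k (\<phi> g)) w = nc_nth (nc_act (endo_matrix \<phi>) (lead k g)) w"
proof -
  let ?A = "endo_matrix \<phi>"
  interpret h: group_hom FR FR \<phi>
    using \<phi> F.is_group by (auto simp: group_hom_def group_hom_axioms_def)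
  have hLC: "\<phi> x \<in> F.LC i" if "x \<in> F.LC i" for x i using F.lower_central_hom[OF \<phi> that] .
  have base1: "nc_nth (lead 1 (\<phi> g)) w = nc_nth (nc_act ?A (lead 1 g)) w"
    if "g \<in> carrier FR" "set w \<subseteq> {..<r}" for g w
  proof -
    let ?T = "{g \<in> carrier FR. \<forall>w. set w \<subseteq> {..<r} \<longrightarrow>
       nc_nth (lead 1 (\<phi> g)) w = nc_nth (nc_act ?A (lead 1 g)) w}"
    have "subgroup ?T FR"
      by (rule F.subgroup_induct_of) (auto simp: lead_one lead_mult lead_inv nc_act_0 nc_act_add nc_act_uminus)
    moreover have "free_gen ` {..<r} \<subseteq> ?T"
    proof
      fix x assume "x \<in> free_gen ` {..<r}"
      then obtain j where j: "j < r" "x = free_gen j" by blast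
      have "nc_nth (lead 1 (\<phi> x)) w = nc_nth (nc_act ?A (lead 1 x)) w" if w: "set w \<subseteq> {..<r}" for w
      proof (cases "length w = 1")
        case True
        then obtain i where i: "w = [i]" by (cases w) auto
        then have "(\<Sum>y<r. ?A $$ (i, y) * nc_nth (nc_var j) [y]) = (\<Sum>y<r. if y = j then ?A $$ (i, j) else 0)"
          by (intro sum.cong) (auto simp: nc_var.rep_eq)
        then show ?thesis
          using i w j lead_gen[OF j(1)] by (simp add: nc_act_rep endo_matrix_def)
      next
        case False
        then show ?thesis
          using nc_nth_lead_length[of _ 1] by (simp add: nc_act_rep nc_actf_eq_0)
      qed
      then show "x \<in> ?T" using j free_gen_closed by blast
    qed
    ultimately have "generate FR (free_gen ` {..<r}) \<subseteq> ?T"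
      by (intro F.generate_subgroup_incl)
    then have "carrier FR \<subseteq> ?T" using F.carrier_gen by blast
    then show ?thesis using that by auto
  qed
  show "g \<in> F.LC k \<Longrightarrow> set w \<subseteq> {..<r} \<Longrightarrow>
    nc_nth (lead k (\<phi> g)) w = nc_nth (nc_act ?A (lead k g)) w"
    using assms(2)
  proof (induction k arbitrary: g w rule: dec_induct)
    case base
    then show ?case using base1 by simp
  next
    case (step k)
    have "\<forall>w. set w \<subseteq> {..<r} \<longrightarrow> nc_nth (lead (Suc k) (\<phi> g)) w = nc_nth (nc_act ?A (lead (Suc k) g)) w"
      using step.prems(1) step.hyps(1)
    proof (induction rule: F.lower_central_Suc_induct)
      case one
      then show ?case by (simp add: lead_one nc_act_0)
    next
      case (incl x y)
      have xc: "x \<in> carrier FR" using incl F.lower_central_carrier by blast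
      have "\<phi> (F.cm x y) = F.cm (\<phi> x) (\<phi> y)"
        using xc incl by (simp add: group_comm_def)
      then have 1: "lead (Suc k) (\<phi> (F.cm x y)) =
          lead k (\<phi> x) * lead 1 (\<phi> y) - lead 1 (\<phi> y) * lead k (\<phi> x)"
        using lead_comm[of k 1 "\<phi> x" "\<phi> y"] step.hyps(1) hLC[OF incl(1)] incl(2) by simp
      have 2: "lead (Suc k) (F.cm x y) = lead k x * lead 1 y - lead 1 y * lead k x"
        using lead_comm[of k 1 x y] step.hyps(1) incl by simp
      have y: "nc_nth (lead 1 (\<phi> y)) v = nc_nth (nc_act ?A (lead 1 y)) v" if "set v \<subseteq> {..<r}" for v
        using base1[of y v] incl(2) that by simp
      have x: "nc_nth (lead k (\<phi> x)) v = nc_nth (nc_act ?A (lead k x)) v" if "set v \<subseteq> {..<r}" for v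
        using step.IH[OF incl(1) that] .
      show ?case
        unfolding 1 2 nc_act_diff nc_act_mult minus_ncps.rep_eq
        using nc_nth_mult_cong_letters[OF _ x y] nc_nth_mult_cong_letters[OF _ y x] by auto
    next
      case (inv g)
      have "g \<in> carrier FR" using inv F.lower_central_carrier by blast
      then show ?case using inv hLC by (simp add: lead_inv nc_act_uminus)
    next
      case (mult g h)
      have "g \<in> carrier FR" "h \<in> carrier FR" using mult F.lower_central_carrier by blast+
      then show ?case using mult hLC by (simp add: lead_mult nc_act_add)
    qed
    then show ?case using step.prems by blast
  qed
qed

text \<open>Defined for an arbitrary matrix \<open>A\<close>, with or without an endomorphism behind
  it. Column \<open>j\<close> records only the Lyndon coefficients of a transformed leading term;
  they describe it completely when it is again a leading term.\<close>

definition graded_matrix :: "nat \<Rightarrow> int mat \<Rightarrow> int mat" where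
  "graded_matrix k A = mat (lyndon_rank k) (lyndon_rank k)
     (\<lambda>(i, j). nc_nth (nc_act A (lead k (lyndon_dual k j))) (lyndon_list k ! i))"

lemma graded_matrix_carrier: "graded_matrix k A \<in> carrier_mat (lyndon_rank k) (lyndon_rank k)"
  by (simp add: graded_matrix_def)

lemma nc_act_expansion:
  assumes "k \<ge> 1" "g \<in> F.LC k" "i < lyndon_rank k"
  shows "nc_nth (nc_act A (lead k g)) (lyndon_list k ! i) = (graded_matrix k A *\<^sub>v lyndon_coord k g) $ i"
proof -
  have "nc_nth (lead k g) = (\<lambda>w. \<Sum>j<lyndon_rank k. lyndon_coord k g $ j * nc_nth (lead k (lyndon_dual k j)) w)"
    using lead_expansion[OF assms(1,2)] by blast
  then have "nc_nth (nc_act A (lead k g)) (lyndon_list k ! i) =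
      (\<Sum>j<lyndon_rank k. lyndon_coord k g $ j * nc_nth (nc_act A (lead k (lyndon_dual k j))) (lyndon_list k ! i))"
    by (simp add: nc_act_rep nc_actf_sum)
  then show ?thesis
    using assms(3) by (simp add: graded_matrix_def scalar_prod_def lyndon_coord_def lessThan_atLeast0 mult.commute)
qed

lemma lyndon_coord_endo:
  assumes "\<phi> \<in> hom FR FR" "k \<ge> 1" "g \<in> F.LC k"
  shows "lyndon_coord k (\<phi> g) = graded_matrix k (endo_matrix \<phi>) *\<^sub>v lyndon_coord k g"
proof (rule eq_vecI)
  fix i assume "i < dim_vec (graded_matrix k (endo_matrix \<phi>) *\<^sub>v lyndon_coord k g)"
  then have i: "i < lyndon_rank k" by (simp add: graded_matrix_def)
  then show "lyndon_coord k (\<phi> g) $ i = (graded_matrix k (endo_matrix \<phi>) *\<^sub>v lyndon_coord k g) $ i"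
    using lead_endo[OF assms lyndon_list_letters[OF i]] nc_act_expansion[OF assms(2,3) i]
    by (simp add: lyndon_coord_def[of k "\<phi> g"] del: index_mult_mat_vec)
qed (simp add: lyndon_coord_def graded_matrix_def)

text \<open>Freeness allows any choice of images of the generators, and \<open>lead_surj\<close> in
  degree 1 finds images with prescribed exponent sums.\<close>

lemma endo_with_matrix:
  assumes "B \<in> carrier_mat r r"
  shows "\<exists>\<phi>\<in>hom FR FR. endo_matrix \<phi> = B"
proof -
  have "\<exists>g\<in>carrier FR. \<forall>w\<in>F.lyndon_words 1. nc_nth (lead 1 g) w = B $$ (hd w, j)" for j
    using lead_surj[of 1 "\<lambda>w. B $$ (hd w, j)"] by simp
  then obtain g where g: "\<And>j. g j \<in> carrier FR"
    "\<And>j w. w \<in> F.lyndon_words 1 \<Longrightarrow> nc_nth (lead 1 (g j)) w = B $$ (hd w, j)"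
    by metis
  obtain \<phi> where \<phi>: "\<phi> \<in> hom FR FR" "\<forall>j<r. \<phi> (free_gen j) = g j"
    using free_group_extend[OF F.is_group, of g r] g(1) by (auto simp: free_gen_def)
  have "endo_matrix \<phi> = B"
    using assms \<phi>(2) g(2) by (intro eq_matI) (auto simp: endo_matrix_def F.lyndon_words_def lyndon_single)
  then show ?thesis using \<phi>(1) by blast
qed

text \<open>After applying \<open>B\<close>, the coefficients at all words matter, not only the
  Lyndon ones. Realizing \<open>B\<close> by an endomorphism shows that the result is again a
  leading term, hence determined by its Lyndon coefficients.\<close>

lemma graded_matrix_mult:
  assumes "k \<ge> 1" and A: "A \<in> carrier_mat r r" and B: "B \<in> carrier_mat r r"
  shows "graded_matrix k (A * B) = graded_matrix k A * graded_matrix k B"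
proof (rule eq_matI)
  fix i j assume "i < dim_row (graded_matrix k A * graded_matrix k B)" "j < dim_col (graded_matrix k A * graded_matrix k B)"
  then have ij: "i < lyndon_rank k" "j < lyndon_rank k" by (simp_all add: graded_matrix_def)
  let ?w = "lyndon_list k ! i" and ?d = "lyndon_dual k j"
  obtain \<phi> where \<phi>: "\<phi> \<in> hom FR FR" "endo_matrix \<phi> = B"
    using endo_with_matrix[OF B] by blast
  have d: "?d \<in> F.LC k" using lyndon_dual assms by blast
  have \<phi>d: "\<phi> ?d \<in> F.LC k" using F.lower_central_hom[OF \<phi>(1) d] .
  have col: "lyndon_coord k (\<phi> ?d) = col (graded_matrix k B) j"
    using lyndon_coord_endo[OF \<phi>(1) assms(1) d] lyndon_dual(2)[OF assms(1)] \<phi>(2) ij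
      by (intro eq_vecI) (auto simp: graded_matrix_def)
  have "graded_matrix k (A * B) $$ (i, j) = nc_actf (A * B) (nc_nth (lead k ?d)) ?w"
    using ij by (simp add: graded_matrix_def nc_act_rep)
  also have "\<dots> = nc_actf A (nc_actf B (nc_nth (lead k ?d))) ?w"
    by (rule nc_actf_mult[OF A B lyndon_list_letters[OF ij(1)]])
  also have "\<dots> = nc_actf A (nc_nth (lead k (\<phi> ?d))) ?w"
    using lead_endo[OF \<phi>(1) assms(1) d] \<phi>(2)
    by (intro nc_actf_cong_letters[OF A lyndon_list_letters[OF ij(1)]]) (simp add: nc_act_rep)
  also have "\<dots> = (graded_matrix k A *\<^sub>v lyndon_coord k (\<phi> ?d)) $ i"
    using nc_act_expansion[OF assms(1) \<phi>d ij(1)] by (simp add: nc_act_rep)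
  also have "\<dots> = (graded_matrix k A * graded_matrix k B) $$ (i, j)"
    unfolding col using ij by (simp add: graded_matrix_def)
  finally show "graded_matrix k (A * B) $$ (i, j) = (graded_matrix k A * graded_matrix k B) $$ (i, j)" .
qed (simp_all add: graded_matrix_def)

lemma graded_matrix_scalar:
  assumes "k \<ge> 1"
  shows "graded_matrix k (c \<cdot>\<^sub>m 1\<^sub>m r) = (c ^ k) \<cdot>\<^sub>m 1\<^sub>m (lyndon_rank k)"
proof (rule eq_matI)
  fix i j assume "i < dim_row ((c ^ k) \<cdot>\<^sub>m 1\<^sub>m (lyndon_rank k) :: int mat)" "j < dim_col ((c ^ k) \<cdot>\<^sub>m 1\<^sub>m (lyndon_rank k) :: int mat)"
  then have ij: "i < lyndon_rank k" "j < lyndon_rank k" by simp_all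
  have "length (lyndon_list k ! i) = k" using lyndon_list_nth[OF ij(1)] by (simp add: F.lyndon_words_def)
  then show "graded_matrix k (c \<cdot>\<^sub>m 1\<^sub>m r) $$ (i, j) = ((c ^ k) \<cdot>\<^sub>m 1\<^sub>m (lyndon_rank k)) $$ (i, j)"
    using ij lead_lyndon_dual[OF assms ij] nc_actf_smult_one[OF lyndon_list_letters[OF ij(1)]]
    by (simp add: graded_matrix_def nc_act_rep)
qed (simp_all add: graded_matrix_def)

lemma graded_matrix_fun_subring:
  assumes "fun_subring S" "\<And>x. B x \<in> carrier_mat r r"
    and "\<And>i j. i < r \<Longrightarrow> j < r \<Longrightarrow> (\<lambda>x. B x $$ (i, j)) \<in> S"
    and ij: "i < lyndon_rank k" "j < lyndon_rank k"
  shows "(\<lambda>x. graded_matrix k (B x) $$ (i, j)) \<in> S"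
  using fun_subring.nc_actf_mem[OF assms(1-3) lyndon_list_letters[OF ij(1)], of "\<lambda>_. nc_nth (lead k (lyndon_dual k j))"]
    fun_subring.const[OF assms(1)] ij by (simp add: graded_matrix_def nc_act_rep)

lemma graded_det_mpoly:
  assumes "r > 0" "k \<ge> 1"
  shows "\<exists>p\<in>mpolys_in {1..r}. \<forall>A\<in>carrier_mat r r.
    det (1\<^sub>m (lyndon_rank k) - graded_matrix k A) = mpoly_eval (\<lambda>i. coeff (char_poly A) (i - 1)) p"
proof (rule det_mpoly_char_poly[OF assms(1), where d = k])
  show "graded_matrix k A \<in> carrier_mat (lyndon_rank k) (lyndon_rank k)" for A
    by (rule graded_matrix_carrier)
  show "graded_matrix k (A * B) = graded_matrix k A * graded_matrix k B"
    if "A \<in> carrier_mat r r" "B \<in> carrier_mat r r" for A B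
    by (rule graded_matrix_mult[OF assms(2) that])
  show "graded_matrix k (c \<cdot>\<^sub>m 1\<^sub>m r) = (c ^ k) \<cdot>\<^sub>m 1\<^sub>m (lyndon_rank k)" for c
    by (rule graded_matrix_scalar[OF assms(2)])
  show "(\<lambda>t. graded_matrix k (B t) $$ (i, j)) \<in> polynomial_functions"
    if "\<And>t. B t \<in> carrier_mat r r" "\<And>i j. i < r \<Longrightarrow> j < r \<Longrightarrow> (\<lambda>t. B t $$ (i, j)) \<in> polynomial_functions"
      "i < lyndon_rank k" "j < lyndon_rank k" for B i j
    by (rule graded_matrix_fun_subring[OF fun_subring_polynomial_functions that])
  show "(\<lambda>t. graded_matrix k (B t) $$ (i, j)) \<in> mpoly_functions {1..r}"
    if "\<And>t. B t \<in> carrier_mat r r" "\<And>i j. i < r \<Longrightarrow> j < r \<Longrightarrow> (\<lambda>t. B t $$ (i, j)) \<in> mpoly_functions {1..r}"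
      "i < lyndon_rank k" "j < lyndon_rank k" for B i j
    by (rule graded_matrix_fun_subring[OF fun_subring_mpoly_functions that])
qed

section \<open>Free nilpotent groups\<close>

context
  fixes c :: nat
  assumes c: "c > 0"
begin

definition nil_proj :: "letter list \<Rightarrow> letter list set" where
  "nil_proj g = lower_central FR (Suc c) #>\<^bsub>FR\<^esub> g"

abbreviation (input) "NG \<equiv> free_nilpotent r c"

interpretation K: normal "F.LC (Suc c)" FR
  by (rule F.normal_lower_central)

lemma group_free_nilpotent: "group NG"
  unfolding free_nilpotent_def using K.factorgroup_is_group by simp

interpretation N: group NG by (rule group_free_nilpotent)

interpretation proj: group_hom FR NG nil_proj
proof -
  have "nil_proj \<in> hom FR NG"
    using K.r_coset_hom_Mod unfolding nil_proj_def[abs_def] free_nilpotent_def by simp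
  then show "group_hom FR NG nil_proj"
    using F.is_group N.is_group by (auto simp: group_hom_def group_hom_axioms_def)
qed

lemma nil_proj_surj: "nil_proj ` carrier FR = carrier NG"
  unfolding nil_proj_def[abs_def] free_nilpotent_def carrier_FactGroup by simp

lemma nil_proj_eq_iff:
  assumes "g \<in> carrier FR" "h \<in> carrier FR"
  shows "nil_proj g = nil_proj h \<longleftrightarrow> g \<otimes>\<^bsub>FR\<^esub> inv\<^bsub>FR\<^esub> h \<in> F.LC (Suc c)"
  unfolding nil_proj_def by (rule F.r_coset_eq_iff[OF F.subgroup_lower_central assms])

section \<open>The abelianization of the free nilpotent group\<close>

abbreviation (input) "G2 \<equiv> lower_central NG 2"
abbreviation (input) "AB \<equiv> NG Mod G2"

interpretation K2: normal G2 NG by (rule N.normal_lower_central)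

definition ab_proj :: "letter list \<Rightarrow> letter list set set" where
  "ab_proj g = G2 #>\<^bsub>NG\<^esub> nil_proj g"

text \<open>As \<open>c\<close> is positive, the kernel of \<open>nil_proj\<close> is contained in
  the second term, so membership in that term can be tested on representatives.\<close>

lemma nil_proj_lower_central_2:
  assumes "g \<in> carrier FR"
  shows "nil_proj g \<in> G2 \<longleftrightarrow> g \<in> F.LC 2"
proof
  have G2: "G2 = nil_proj ` F.LC 2"
    by (rule lower_central_surj_image[OF proj.group_hom_axioms nil_proj_surj])
  assume "nil_proj g \<in> G2"
  then obtain h where h: "h \<in> F.LC 2" "nil_proj g = nil_proj h" using G2 by auto
  have hc: "h \<in> carrier FR" using h F.lower_central_carrier by blast
  have "g \<otimes>\<^bsub>FR\<^esub> inv\<^bsub>FR\<^esub> h \<in> F.LC 2"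
    using nil_proj_eq_iff[OF assms hc] h(2) F.lower_central_antimono[of 2 "Suc c"] c by auto
  then have "(g \<otimes>\<^bsub>FR\<^esub> inv\<^bsub>FR\<^esub> h) \<otimes>\<^bsub>FR\<^esub> h \<in> F.LC 2"
    using subgroup.m_closed[OF F.subgroup_lower_central] h(1) by blast
  then show "g \<in> F.LC 2" using assms hc by (simp add: F.m_assoc)
next
  assume "g \<in> F.LC 2"
  then show "nil_proj g \<in> G2"
    using lower_central_surj_image[OF proj.group_hom_axioms nil_proj_surj] by blast
qed

lemma ab_proj_hom: "ab_proj \<in> hom FR AB"
proof -
  have "(\<lambda>x. G2 #>\<^bsub>NG\<^esub> x) \<in> hom NG AB" by (rule K2.r_coset_hom_Mod)
  then show ?thesis
    unfolding ab_proj_def[abs_def] using proj.homh by (auto simp: hom_def Pi_iff)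
qed

lemma ab_proj_surj: "ab_proj ` carrier FR = carrier AB"
  unfolding ab_proj_def[abs_def] carrier_FactGroup nil_proj_surj[symmetric] by (simp add: image_image)

lemma ab_proj_eq_iff:
  assumes "g \<in> carrier FR" "h \<in> carrier FR"
  shows "ab_proj g = ab_proj h \<longleftrightarrow> g \<otimes>\<^bsub>FR\<^esub> inv\<^bsub>FR\<^esub> h \<in> F.LC 2"
proof -
  have "ab_proj g = ab_proj h \<longleftrightarrow> nil_proj g \<otimes>\<^bsub>NG\<^esub> inv\<^bsub>NG\<^esub> nil_proj h \<in> G2"
    unfolding ab_proj_def by (rule N.r_coset_eq_iff[OF N.subgroup_lower_central]) (use assms in auto)
  also have "nil_proj g \<otimes>\<^bsub>NG\<^esub> inv\<^bsub>NG\<^esub> nil_proj h = nil_proj (g \<otimes>\<^bsub>FR\<^esub> inv\<^bsub>FR\<^esub> h)"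
    using assms by simp
  finally show ?thesis
    using nil_proj_lower_central_2[of "g \<otimes>\<^bsub>FR\<^esub> inv\<^bsub>FR\<^esub> h"] assms
    by (metis F.m_closed F.inv_closed)
qed

lemma comm_group_ab: "comm_group AB"
proof (rule group.group_comm_groupI)
  show "group AB" by (rule K2.factorgroup_is_group)
  fix x y assume "x \<in> carrier AB" "y \<in> carrier AB"
  then obtain g h where g: "g \<in> carrier FR" "x = ab_proj g"
    and h: "h \<in> carrier FR" "y = ab_proj h"
    using ab_proj_surj by (metis imageE)
  have "(g \<otimes>\<^bsub>FR\<^esub> h) \<otimes>\<^bsub>FR\<^esub> inv\<^bsub>FR\<^esub> (h \<otimes>\<^bsub>FR\<^esub> g) = F.cm g h"
    using g h by (simp add: group_comm_def F.m_assoc F.inv_mult_group)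
  moreover have "F.cm g h \<in> F.LC 2"
    using F.comm_mem_lower_central_Suc[of g 1 h] g h by (simp add: numeral_2_eq_2)
  ultimately have "ab_proj (g \<otimes>\<^bsub>FR\<^esub> h) = ab_proj (h \<otimes>\<^bsub>FR\<^esub> g)"
    using ab_proj_eq_iff g h by simp
  then show "x \<otimes>\<^bsub>AB\<^esub> y = y \<otimes>\<^bsub>AB\<^esub> x"
    using hom_mult[OF ab_proj_hom] g h by metis
qed

interpretation AB: comm_group AB by (rule comm_group_ab)

interpretation ab: group_hom FR AB ab_proj
  using F.is_group AB.is_group ab_proj_hom by (auto simp: group_hom_def group_hom_axioms_def)

definition ab_basis :: "nat \<Rightarrow> letter list set set" where
  "ab_basis i = ab_proj (free_gen i)"

lemma ab_basis_closed: "ab_basis \<in> {..<r} \<rightarrow> carrier AB"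
  using free_gen_closed by (auto simp: ab_basis_def)

text \<open>The Lyndon words of length 1 are the single letters, so this is the kernel statement in
  degree 1: the commutator subgroup consists of the elements with all exponent sums zero.\<close>

lemma lead_1_LC_2:
  assumes "g \<in> carrier FR"
  shows "g \<in> F.LC 2 \<longleftrightarrow> (\<forall>i<r. nc_nth (lead 1 g) [i] = 0)"
proof
  assume "g \<in> F.LC 2"
  then show "\<forall>i<r. nc_nth (lead 1 g) [i] = 0" using lead_Suc[of g 1] by (simp add: numeral_2_eq_2)
next
  assume *: "\<forall>i<r. nc_nth (lead 1 g) [i] = 0"
  have "nc_nth (lead 1 g) w = 0" if "w \<in> F.lyndon_words 1" for w
    using that * by (cases w) (auto simp: F.lyndon_words_def)
  then have "g \<in> F.LC (Suc 1)" using lead_kernel[of 1 g] assms by simp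
  then show "g \<in> F.LC 2" by (simp add: numeral_2_eq_2)
qed

lemma ab_proj_eq_lead:
  assumes "g \<in> carrier FR" "h \<in> carrier FR"
  shows "ab_proj g = ab_proj h \<longleftrightarrow> (\<forall>i<r. nc_nth (lead 1 g) [i] = nc_nth (lead 1 h) [i])"
proof -
  have "lead 1 (g \<otimes>\<^bsub>FR\<^esub> inv\<^bsub>FR\<^esub> h) = lead 1 g - lead 1 h"
    using assms by (simp add: lead_mult lead_inv)
  then show ?thesis using ab_proj_eq_iff[OF assms] lead_1_LC_2 assms by simp
qed

lemma int_comb_ab_basis_aux:
  assumes "n \<le> r"
  shows "\<exists>g\<in>carrier FR. AB.int_comb ab_basis n k = ab_proj g \<and>
    (\<forall>i. nc_nth (lead 1 g) [i] = (if i < n then k i else 0))"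
  using assms
proof (induction n)
  case 0
  then show ?case
    by (intro bexI[of _ "\<one>\<^bsub>FR\<^esub>"]) (simp_all add: AB.int_comb_def lead_one)
next
  case (Suc n)
  then obtain g where g: "g \<in> carrier FR" "AB.int_comb ab_basis n k = ab_proj g"
    "\<And>i. nc_nth (lead 1 g) [i] = (if i < n then k i else 0)" by auto
  let ?x = "free_gen n [^]\<^bsub>FR\<^esub> k n"
  have n: "free_gen n \<in> carrier FR" using free_gen_closed Suc.prems by simp
  then have x: "?x \<in> carrier FR" by simp
  have lx: "nc_nth (lead 1 ?x) [i] = (if i = n then k n else 0)" for i
    using lead_int_pow[of 1 "free_gen n" "k n" "[i]"] n lead_gen[of n] Suc.prems
    by (simp add: nc_var.rep_eq)
  have cl: "(\<lambda>i. ab_basis i [^]\<^bsub>AB\<^esub> k i) \<in> {..<n} \<rightarrow> carrier AB"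
    using ab_basis_closed Suc.prems by auto
  have "AB.int_comb ab_basis (Suc n) k = ab_basis n [^]\<^bsub>AB\<^esub> k n \<otimes>\<^bsub>AB\<^esub> AB.int_comb ab_basis n k"
    using cl ab_basis_closed Suc.prems by (simp add: AB.int_comb_def lessThan_Suc Pi_iff)
  also have "\<dots> = ab_proj (?x \<otimes>\<^bsub>FR\<^esub> g)"
    unfolding g(2) ab_basis_def using n x g(1) by (simp add: ab.hom_int_pow)
  finally have "AB.int_comb ab_basis (Suc n) k = ab_proj (?x \<otimes>\<^bsub>FR\<^esub> g)" .
  moreover have "nc_nth (lead 1 (?x \<otimes>\<^bsub>FR\<^esub> g)) [i] = (if i < Suc n then k i else 0)" for i
    using lead_mult[of 1 ?x g] x g(1) lx[of i] g(3)[of i] by (auto simp: less_Suc_eq)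
  ultimately show ?case using x g(1) by blast
qed

lemma int_comb_ab_basis:
  assumes "g \<in> carrier FR"
  shows "ab_proj g = AB.int_comb ab_basis r k \<longleftrightarrow> (\<forall>i<r. nc_nth (lead 1 g) [i] = k i)"
proof -
  obtain h where h: "h \<in> carrier FR" "AB.int_comb ab_basis r k = ab_proj h"
    "\<And>i. nc_nth (lead 1 h) [i] = (if i < r then k i else 0)"
    using int_comb_ab_basis_aux[of r k] by auto
  show ?thesis using ab_proj_eq_lead[OF assms h(1)] h(2,3) by auto
qed

lemma Z_basis_ab: "Z_basis AB r ab_basis"
  unfolding Z_basis_def
proof (intro conjI ballI)
  show "ab_basis \<in> {..<r} \<rightarrow> carrier AB" by (rule ab_basis_closed)
  fix x assume "x \<in> carrier AB"
  then obtain g where g: "g \<in> carrier FR" "x = ab_proj g" using ab_proj_surj by (metis imageE)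
  define k where "k = restrict (\<lambda>i. nc_nth (lead 1 g) [i]) {..<r}"
  show "\<exists>!k :: nat \<Rightarrow> int. k \<in> extensional {..<r} \<and> x = finprod AB (\<lambda>i. ab_basis i [^]\<^bsub>AB\<^esub> k i) {..<r}"
  proof (rule ex1I[of _ k])
    have "ab_proj g = AB.int_comb ab_basis r k" using int_comb_ab_basis[OF g(1)] by (simp add: k_def)
    then show "k \<in> extensional {..<r} \<and> x = finprod AB (\<lambda>i. ab_basis i [^]\<^bsub>AB\<^esub> k i) {..<r}"
      using g(2) by (simp add: AB.int_comb_def k_def)
    fix l :: "nat \<Rightarrow> int" assume l: "l \<in> extensional {..<r} \<and> x = finprod AB (\<lambda>i. ab_basis i [^]\<^bsub>AB\<^esub> l i) {..<r}"
    then have "ab_proj g = AB.int_comb ab_basis r l" using g(2) by (simp add: AB.int_comb_def)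
    then have "\<forall>i<r. nc_nth (lead 1 g) [i] = l i" using int_comb_ab_basis[OF g(1)] by blast
    then show "l = k" using l unfolding k_def by (intro extensionalityI[of _ "{..<r}"]) auto
  qed
qed

context
  fixes \<phi> :: "letter list set \<Rightarrow> letter list set"
  assumes \<phi>: "\<phi> \<in> hom NG NG"
begin

text \<open>Freeness allows preimages of the images of the generators to be chosen at will; the two
  maps then agree on a subgroup containing the generators.\<close>

lemma free_lift:
  "\<exists>\<Phi>\<in>hom FR FR. \<forall>g\<in>carrier FR. \<phi> (nil_proj g) = nil_proj (\<Phi> g)"
proof -
  interpret h: group_hom NG NG \<phi> using \<phi> N.is_group by (auto simp: group_hom_def group_hom_axioms_def)
  have "\<exists>g\<in>carrier FR. nil_proj g = \<phi> (nil_proj (free_gen i))" if "i < r" for i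
  proof -
    have "\<phi> (nil_proj (free_gen i)) \<in> nil_proj ` carrier FR"
      unfolding nil_proj_surj using free_gen_closed[OF that] by simp
    then show ?thesis by (metis imageE)
  qed
  then obtain f where f: "\<And>i. i < r \<Longrightarrow> f i \<in> carrier FR"
    "\<And>i. i < r \<Longrightarrow> nil_proj (f i) = \<phi> (nil_proj (free_gen i))" by metis
  obtain \<Phi> where \<Phi>: "\<Phi> \<in> hom FR FR" "\<forall>i<r. \<Phi> (free_gen i) = f i"
    using free_group_extend[OF F.is_group, of f r] f(1) by (auto simp: free_gen_def)
  interpret L: group_hom FR FR \<Phi>
    using \<Phi> F.is_group by (auto simp: group_hom_def group_hom_axioms_def)
  let ?T = "{g \<in> carrier FR. \<phi> (nil_proj g) = nil_proj (\<Phi> g)}"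
  have "subgroup ?T FR" by (rule F.subgroup_induct_of) auto
  moreover have "free_gen ` {..<r} \<subseteq> ?T" using f \<Phi>(2) free_gen_closed by auto
  ultimately have "generate FR (free_gen ` {..<r}) \<subseteq> ?T"
    by (intro F.generate_subgroup_incl)
  then have "carrier FR \<subseteq> ?T" using F.carrier_gen by blast
  then show ?thesis using \<Phi>(1) by blast
qed

context
  fixes \<Phi> :: "letter list \<Rightarrow> letter list"
  assumes \<Phi>: "\<Phi> \<in> hom FR FR"
    and lift: "\<And>g. g \<in> carrier FR \<Longrightarrow> \<phi> (nil_proj g) = nil_proj (\<Phi> g)"
begin

interpretation L: group_endo FR \<Phi>
  using \<Phi> F.is_group by (auto simp: group_endo_def group_endo_axioms_def)

text \<open>\<open>induced_map\<close> multiplies by the subgroup on the right whereas cosets here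
  are right cosets; normality moves the factor \<open>v\<close> across the representative.\<close>

lemma induced_map_ab_proj:
  assumes g: "g \<in> carrier FR"
  shows "induced_map NG G2 \<phi> (ab_proj g) = ab_proj (\<Phi> g)"
proof -
  interpret h: group_hom NG NG \<phi> using \<phi> N.is_group by (auto simp: group_hom_def group_hom_axioms_def)
  have pg: "nil_proj g \<in> carrier NG" "nil_proj (\<Phi> g) \<in> carrier NG" using g by simp_all
  have \<phi>G2: "\<phi> u \<in> G2" if "u \<in> G2" for u using N.lower_central_hom[OF \<phi> that] .
  have G2c: "u \<in> carrier NG" if "u \<in> G2" for u using that by (rule N.lower_central_carrier)
  let ?y = "nil_proj (\<Phi> g)"
  have "induced_map NG G2 \<phi> (ab_proj g) =
      {\<phi> (u \<otimes>\<^bsub>NG\<^esub> nil_proj g) \<otimes>\<^bsub>NG\<^esub> v |u v. u \<in> G2 \<and> v \<in> G2}"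
    unfolding induced_map_def ab_proj_def set_mult_def r_coset_def by auto
  also have "\<dots> = {\<phi> u \<otimes>\<^bsub>NG\<^esub> ?y \<otimes>\<^bsub>NG\<^esub> v |u v. u \<in> G2 \<and> v \<in> G2}"
  proof -
    have "\<phi> (u \<otimes>\<^bsub>NG\<^esub> nil_proj g) = \<phi> u \<otimes>\<^bsub>NG\<^esub> ?y" if "u \<in> G2" for u
      using lift[OF g] pg(1) G2c[OF that] by simp
    then show ?thesis by (intro Collect_cong) metis
  qed
  also have "\<dots> = {w \<otimes>\<^bsub>NG\<^esub> ?y |w. w \<in> G2}"
  proof (intro equalityI subsetI)
    fix x assume "x \<in> {\<phi> u \<otimes>\<^bsub>NG\<^esub> ?y \<otimes>\<^bsub>NG\<^esub> v |u v. u \<in> G2 \<and> v \<in> G2}"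
    then obtain u v where uv: "u \<in> G2" "v \<in> G2" "x = \<phi> u \<otimes>\<^bsub>NG\<^esub> ?y \<otimes>\<^bsub>NG\<^esub> v" by blast
    have w: "\<phi> u \<otimes>\<^bsub>NG\<^esub> (?y \<otimes>\<^bsub>NG\<^esub> v \<otimes>\<^bsub>NG\<^esub> inv\<^bsub>NG\<^esub> ?y) \<in> G2"
      using \<phi>G2[OF uv(1)] N.lower_central_conj[OF uv(2) pg(2)] by (rule K2.m_closed)
    have "x = (\<phi> u \<otimes>\<^bsub>NG\<^esub> (?y \<otimes>\<^bsub>NG\<^esub> v \<otimes>\<^bsub>NG\<^esub> inv\<^bsub>NG\<^esub> ?y)) \<otimes>\<^bsub>NG\<^esub> ?y"
      using uv G2c pg by (simp add: N.m_assoc)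
    then show "x \<in> {w \<otimes>\<^bsub>NG\<^esub> ?y |w. w \<in> G2}" using w by blast
  next
    fix x assume "x \<in> {w \<otimes>\<^bsub>NG\<^esub> ?y |w. w \<in> G2}"
    then obtain w where w: "w \<in> G2" "x = w \<otimes>\<^bsub>NG\<^esub> ?y" by blast
    have "inv\<^bsub>NG\<^esub> ?y \<otimes>\<^bsub>NG\<^esub> w \<otimes>\<^bsub>NG\<^esub> ?y \<in> G2" using N.lower_central_conj'[OF w(1) pg(2)] .
    moreover have "x = \<phi> \<one>\<^bsub>NG\<^esub> \<otimes>\<^bsub>NG\<^esub> ?y \<otimes>\<^bsub>NG\<^esub> (inv\<^bsub>NG\<^esub> ?y \<otimes>\<^bsub>NG\<^esub> w \<otimes>\<^bsub>NG\<^esub> ?y)"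
      using w G2c pg by (simp add: N.m_assoc)
    ultimately show "x \<in> {\<phi> u \<otimes>\<^bsub>NG\<^esub> ?y \<otimes>\<^bsub>NG\<^esub> v |u v. u \<in> G2 \<and> v \<in> G2}"
      using K2.one_closed by blast
  qed
  also have "\<dots> = ab_proj (\<Phi> g)" unfolding ab_proj_def r_coset_def by auto
  finally show ?thesis .
qed

lemma induced_map_hom: "induced_map NG G2 \<phi> \<in> hom AB AB"
proof (rule homI)
  fix x assume "x \<in> carrier AB"
  then obtain g where g: "g \<in> carrier FR" "x = ab_proj g" using ab_proj_surj by (metis imageE)
  then show "induced_map NG G2 \<phi> x \<in> carrier AB" by (simp add: induced_map_ab_proj del: carrier_FactGroup)
next
  fix x y assume "x \<in> carrier AB" "y \<in> carrier AB"
  then obtain g h where g: "g \<in> carrier FR" "x = ab_proj g"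
    and h: "h \<in> carrier FR" "y = ab_proj h"
    using ab_proj_surj by (metis imageE)
  have "x \<otimes>\<^bsub>AB\<^esub> y = ab_proj (g \<otimes>\<^bsub>FR\<^esub> h)"
    unfolding g(2) h(2) by (rule hom_mult[OF ab_proj_hom g(1) h(1), symmetric])
  then have "induced_map NG G2 \<phi> (x \<otimes>\<^bsub>AB\<^esub> y) = ab_proj (\<Phi> (g \<otimes>\<^bsub>FR\<^esub> h))"
    using induced_map_ab_proj[OF F.m_closed[OF g(1) h(1)]] by (simp only:)
  also have "\<dots> = ab_proj (\<Phi> g) \<otimes>\<^bsub>AB\<^esub> ab_proj (\<Phi> h)"
    unfolding L.endo_mult[OF g(1) h(1)]
    by (rule hom_mult[OF ab_proj_hom L.endo_closed[OF g(1)] L.endo_closed[OF h(1)]])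
  also have "\<dots> = induced_map NG G2 \<phi> x \<otimes>\<^bsub>AB\<^esub> induced_map NG G2 \<phi> y"
    unfolding g(2) h(2) induced_map_ab_proj[OF g(1)] induced_map_ab_proj[OF h(1)] ..
  finally show "induced_map NG G2 \<phi> (x \<otimes>\<^bsub>AB\<^esub> y) = induced_map NG G2 \<phi> x \<otimes>\<^bsub>AB\<^esub> induced_map NG G2 \<phi> y" .
qed

lemma endo_char_poly_induced:
  "endo_char_poly AB r (induced_map NG G2 \<phi>) = char_poly (endo_matrix \<Phi>)"
proof (rule AB.endo_char_poly_eq[OF Z_basis_ab endo_matrix_carrier induced_map_hom])
  fix j assume j: "j < r"
  have "\<forall>i<r. nc_nth (lead 1 (\<Phi> (free_gen j))) [i] = endo_matrix \<Phi> $$ (i, j)"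
    using j by (simp add: endo_matrix_def)
  then have "ab_proj (\<Phi> (free_gen j)) = AB.int_comb ab_basis r (\<lambda>i. endo_matrix \<Phi> $$ (i, j))"
    using int_comb_ab_basis free_gen_closed[OF j] by simp
  then show "induced_map NG G2 \<phi> (ab_basis j) = AB.int_comb ab_basis r (\<lambda>i. endo_matrix \<Phi> $$ (i, j))"
    using induced_map_ab_proj[OF free_gen_closed[OF j]] by (simp add: ab_basis_def)
qed

text \<open>Carries the count back to the free group, where conjugating elements and representatives
  can be chosen without cosets.\<close>

lemma twisted_conj_nil_proj:
  assumes "x \<in> carrier FR" "y \<in> carrier FR"
  shows "(nil_proj x, nil_proj y) \<in> twisted_conj NG \<phi> \<longleftrightarrow> L.twisted_cong (Suc c) x y"
proof -
  have eq: "nil_proj z \<otimes>\<^bsub>NG\<^esub> nil_proj y \<otimes>\<^bsub>NG\<^esub> inv\<^bsub>NG\<^esub> \<phi> (nil_proj z) =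
      nil_proj (z \<otimes>\<^bsub>FR\<^esub> y \<otimes>\<^bsub>FR\<^esub> inv\<^bsub>FR\<^esub> \<Phi> z)"
    if "z \<in> carrier FR" for z
    using that assms by (simp add: lift)
  have iff: "nil_proj x = nil_proj z \<otimes>\<^bsub>NG\<^esub> nil_proj y \<otimes>\<^bsub>NG\<^esub> inv\<^bsub>NG\<^esub> \<phi> (nil_proj z) \<longleftrightarrow>
      L.lc_cong (Suc c) x (z \<otimes>\<^bsub>FR\<^esub> y \<otimes>\<^bsub>FR\<^esub> inv\<^bsub>FR\<^esub> \<Phi> z)"
    if "z \<in> carrier FR" for z
    unfolding eq[OF that] L.lc_cong_def by (rule nil_proj_eq_iff) (use that assms in auto)
  have "(nil_proj x, nil_proj y) \<in> twisted_conj NG \<phi> \<longleftrightarrow>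
      (\<exists>z\<in>carrier FR. nil_proj x = nil_proj z \<otimes>\<^bsub>NG\<^esub> nil_proj y \<otimes>\<^bsub>NG\<^esub> inv\<^bsub>NG\<^esub> \<phi> (nil_proj z))"
    unfolding twisted_conj_def nil_proj_surj[symmetric] using assms by auto
  also have "\<dots> \<longleftrightarrow> L.twisted_cong (Suc c) x y"
    unfolding L.twisted_cong_def by (intro bex_cong refl iff)
  finally show ?thesis .
qed

lemma lyndon_lc_coordinates:
  assumes "k \<ge> 1"
  shows "L.lc_coordinates k (lyndon_rank k) (lyndon_coord k) (graded_matrix k (endo_matrix \<Phi>))"
  unfolding L.lc_coordinates_def
proof (intro conjI ballI impI)
  show "graded_matrix k (endo_matrix \<Phi>) \<in> carrier_mat (lyndon_rank k) (lyndon_rank k)"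
    by (rule graded_matrix_carrier)
  show "lyndon_coord k ` F.LC k = carrier_vec (lyndon_rank k)"
  proof
    show "lyndon_coord k ` F.LC k \<subseteq> carrier_vec (lyndon_rank k)" by (auto simp: lyndon_coord_def)
    show "carrier_vec (lyndon_rank k) \<subseteq> lyndon_coord k ` F.LC k"
      using lyndon_coord_surj[OF assms] by blast
  qed
next
  fix x y assume "x \<in> F.LC k" "y \<in> F.LC k"
  then show "lyndon_coord k (x \<otimes>\<^bsub>FR\<^esub> y) = lyndon_coord k x + lyndon_coord k y"
    using lead_mult[OF assms] by (intro eq_vecI) (auto simp: lyndon_coord_def)
next
  fix x assume "x \<in> F.LC k" "lyndon_coord k x = 0\<^sub>v (lyndon_rank k)"
  then show "x \<in> F.LC (Suc k)" by (rule lyndon_coord_0[OF assms])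
next
  fix x assume "x \<in> F.LC (Suc k)"
  then show "lyndon_coord k x = 0\<^sub>v (lyndon_rank k)"
    by (intro eq_vecI) (auto simp: lyndon_coord_def lead_Suc)
next
  fix x assume "x \<in> F.LC k"
  then show "lyndon_coord k (\<Phi> x) = graded_matrix k (endo_matrix \<Phi>) *\<^sub>v lyndon_coord k x"
    by (rule lyndon_coord_endo[OF \<Phi> assms])
qed

lemma reidemeister_number_prod_det:
  "reidemeister_number NG \<phi> =
    abs_infty (\<Prod>k=1..c. det (1\<^sub>m (lyndon_rank k) - graded_matrix k (endo_matrix \<Phi>)))"
proof -
  let ?d = "\<lambda>k. det (1\<^sub>m (lyndon_rank k) - graded_matrix k (endo_matrix \<Phi>))"
  have sep: "s = t" if "L.twisted_separated (Suc c) S" "s \<in> S" "t \<in> S"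
    "(nil_proj s, nil_proj t) \<in> twisted_conj NG \<phi>" for S s t
  proof -
    have "s \<in> carrier FR" "t \<in> carrier FR"
      using that by (auto simp: L.twisted_separated_def)
    then show ?thesis using that twisted_conj_nil_proj unfolding L.twisted_separated_def by blast
  qed
  have cl: "nil_proj s \<in> carrier NG" if "L.twisted_separated (Suc c) S" "s \<in> S" for S s
    using that by (auto simp: L.twisted_separated_def)
  show ?thesis
  proof (cases "\<exists>k. 1 \<le> k \<and> k \<le> c \<and> ?d k = 0")
    case True
    then have "(\<Prod>k=1..c. ?d k) = 0" by (intro prod_zero) auto
    moreover obtain S where S: "L.twisted_separated (Suc c) S" "infinite S"
      using L.infinite_twisted_separated[of c "lyndon_rank" "lyndon_coord" "\<lambda>k. graded_matrix k (endo_matrix \<Phi>)"]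
        lyndon_lc_coordinates True by blast
    have "reidemeister_number NG \<phi> = \<infinity>"
      by (rule reidemeister_number_transversal(1)[OF N.is_group \<phi> cl[OF S(1)] sep[OF S(1)] S(2)])
    ultimately show ?thesis by (simp add: abs_infty_def)
  next
    case False
    obtain S where S: "L.twisted_separated (Suc c) S" "L.twisted_covering (Suc c) S" "finite S"
      "card S = (\<Prod>k=1..c. nat \<bar>?d k\<bar>)"
      using L.twisted_transversal(2)[of c "lyndon_rank" "lyndon_coord" "\<lambda>k. graded_matrix k (endo_matrix \<Phi>)"]
        lyndon_lc_coordinates False by blast
    have e: "int (\<Prod>k=1..c. nat \<bar>?d k\<bar>) = \<bar>\<Prod>k=1..c. ?d k\<bar>" by (simp add: abs_prod)
    have "reidemeister_number NG \<phi> = enat (card S)"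
    proof (rule reidemeister_number_transversal(2)[OF N.is_group \<phi> cl[OF S(1)] sep[OF S(1)] S(3)])
      fix x assume "x \<in> carrier NG"
      then obtain g where g: "g \<in> carrier FR" "x = nil_proj g" using nil_proj_surj by (metis imageE)
      then obtain s where "s \<in> S" "L.twisted_cong (Suc c) g s" "s \<in> carrier FR"
        using S(2) unfolding L.twisted_covering_def by blast
      then show "\<exists>s\<in>S. (x, nil_proj s) \<in> twisted_conj NG \<phi>"
        using twisted_conj_nil_proj g by blast
    qed
    moreover have "(\<Prod>k=1..c. ?d k) \<noteq> 0" using False by auto
    moreover have "nat \<bar>\<Prod>k=1..c. ?d k\<bar> = (\<Prod>k=1..c. nat \<bar>?d k\<bar>)" unfolding e[symmetric] by (rule nat_int)
    ultimately show ?thesis using S(4) by (simp add: abs_infty_def)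
  qed
qed

end
end
end

end

theorem theorem2p11:
  fixes r c :: nat
  assumes "r \<ge> 2" and "c \<ge> 2"
  shows "\<exists>g :: nat \<Rightarrow> int_mpoly. (\<forall>k\<in>{1..c}. g k \<in> mpolys_in {1..r}) \<and>
    (\<forall>\<phi> \<in> hom (free_nilpotent r c) (free_nilpotent r c).
       let \<gamma>\<^sub>2 = lower_central (free_nilpotent r c) 2;
           p = endo_char_poly (free_nilpotent r c Mod \<gamma>\<^sub>2) r
                 (induced_map (free_nilpotent r c) \<gamma>\<^sub>2 \<phi>)
       in reidemeister_number (free_nilpotent r c) \<phi> =
            abs_infty (\<Prod>k=1..c. mpoly_eval (\<lambda>i. poly.coeff p (i - 1)) (g k)))"
proof -
  have r: "r > 0" and c: "c > 0" using assms by auto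
  \<comment> \<open>The polynomials are chosen from \<open>r\<close> and \<open>k\<close> alone;
    \<open>c\<close> only decides how many of them are multiplied.\<close>
  have "\<exists>p\<in>mpolys_in {1..r}. \<forall>A\<in>carrier_mat r r.
      det (1\<^sub>m (lyndon_rank r k) - graded_matrix r k A) = mpoly_eval (\<lambda>i. coeff (char_poly A) (i - 1)) p"
    if "k \<ge> 1" for k
    by (rule graded_det_mpoly[OF r that])
  then obtain g where g: "\<And>k. k \<ge> 1 \<Longrightarrow> g k \<in> mpolys_in {1..r}"
    "\<And>k A. k \<ge> 1 \<Longrightarrow> A \<in> carrier_mat r r \<Longrightarrow>
      det (1\<^sub>m (lyndon_rank r k) - graded_matrix r k A) = mpoly_eval (\<lambda>i. coeff (char_poly A) (i - 1)) (g k)"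
    by metis
  show ?thesis
  proof (intro exI[of _ g] conjI ballI)
    show "g k \<in> mpolys_in {1..r}" if "k \<in> {1..c}" for k using g(1) that by simp
    fix \<phi> assume \<phi>: "\<phi> \<in> hom (free_nilpotent r c) (free_nilpotent r c)"
    obtain \<Phi> where \<Phi>: "\<Phi> \<in> hom (free_group r) (free_group r)"
      "\<And>g. g \<in> carrier (free_group r) \<Longrightarrow> \<phi> (nil_proj r c g) = nil_proj r c (\<Phi> g)"
      using free_lift[OF c \<phi>] by blast
    have "reidemeister_number (free_nilpotent r c) \<phi> = abs_infty (\<Prod>k=1..c.
        det (1\<^sub>m (lyndon_rank r k) - graded_matrix r k (endo_matrix r \<Phi>)))"
      by (rule reidemeister_number_prod_det[OF c \<phi> \<Phi>])
    also have "(\<Prod>k=1..c. det (1\<^sub>m (lyndon_rank r k) - graded_matrix r k (endo_matrix r \<Phi>))) =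
        (\<Prod>k=1..c. mpoly_eval (\<lambda>i. coeff (char_poly (endo_matrix r \<Phi>)) (i - 1)) (g k))"
      using g(2)[OF _ endo_matrix_carrier] by (intro prod.cong) auto
    finally show "let \<gamma>\<^sub>2 = lower_central (free_nilpotent r c) 2;
           p = endo_char_poly (free_nilpotent r c Mod \<gamma>\<^sub>2) r
                 (induced_map (free_nilpotent r c) \<gamma>\<^sub>2 \<phi>)
       in reidemeister_number (free_nilpotent r c) \<phi> =
            abs_infty (\<Prod>k=1..c. mpoly_eval (\<lambda>i. poly.coeff p (i - 1)) (g k))"
      using endo_char_poly_induced[OF c \<phi> \<Phi>] by (simp only: Let_def)
  qed
qed

end
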